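(* Let $N\ge 2$, let $\Omega\subset\mathbb{R}^N$ be a bounded Lipschitz domain, and let $k\in\mathbb{N}$. Then the map $p\mapsto\lambda_k^{DR}(p;\Omega)$ is continuous in $(1,+\infty)$.
   Context: $\mathbb{N}=\{1,2,\dots\}$; $\mathbb{S}^{k-1}$ is the unit Euclidean sphere in $\mathbb{R}^k$. For $p\in(1,+\infty)$, let $\mathcal{S}(\Omega)=\{u\in W_0^{1,p}(\Omega):\int_\Omega|u|^p\,dx=1\}$ (with the topology of $W_0^{1,p}(\Omega)$) and $E(u)=\int_\Omega|\nabla u|^p\,dx$. Define $$\lambda_k^{DR}(p;\Omega)=\inf_{A\in\Sigma_k^{DR}}\max_{u\in A}E(u),$$ where $\Sigma_k^{DR}$ is the family of all sets $A\subset\mathcal{S}(\Omega)$ of the form $A=h(\mathbb{S}^{k-1})$ for some continuous odd map $h:\mathbb{S}^{k-1}\to\mathcal{S}(\Omega)$. *)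

theory Defs
  imports "HOL-Analysis.Analysis"
begin

text \<open>
  Throughout, an element of a Lebesgue or Sobolev space on \<open>\<Omega>\<close> is given by a representative, i.e. a
  function on the whole ambient space of which only the values on \<open>\<Omega>\<close>, up to Lebesgue null sets,
  matter.
\<close>

subsection \<open>Bounded Lipschitz domains\<close>

text \<open>
  The unit vector \<open>e\<close> is the last axis of a rotated orthonormal coordinate system; the point
  \<open>y - (y \<bullet> e) *\<^sub>R e\<close> of the hyperplane orthogonal to \<open>e\<close> collects the remaining \<open>N - 1\<close> coordinates
  of \<open>y\<close>.
\<close>

definition bounded_Lipschitz_domain :: "'a::euclidean_space set \<Rightarrow> bool" where
  "bounded_Lipschitz_domain \<Omega> \<longleftrightarrow>
     open \<Omega> \<and> connected \<Omega> \<and> \<Omega> \<noteq> {} \<and> bounded \<Omega> \<and>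
     (\<forall>x\<in>frontier \<Omega>. \<exists>r>0. \<exists>e \<gamma> C. norm e = 1 \<and>
        C-lipschitz_on {z. z \<bullet> e = 0} (\<gamma> :: 'a \<Rightarrow> real) \<and>
        \<Omega> \<inter> ball x r = {y \<in> ball x r. \<gamma> (y - (y \<bullet> e) *\<^sub>R e) < y \<bullet> e})"

subsection \<open>Test functions\<close>

definition partial_deriv :: "'a::euclidean_space \<Rightarrow> ('a \<Rightarrow> real) \<Rightarrow> 'a \<Rightarrow> real" where
  "partial_deriv i f x = frechet_derivative f (at x) i"

primrec C_differentiable :: "nat \<Rightarrow> ('a::euclidean_space \<Rightarrow> real) \<Rightarrow> bool" where
  "C_differentiable 0 f \<longleftrightarrow> continuous_on UNIV f"
| "C_differentiable (Suc m) f \<longleftrightarrow>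
     f differentiable_on UNIV \<and> (\<forall>i\<in>Basis. C_differentiable m (partial_deriv i f))"

definition test_functions :: "'a::euclidean_space set \<Rightarrow> ('a \<Rightarrow> real) set" where
  "test_functions \<Omega> =
     {\<phi>. (\<forall>m. C_differentiable m \<phi>) \<and> compact (closure {x. \<phi> x \<noteq> 0}) \<and> closure {x. \<phi> x \<noteq> 0} \<subseteq> \<Omega>}"

subsection \<open>Sobolev spaces\<close>

definition Lp_space :: "real \<Rightarrow> 'a::euclidean_space set \<Rightarrow> ('a \<Rightarrow> 'b::euclidean_space) set" where
  "Lp_space p \<Omega> = {f \<in> borel_measurable (lebesgue_on \<Omega>).
     integrable (lebesgue_on \<Omega>) (\<lambda>x. norm (f x) powr p)}"

definition locally_integrable ::
  "'a::euclidean_space set \<Rightarrow> ('a \<Rightarrow> 'b::euclidean_space) \<Rightarrow> bool" where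
  "locally_integrable \<Omega> f \<longleftrightarrow> (\<forall>K. compact K \<and> K \<subseteq> \<Omega> \<longrightarrow> f absolutely_integrable_on K)"

definition has_weak_gradient ::
  "'a::euclidean_space set \<Rightarrow> ('a \<Rightarrow> real) \<Rightarrow> ('a \<Rightarrow> 'a) \<Rightarrow> bool" where
  "has_weak_gradient \<Omega> u g \<longleftrightarrow> locally_integrable \<Omega> u \<and> locally_integrable \<Omega> g \<and>
     (\<forall>\<phi>\<in>test_functions \<Omega>. \<forall>i\<in>Basis.
        (\<integral>x. u x * partial_deriv i \<phi> x \<partial>lebesgue_on \<Omega>) = - (\<integral>x. (g x \<bullet> i) * \<phi> x \<partial>lebesgue_on \<Omega>))"

text \<open>The weak gradient is unique up to null sets, so the choice below is immaterial.\<close>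

definition weak_gradient :: "'a::euclidean_space set \<Rightarrow> ('a \<Rightarrow> real) \<Rightarrow> 'a \<Rightarrow> 'a" where
  "weak_gradient \<Omega> u = (SOME g. has_weak_gradient \<Omega> u g)"

definition W1p :: "real \<Rightarrow> 'a::euclidean_space set \<Rightarrow> ('a \<Rightarrow> real) set" where
  "W1p p \<Omega> = {u \<in> Lp_space p \<Omega>. \<exists>g\<in>Lp_space p \<Omega>. has_weak_gradient \<Omega> u g}"

definition energy :: "real \<Rightarrow> 'a::euclidean_space set \<Rightarrow> ('a \<Rightarrow> real) \<Rightarrow> real" where
  "energy p \<Omega> u = (\<integral>x. norm (weak_gradient \<Omega> u x) powr p \<partial>lebesgue_on \<Omega>)"

definition W1p_norm :: "real \<Rightarrow> 'a::euclidean_space set \<Rightarrow> ('a \<Rightarrow> real) \<Rightarrow> real" where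
  "W1p_norm p \<Omega> u = ((\<integral>x. \<bar>u x\<bar> powr p \<partial>lebesgue_on \<Omega>) + energy p \<Omega> u) powr (1 / p)"

definition W0 :: "real \<Rightarrow> 'a::euclidean_space set \<Rightarrow> ('a \<Rightarrow> real) set" where
  "W0 p \<Omega> = {u \<in> W1p p \<Omega>. \<forall>\<epsilon>>0. \<exists>\<phi>\<in>test_functions \<Omega>. W1p_norm p \<Omega> (\<lambda>x. u x - \<phi> x) < \<epsilon>}"

text \<open>
  The norm topology of \<open>W0 p \<Omega>\<close>. On representatives it is not Hausdorff: functions that agree almost
  everywhere on \<open>\<Omega>\<close> have the same neighbourhoods.
\<close>

definition W0_topology :: "real \<Rightarrow> 'a::euclidean_space set \<Rightarrow> ('a \<Rightarrow> real) topology" where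
  "W0_topology p \<Omega> = topology (\<lambda>U. U \<subseteq> W0 p \<Omega> \<and>
     (\<forall>u\<in>U. \<exists>\<epsilon>>0. \<forall>v\<in>W0 p \<Omega>. W1p_norm p \<Omega> (\<lambda>x. v x - u x) < \<epsilon> \<longrightarrow> v \<in> U))"

lemma openin_W0_topology:
  "openin (W0_topology p \<Omega>) U \<longleftrightarrow> U \<subseteq> W0 p \<Omega> \<and>
     (\<forall>u\<in>U. \<exists>\<epsilon>>0. \<forall>v\<in>W0 p \<Omega>. W1p_norm p \<Omega> (\<lambda>x. v x - u x) < \<epsilon> \<longrightarrow> v \<in> U)"
proof -
  let ?P = "\<lambda>U. U \<subseteq> W0 p \<Omega> \<and>
     (\<forall>u\<in>U. \<exists>\<epsilon>>0. \<forall>v\<in>W0 p \<Omega>. W1p_norm p \<Omega> (\<lambda>x. v x - u x) < \<epsilon> \<longrightarrow> v \<in> U)"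
  have "?P (S \<inter> T)" if S: "?P S" and T: "?P T" for S T
  proof (intro conjI ballI)
    show "S \<inter> T \<subseteq> W0 p \<Omega>" using S by blast
  next
    fix u assume "u \<in> S \<inter> T"
    then obtain a b where a: "a > 0" "\<forall>v\<in>W0 p \<Omega>. W1p_norm p \<Omega> (\<lambda>x. v x - u x) < a \<longrightarrow> v \<in> S"
      and b: "b > 0" "\<forall>v\<in>W0 p \<Omega>. W1p_norm p \<Omega> (\<lambda>x. v x - u x) < b \<longrightarrow> v \<in> T"
      using S T by blast
    show "\<exists>\<epsilon>>0. \<forall>v\<in>W0 p \<Omega>. W1p_norm p \<Omega> (\<lambda>x. v x - u x) < \<epsilon> \<longrightarrow> v \<in> S \<inter> T"
      using a b by (intro exI[of _ "min a b"]) auto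
  qed
  moreover have "?P (\<Union>\<K>)" if "\<forall>K\<in>\<K>. ?P K" for \<K>
  proof (intro conjI ballI)
    show "\<Union>\<K> \<subseteq> W0 p \<Omega>" using that by blast
  next
    fix u assume "u \<in> \<Union>\<K>"
    then obtain K where "K \<in> \<K>" "u \<in> K" by blast
    then show "\<exists>\<epsilon>>0. \<forall>v\<in>W0 p \<Omega>. W1p_norm p \<Omega> (\<lambda>x. v x - u x) < \<epsilon> \<longrightarrow> v \<in> \<Union>\<K>"
      using that by (meson UnionI)
  qed
  ultimately have "istopology ?P"
    unfolding istopology_def by blast
  then show ?thesis
    unfolding W0_topology_def by (simp add: topology_inverse')
qed

lemma topspace_W0_topology [simp]: "topspace (W0_topology p \<Omega>) = W0 p \<Omega>"
proof (rule antisym)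
  show "topspace (W0_topology p \<Omega>) \<subseteq> W0 p \<Omega>"
    using openin_W0_topology openin_topspace by blast
  have "openin (W0_topology p \<Omega>) (W0 p \<Omega>)"
    unfolding openin_W0_topology by (auto intro: exI[of _ 1])
  then show "W0 p \<Omega> \<subseteq> topspace (W0_topology p \<Omega>)"
    by (rule openin_subset)
qed

subsection \<open>The variational eigenvalues\<close>

definition unit_Lp_sphere :: "real \<Rightarrow> 'a::euclidean_space set \<Rightarrow> ('a \<Rightarrow> real) set" where
  "unit_Lp_sphere p \<Omega> = {u \<in> W0 p \<Omega>. (\<integral>x. \<bar>u x\<bar> powr p \<partial>lebesgue_on \<Omega>) = 1}"

text \<open>
  \<open>nsphere (k - 1)\<close> is the unit sphere of Euclidean \<open>k\<close>-space (\<open>k \<ge> 1\<close>), whose points are sequences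
  vanishing from index \<open>k\<close> on. Oddness of \<open>h\<close> is an identity between elements of the Sobolev
  space, hence holds almost everywhere.
\<close>

definition Sigma_DR :: "nat \<Rightarrow> real \<Rightarrow> 'a::euclidean_space set \<Rightarrow> ('a \<Rightarrow> real) set set" where
  "Sigma_DR k p \<Omega> = {h ` topspace (nsphere (k - 1)) | h.
     continuous_map (nsphere (k - 1)) (subtopology (W0_topology p \<Omega>) (unit_Lp_sphere p \<Omega>)) h \<and>
     (\<forall>\<xi>\<in>topspace (nsphere (k - 1)). AE x in lebesgue_on \<Omega>. h (\<lambda>i. - \<xi> i) x = - h \<xi> x)}"

definition lambda_DR :: "nat \<Rightarrow> real \<Rightarrow> 'a::euclidean_space set \<Rightarrow> real" where
  "lambda_DR k p \<Omega> = (INF A\<in>Sigma_DR k p \<Omega>. GREATEST c. c \<in> energy p \<Omega> ` A)"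

end

theory Submission
  imports Defs
begin

text \<open>
  For every \<open>\<eta> > 0\<close> there is one linear operator \<open>T\<close>, independent of \<open>p\<close>, which almost preserves
  \<open>\<integral>\<bar>u\<bar>\<^sup>p\<close> and increases \<open>\<integral>\<bar>\<nabla>u\<bar>\<^sup>p\<close> by at most \<open>\<eta>\<close> times the Sobolev norm, uniformly for \<open>p\<close> in
  \<open>{1..b}\<close>, and which maps \<open>L\<^sup>1(\<Omega>)\<close> into test functions with \<open>\<bar>T u\<bar>\<close> and \<open>\<bar>\<nabla>(T u)\<bar>\<close> bounded by
  \<open>C \<integral>\<bar>u\<bar>\<close>: a partition of unity cuts \<open>u\<close> into pieces, each of which is shifted into \<open>\<Omega>\<close> along the
  axis of a Lipschitz chart and then mollified. Since \<open>T\<close> is linear and bounded, it turns an odd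
  continuous map into the sphere for \<open>p\<close> into one for any other exponent \<open>q\<close>; and since \<open>T u\<close> and
  its gradient are uniformly bounded, replacing \<open>p\<close> by a close \<open>q\<close> hardly changes the two integrals.
  Hence \<open>\<lambda>(q) \<le> \<lambda>(p) + \<epsilon>\<close> for \<open>p\<close>, \<open>q\<close> close together, as long as \<open>\<lambda>(p)\<close> stays bounded.
\<close>

subsection \<open>Calculus of test functions\<close>

text \<open>Density of the test functions does not suffice: it approximates each element separately,
  while an odd map needs one continuous odd choice with a single bound for all its values. Moreover
  the gradient may only grow by a factor close to 1, not by a constant. The product rule settles
  this. Moving the derivative from the mollifiers back to the pieces splits the gradient of the
  image of \<phi> into averages of \<theta>_i grad \<phi> and averages of \<phi> grad \<theta>_i.
  The first are summed over i before they are estimated: the summed kernel has mass at most about 1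
  in both variables, so Jensen and Tonelli cost almost nothing. The second are small because the
  gradients of a partition of unity add up to 0 on \<Omega>. The Lipschitz condition enters through
  a cone: near a boundary point one direction moves the points of \<Omega> away from the complement
  by a distance proportional to the shift. All estimates concern p-th powers without roots, so that
  their constants depend only on an upper bound \<open>b\<close> of the exponents.\<close>

lemma C_differentiable_antimono: "C_differentiable (Suc m) f \<Longrightarrow> C_differentiable m f"
proof (induction m arbitrary: f)
  case 0
  then show ?case by (auto intro: differentiable_imp_continuous_on)
next
  case (Suc m)
  then show ?case by (metis C_differentiable.simps(2))
qed

lemma partial_deriv_eqI:
  assumes "(f has_derivative f') (at x)"
  shows "partial_deriv i f x = f' i"
  using frechet_derivative_at[OF assms] by (simp add: partial_deriv_def)

text \<open>For derivatives known in closed form: membership in the next class reduces to that of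
  the explicit coefficients in the present one.\<close>

lemma C_differentiable_SucI:
  assumes "\<And>x. (f has_derivative f' x) (at x)"
    and "\<And>i. i \<in> Basis \<Longrightarrow> C_differentiable m (\<lambda>x. f' x i)"
  shows "C_differentiable (Suc m) f"
proof -
  have "partial_deriv i f = (\<lambda>x. f' x i)" for i
    using partial_deriv_eqI[OF assms(1)] by blast
  moreover have "f differentiable_on UNIV"
    using assms(1) by (auto simp: differentiable_on_def differentiable_def)
  ultimately show ?thesis using assms(2) by simp
qed

definition grad :: "('a::euclidean_space \<Rightarrow> real) \<Rightarrow> 'a \<Rightarrow> 'a" where
  "grad f x = (\<Sum>i\<in>Basis. partial_deriv i f x *\<^sub>R i)"

lemma grad_inner_Basis: "i \<in> Basis \<Longrightarrow> grad f x \<bullet> i = partial_deriv i f x"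
  by (simp add: grad_def inner_sum_left inner_Basis if_distrib cong: if_cong)

lemma grad_eqI:
  assumes "(f has_derivative (\<lambda>h. g \<bullet> h)) (at x)"
  shows "grad f x = g"
  using partial_deriv_eqI[OF assms] by (intro euclidean_eqI[of "grad f x" g]) (simp add: grad_inner_Basis)

lemma has_derivative_grad:
  assumes "f differentiable (at x)"
  shows "(f has_derivative (\<lambda>h. grad f x \<bullet> h)) (at x)"
proof -
  obtain f' where f': "(f has_derivative f') (at x)" using assms differentiable_def by blast
  then interpret bounded_linear f' by (rule has_derivative_bounded_linear)
  have "f' h = grad f x \<bullet> h" for h
  proof -
    have "f' h = f' (\<Sum>i\<in>Basis. (h \<bullet> i) *\<^sub>R i)" by (simp add: euclidean_representation)
    also have "\<dots> = (\<Sum>i\<in>Basis. (h \<bullet> i) * f' i)" by (simp add: sum scaleR)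
    also have "\<dots> = grad f x \<bullet> h"
      by (simp add: grad_def inner_sum_left inner_sum_right partial_deriv_eqI[OF f'] inner_commute mult.commute)
    finally show ?thesis .
  qed
  then show ?thesis using f' by (metis (no_types, lifting) ext)
qed

lemma C_differentiable_Suc_derivative:
  assumes "C_differentiable (Suc m) f"
  shows "(f has_derivative (\<lambda>h. grad f x \<bullet> h)) (at x)"
  using assms by (intro has_derivative_grad) (auto simp: differentiable_on_def)

lemma continuous_on_grad:
  assumes "C_differentiable (Suc m) f"
  shows "continuous_on S (grad f)"
proof -
  have "C_differentiable (Suc 0) f"
    using assms by (induction m) (blast dest: C_differentiable_antimono)+
  then have "\<forall>i\<in>Basis. continuous_on UNIV (partial_deriv i f)" by simp
  then have "continuous_on UNIV (grad f)"
    unfolding grad_def by (auto intro!: continuous_intros)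
  then show ?thesis using continuous_on_subset by blast
qed

lemma C_differentiable_imp_continuous: "C_differentiable m f \<Longrightarrow> continuous_on S f"
proof (induction m)
  case 0
  then show ?case using continuous_on_subset by auto
qed (blast dest: C_differentiable_antimono)

lemma C_differentiable_const [simp]: "C_differentiable m (\<lambda>x. c)"
proof (induction m arbitrary: c)
  case (Suc m)
  show ?case by (rule C_differentiable_SucI[of _ "\<lambda>_ _. 0"]) (auto simp: Suc)
qed auto

lemma C_differentiable_add:
  "C_differentiable m f \<Longrightarrow> C_differentiable m g \<Longrightarrow> C_differentiable m (\<lambda>x. f x + g x)"
proof (induction m arbitrary: f g)
  case (Suc m)
  show ?case
  proof (rule C_differentiable_SucI)
    show "((\<lambda>x. f x + g x) has_derivative (\<lambda>h. grad f x \<bullet> h + grad g x \<bullet> h)) (at x)" for x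
      by (intro derivative_intros C_differentiable_Suc_derivative[OF Suc.prems(1)]
          C_differentiable_Suc_derivative[OF Suc.prems(2)])
    show "C_differentiable m (\<lambda>x. grad f x \<bullet> i + grad g x \<bullet> i)" if "i \<in> Basis" for i
      using Suc that by (simp add: grad_inner_Basis)
  qed
qed (auto intro: continuous_intros)

lemma C_differentiable_mult:
  "C_differentiable m f \<Longrightarrow> C_differentiable m g \<Longrightarrow> C_differentiable m (\<lambda>x. f x * g x)"
proof (induction m arbitrary: f g)
  case (Suc m)
  show ?case
  proof (rule C_differentiable_SucI)
    show "((\<lambda>x. f x * g x) has_derivative (\<lambda>h. f x * (grad g x \<bullet> h) + (grad f x \<bullet> h) * g x)) (at x)" for x
      by (intro derivative_intros C_differentiable_Suc_derivative[OF Suc.prems(1)]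
          C_differentiable_Suc_derivative[OF Suc.prems(2)])
    show "C_differentiable m (\<lambda>x. f x * (grad g x \<bullet> i) + (grad f x \<bullet> i) * g x)" if "i \<in> Basis" for i
      using Suc that C_differentiable_antimono[OF Suc.prems(1)] C_differentiable_antimono[OF Suc.prems(2)]
      by (auto simp: grad_inner_Basis intro!: C_differentiable_add)
  qed
qed (auto intro: continuous_intros)

lemma C_differentiable_sum:
  "(\<And>i. i \<in> I \<Longrightarrow> C_differentiable m (f i)) \<Longrightarrow> C_differentiable m (\<lambda>x. \<Sum>i\<in>I. f i x)"
  by (induction I rule: infinite_finite_induct) (auto intro: C_differentiable_add)

lemma C_differentiable_inner: "C_differentiable m (\<lambda>x. (x - c) \<bullet> b)"
proof (cases m)
  case (Suc k)
  show ?thesis unfolding Suc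
    by (rule C_differentiable_SucI[of _ "\<lambda>x h. h \<bullet> b"]) (auto intro!: derivative_eq_intros)
qed (auto intro!: continuous_intros)

section \<open>Smooth bump functions\<close>

definition flat_exp :: "nat \<Rightarrow> real \<Rightarrow> real" where
  "flat_exp n t = (if t > 0 then exp (- 1 / t) / t ^ n else 0)"

text \<open>The derivative is a combination of members of the same family, which is why the power
  \<open>n\<close> is carried as a parameter.\<close>

lemma flat_exp_has_derivative:
  "(flat_exp n has_real_derivative flat_exp (n + 2) t - real n * flat_exp (n + 1) t) (at t)"
proof -
  consider "t > 0" | "t < 0" | "t = 0" by linarith
  then show ?thesis
  proof cases
    case 1
    have "((\<lambda>t. exp (- 1 / t) / t ^ n) has_real_derivative flat_exp (n + 2) t - real n * flat_exp (n + 1) t) (at t)"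
    proof -
      \<comment> \<open>The truncated exponent \<open>n - Suc 0\<close> is harmless for
        \<open>n = 0\<close>, because the factor \<open>real n\<close> then vanishes.\<close>
      have n: "real n * t ^ n = real n * (t * t ^ (n - Suc 0))"
        by (cases n) auto
      have "((\<lambda>t. exp (- 1 / t)) has_real_derivative exp (- 1 / t) / t\<^sup>2) (at t)"
        using 1 by (auto intro!: derivative_eq_intros simp: power2_eq_square)
      from DERIV_divide[OF this DERIV_pow[of n]] show ?thesis
        using 1 n by (auto elim!: DERIV_cong simp: flat_exp_def field_simps power2_eq_square)
    qed

    then show ?thesis
      by (rule has_field_derivative_transform_within_open[where S = "{0<..}"])
        (use 1 in \<open>auto simp: flat_exp_def\<close>)
  next
    case 2
    have "((\<lambda>t. 0) has_real_derivative flat_exp (n + 2) t - real n * flat_exp (n + 1) t) (at t)"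
      using 2 by (simp add: flat_exp_def)
    then show ?thesis
      by (rule has_field_derivative_transform_within_open[where S = "{..<0}"])
        (use 2 in \<open>auto simp: flat_exp_def\<close>)
  next
    case 3
    \<comment> \<open>With s = 1 / h the quotient becomes s^(n+1) / exp s, and the exponential beats
      every power.\<close>
    have "((\<lambda>h. exp (- 1 / h) / h ^ n / h) \<longlongrightarrow> 0) (at_right (0::real))"
    proof -
      have "((\<lambda>h. (inverse h) ^ Suc n / exp (inverse h)) \<longlongrightarrow> 0) (at_right (0::real))"
        by (rule filterlim_compose[OF tendsto_power_div_exp_0 filterlim_inverse_at_top_right])
      then show ?thesis
        by (rule Lim_transform_eventually)
          (auto simp: eventually_at_filter exp_minus field_simps)
    qed
    then have "((\<lambda>h. flat_exp n h / h) \<longlongrightarrow> 0) (at_right 0)"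
      by (rule Lim_transform_eventually)
        (auto simp: flat_exp_def eventually_at_filter)
    moreover have "((\<lambda>h. flat_exp n h / h) \<longlongrightarrow> 0) (at_left 0)"
      by (rule Lim_transform_eventually[OF tendsto_const])
        (auto simp: flat_exp_def eventually_at_filter)
    ultimately have "((\<lambda>h. flat_exp n h / h) \<longlongrightarrow> 0) (at 0)"
      by (simp add: filterlim_split_at)
    then show ?thesis using 3 by (simp add: DERIV_def flat_exp_def)

  qed
qed

text \<open>The squared distance is a polynomial in \<open>x\<close>, so no singularity arises at
  the centre.\<close>

definition bump :: "'a::euclidean_space \<Rightarrow> real \<Rightarrow> 'a \<Rightarrow> real" where
  "bump c r x = flat_exp 0 (r\<^sup>2 - (x - c) \<bullet> (x - c))"

text \<open>Each partial derivative is a linear polynomial times a combination of the same functions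
  with larger \<open>n\<close>; the induction therefore ranges over all \<open>n\<close>.\<close>

lemma C_differentiable_flat_exp:
  "C_differentiable m (\<lambda>x. flat_exp n (r\<^sup>2 - (x - c) \<bullet> (x - c)))"
proof (induction m arbitrary: n)
  case 0
  have "continuous_on UNIV (flat_exp n)"
    by (rule DERIV_continuous_on, rule has_field_derivative_at_within[OF flat_exp_has_derivative])
  from continuous_on_compose2[OF this, of UNIV "\<lambda>x. r\<^sup>2 - (x - c) \<bullet> (x - c)"]
  show ?case by (simp add: continuous_intros)
next
  case (Suc m)
  let ?s = "\<lambda>x. r\<^sup>2 - (x - c) \<bullet> (x - c)"
  let ?D = "\<lambda>x. flat_exp (n + 2) (?s x) + (- real n) * flat_exp (n + 1) (?s x)"
  show ?case
  proof (rule C_differentiable_SucI)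
    fix x
    have "((\<lambda>x. flat_exp n (?s x)) has_derivative (\<lambda>h. - 2 * ((x - c) \<bullet> h) * ?D x)) (at x)"
      by (rule DERIV_compose_FDERIV[of "flat_exp n"])
        (use flat_exp_has_derivative[of n "?s x"] in
          \<open>auto intro!: derivative_eq_intros simp: inner_commute algebra_simps\<close>)
    then show "((\<lambda>x. flat_exp n (?s x)) has_derivative (\<lambda>h. - 2 * ((x - c) \<bullet> h) * ?D x)) (at x)" .
    show "C_differentiable m (\<lambda>x. - 2 * ((x - c) \<bullet> i) * ?D x)" for i
      by (intro C_differentiable_mult C_differentiable_add Suc C_differentiable_inner C_differentiable_const)
  qed
qed

lemma C_differentiable_bump: "C_differentiable m (bump c r)"
  unfolding bump_def by (rule C_differentiable_flat_exp)

lemma bump_nonneg: "bump c r x \<ge> 0"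
  by (simp add: bump_def flat_exp_def)

lemma bump_pos_iff: "r > 0 \<Longrightarrow> bump c r x > 0 \<longleftrightarrow> x \<in> ball c r"
proof -
  assume r: "r > 0"
  have "(x - c) \<bullet> (x - c) < r\<^sup>2 \<longleftrightarrow> dist c x < r"
    using r power2_less_imp_less[of "dist c x" r] power_strict_mono[of "dist c x" r 2]
    by (auto simp: dist_norm norm_minus_commute dot_square_norm)
  then show ?thesis by (simp add: bump_def flat_exp_def)
qed

lemma bump_eq_0_iff: "r > 0 \<Longrightarrow> bump c r x = 0 \<longleftrightarrow> x \<notin> ball c r"
  using bump_pos_iff[of r c x] bump_nonneg[of c r x] by linarith

section \<open>Membership in the space of test functions\<close>

lemma test_functionsI:
  assumes "\<And>m. C_differentiable m f" "compact K" "K \<subseteq> \<Omega>" "\<And>x. x \<notin> K \<Longrightarrow> f x = 0"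
  shows "f \<in> test_functions \<Omega>"
proof -
  have "closure {x. f x \<noteq> 0} \<subseteq> K"
    using assms(2,4) by (intro closure_minimal compact_imp_closed) auto
  then have "compact (closure {x. f x \<noteq> 0}) \<and> closure {x. f x \<noteq> 0} \<subseteq> \<Omega>"
    using assms(2,3) compact_closure compact_imp_bounded bounded_subset closure_subset by (meson order_trans)
  with assms(1) show ?thesis unfolding test_functions_def by simp
qed

lemma test_functionsE:
  assumes "f \<in> test_functions \<Omega>"
  obtains K where "compact K" "K \<subseteq> \<Omega>" "\<And>x. x \<notin> K \<Longrightarrow> f x = 0"
proof (rule that[of "closure {x. f x \<noteq> 0}"])
  show "f x = 0" if "x \<notin> closure {x. f x \<noteq> 0}" for x
    using that closure_subset[of "{x. f x \<noteq> 0}"] by blast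
qed (use assms in \<open>simp_all add: test_functions_def\<close>)

lemma test_functions_smooth: "f \<in> test_functions \<Omega> \<Longrightarrow> C_differentiable m f"
  by (simp add: test_functions_def)

lemma test_functions_add:
  assumes "f \<in> test_functions \<Omega>" "g \<in> test_functions \<Omega>"
  shows "(\<lambda>x. f x + g x) \<in> test_functions \<Omega>"
proof -
  obtain K L where "compact K" "K \<subseteq> \<Omega>" "\<And>x. x \<notin> K \<Longrightarrow> f x = 0"
    "compact L" "L \<subseteq> \<Omega>" "\<And>x. x \<notin> L \<Longrightarrow> g x = 0"
    using assms test_functionsE by metis
  then show ?thesis
    using assms[THEN test_functions_smooth]
    by (intro test_functionsI[of _ "K \<union> L"] C_differentiable_add) auto
qed

lemma test_functions_cmult:
  assumes "f \<in> test_functions \<Omega>"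
  shows "(\<lambda>x. c * f x) \<in> test_functions \<Omega>"
proof -
  obtain K where "compact K" "K \<subseteq> \<Omega>" "\<And>x. x \<notin> K \<Longrightarrow> f x = 0"
    using assms test_functionsE by metis
  then show ?thesis
    using assms[THEN test_functions_smooth]
    by (intro test_functionsI[of _ K] C_differentiable_mult C_differentiable_const) auto
qed

lemma test_functions_zero: "(\<lambda>x. 0) \<in> test_functions \<Omega>"
  by (rule test_functionsI[of _ "{}"]) auto

lemma test_functions_sum:
  "(\<And>i. i \<in> I \<Longrightarrow> f i \<in> test_functions \<Omega>) \<Longrightarrow> (\<lambda>x. \<Sum>i\<in>I. f i x) \<in> test_functions \<Omega>"
  by (induction I rule: infinite_finite_induct) (auto intro: test_functions_add test_functions_zero)

lemma bump_test_function:
  assumes "r > 0" "cball c r \<subseteq> \<Omega>"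
  shows "bump c r \<in> test_functions \<Omega>"
proof (rule test_functionsI[OF C_differentiable_bump compact_cball assms(2)])
  show "bump c r x = 0" if "x \<notin> cball c r" for x
    using that bump_eq_0_iff[OF assms(1), of c x] by auto
qed

section \<open>Uniform estimates under compact support\<close>

lemma uniformly_continuous_compact_support:
  fixes f :: "'a::euclidean_space \<Rightarrow> 'b::real_normed_vector"
  assumes "continuous_on UNIV f" "compact K" "\<And>x. x \<notin> K \<Longrightarrow> f x = 0"
  shows "uniformly_continuous_on UNIV f"
proof -
  obtain B where B: "K \<subseteq> ball 0 B" using bounded_subset_ballD compact_imp_bounded assms(2) by blast
  have "uniformly_continuous_on (cball 0 (B + 1)) f"
    using assms by (intro compact_uniformly_continuous) (auto intro: continuous_on_subset)
  show ?thesis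
  unfolding uniformly_continuous_on_def
  proof (intro allI impI)
    fix e :: real assume "e > 0"
    then obtain d where d: "d > 0" "\<And>x y. x \<in> cball 0 (B+1) \<Longrightarrow> y \<in> cball 0 (B+1) \<Longrightarrow> dist y x < d \<Longrightarrow> dist (f y) (f x) < e"
      using \<open>uniformly_continuous_on (cball 0 (B + 1)) f\<close> unfolding uniformly_continuous_on_def by metis
    \<comment> \<open>The margin 1 ensures that when one of two close points leaves the ball of
      radius \<open>B + 1\<close>, neither of them lies in \<open>K\<close>, and \<open>f\<close>
      vanishes at both.\<close>
    have "dist (f y) (f x) < e" if "dist y x < min d 1" for x y
    proof (cases "x \<in> cball 0 (B+1) \<and> y \<in> cball 0 (B+1)")
      case False
      have "norm x \<ge> B \<and> norm y \<ge> B"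
        using False that norm_triangle_ineq2[of x y] norm_triangle_ineq2[of y x]
        by (auto simp: dist_norm norm_minus_commute)
      then have "x \<notin> K" "y \<notin> K" using B by auto
      then show ?thesis using assms(3) \<open>e > 0\<close> by simp
    qed (use that d in auto)
    then show "\<exists>d>0. \<forall>x\<in>UNIV. \<forall>x'\<in>UNIV. dist x' x < d \<longrightarrow> dist (f x') (f x) < e"
      using d(1) by (intro exI[of _ "min d 1"]) auto
  qed
qed

lemma bounded_compact_support:
  fixes f :: "'a::euclidean_space \<Rightarrow> 'b::real_normed_vector"
  assumes "continuous_on UNIV f" "compact K" "\<And>x. x \<notin> K \<Longrightarrow> f x = 0"
  obtains B where "B > 0" "\<And>x. norm (f x) \<le> B"
proof -
  have "bounded (f ` K)"
    using assms by (intro compact_imp_bounded compact_continuous_image) (auto intro: continuous_on_subset)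
  then obtain B where "\<And>x. x \<in> K \<Longrightarrow> norm (f x) \<le> B" unfolding bounded_iff by auto
  then have "norm (f x) \<le> max B 1" for x using assms(3)[of x] by (cases "x \<in> K") force+
  then show ?thesis using that[of "max B 1"] by auto
qed

lemma integrable_compact_support:
  fixes f :: "'a::euclidean_space \<Rightarrow> 'b::euclidean_space"
  assumes "continuous_on UNIV f" "compact K" "\<And>x. x \<notin> K \<Longrightarrow> f x = 0"
  shows "integrable lborel f"
proof -
  have "integrable lborel (\<lambda>x. indicator K x *\<^sub>R f x)"
    using assms by (intro borel_integrable_compact) (auto intro: continuous_on_subset)
  moreover have "(\<lambda>x. indicator K x *\<^sub>R f x) = f"
    using assms(3) by (auto simp: indicator_def fun_eq_iff)
  ultimately show ?thesis by simp
qed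

lemma grad_outside_support:
  assumes "compact K" "\<And>x. x \<notin> K \<Longrightarrow> f x = 0" "x \<notin> K"
  shows "grad f x = 0" "partial_deriv i f x = 0"
proof -
  have "((\<lambda>x. 0) has_derivative (\<lambda>h. 0)) (at x)" by simp
  then have "(f has_derivative (\<lambda>h. 0)) (at x)"
    by (rule has_derivative_transform_within_open[where s = "- K"])
      (use assms in \<open>auto intro: compact_imp_closed\<close>)
  then show "grad f x = 0" "partial_deriv i f x = 0"
    using grad_eqI[of f 0 x] partial_deriv_eqI[of f _ x i] by auto
qed

lemma lipschitz_compact_support:
  fixes f :: "'a::euclidean_space \<Rightarrow> real"
  assumes "C_differentiable (Suc 0) f" "compact K" "\<And>x. x \<notin> K \<Longrightarrow> f x = 0"
  obtains B where "B > 0" "\<And>x. norm (grad f x) \<le> B" "\<And>x y. \<bar>f x - f y\<bar> \<le> B * norm (x - y)"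
proof -
  obtain B where B: "B > 0" "\<And>x. norm (grad f x) \<le> B"
    using bounded_compact_support[OF continuous_on_grad[OF assms(1)] assms(2)
        grad_outside_support(1)[OF assms(2,3)]] by blast
  have "\<bar>f x - f y\<bar> \<le> B * norm (x - y)" for x y
  proof -
    have "norm (f x - f y) \<le> B * norm (x - y)"
    proof (rule differentiable_bound[of UNIV f "\<lambda>x h. grad f x \<bullet> h"])
      show "onorm ((\<bullet>) (grad f x)) \<le> B" for x
        using order_trans[OF Cauchy_Schwarz_ineq2 mult_right_mono[OF B(2) norm_ge_zero]]
        by (intro onorm_le) simp
      show "(f has_derivative (\<bullet>) (grad f x)) (at x within UNIV)" for x
        using C_differentiable_Suc_derivative[OF assms(1)] has_derivative_at_withinI by blast
    qed auto
    then show ?thesis by simp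
  qed
  then show ?thesis using that B by blast
qed

text \<open>The gradient is uniformly continuous, so one \<open>d\<close> serves all points
  \<open>x\<close>. This uniformity allows the remainder to be estimated under an integral in
  \<open>has_derivative_convolution\<close>.\<close>

lemma uniform_linearization:
  fixes f :: "'a::euclidean_space \<Rightarrow> real"
  assumes "C_differentiable (Suc 0) f" "compact K" "\<And>x. x \<notin> K \<Longrightarrow> f x = 0" "e > 0"
  obtains d where "d > 0" "\<And>x h. norm h < d \<Longrightarrow> \<bar>f (x + h) - f x - grad f x \<bullet> h\<bar> \<le> e * norm h"
proof -
  have "uniformly_continuous_on UNIV (grad f)"
    by (rule uniformly_continuous_compact_support[OF continuous_on_grad[OF assms(1)] assms(2)
        grad_outside_support(1)[OF assms(2,3)]])
  then obtain d where d: "d > 0" "\<And>x y. dist x y < d \<Longrightarrow> dist (grad f x) (grad f y) < e"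
    using uniformly_continuous_onE[OF _ assms(4)] by (metis UNIV_I)
  have "\<bar>f (x + h) - f x - grad f x \<bullet> h\<bar> \<le> e * norm h" if h: "norm h < d" for x h
  proof -
    have "norm (f (x + h) - f x - grad f x \<bullet> ((x + h) - x)) \<le> norm ((x + h) - x) * e"
    proof (rule differentiable_bound_linearization[where S = "ball x d" and f' = "\<lambda>x h. grad f x \<bullet> h"])
      show "x + t *\<^sub>R (x + h - x) \<in> ball x d" if "t \<in> {0..1}" for t
      proof -
        have "\<bar>t\<bar> * norm h \<le> 1 * norm h" using that by (intro mult_right_mono) auto
        then show ?thesis using h by (simp add: dist_norm)
      qed
      show "(f has_derivative (\<bullet>) (grad f y)) (at y within ball x d)" for y
        using C_differentiable_Suc_derivative[OF assms(1)] has_derivative_at_withinI by blast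
      show "onorm ((\<bullet>) (grad f y) - (\<bullet>) (grad f x)) \<le> e" if "y \<in> ball x d" for y
        unfolding fun_diff_def
      proof (rule onorm_le)
        fix i
        have "norm (grad f y \<bullet> i - grad f x \<bullet> i) \<le> norm (grad f y - grad f x) * norm i"
          unfolding inner_diff_left[symmetric] real_norm_def by (rule Cauchy_Schwarz_ineq2)
        also have "\<dots> \<le> e * norm i"
          using d(2)[of y x] that by (intro mult_right_mono) (auto simp: dist_norm norm_minus_commute)
        finally show "norm (grad f y \<bullet> i - grad f x \<bullet> i) \<le> e * norm i" .
      qed
    qed (use d in auto)
    then show ?thesis by (simp add: mult.commute)
  qed
  then show ?thesis using that d by blast
qed

subsection \<open>Convolution and integration by parts\<close>

lemma lborel_distr_reflect:
  fixes x :: "'a::euclidean_space"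
  shows "distr lborel borel (\<lambda>y. x - y) = lborel"
  using lborel_affine[of "-1" x] by (simp add: density_1)

lemma lborel_integral_reflect:
  fixes f :: "'a::euclidean_space \<Rightarrow> 'b::euclidean_space"
  assumes "f \<in> borel_measurable borel"
  shows "(\<integral>y. f (x - y) \<partial>lborel) = (\<integral>y. f y \<partial>lborel)"
  using integral_distr[of "\<lambda>y. x - y" lborel borel f] assms
  by (simp add: lborel_distr_reflect)

lemma lborel_integrable_reflect:
  fixes f :: "'a::euclidean_space \<Rightarrow> 'b::euclidean_space"
  assumes "integrable lborel f"
  shows "integrable lborel (\<lambda>y. f (x - y))"
  using integrable_distr_eq[of "\<lambda>y. x - y" lborel borel f] assms
  by (simp add: lborel_distr_reflect borel_measurable_integrable)

lemma lborel_integral_shift: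
  fixes f :: "'a::euclidean_space \<Rightarrow> 'b::euclidean_space"
  assumes "f \<in> borel_measurable borel"
  shows "(\<integral>y. f (c + y) \<partial>lborel) = (\<integral>y. f y \<partial>lborel)"
  using integral_distr[of "(+) c" lborel borel f] assms
  by (simp add: lborel_distr_plus)

lemma lborel_nn_integral_shift:
  fixes f :: "'a::euclidean_space \<Rightarrow> ennreal"
  assumes "f \<in> borel_measurable borel"
  shows "(\<integral>\<^sup>+y. f (c + y) \<partial>lborel) = (\<integral>\<^sup>+y. f y \<partial>lborel)"
  using nn_integral_distr[of "(+) c" lborel borel f] assms
  by (simp add: lborel_distr_plus)

lemma lborel_integrable_shift:
  fixes f :: "'a::euclidean_space \<Rightarrow> 'b::euclidean_space"
  assumes "integrable lborel f"
  shows "integrable lborel (\<lambda>y. f (c + y))"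
  using integrable_distr_eq[of "(+) c" lborel borel f] assms
  by (simp add: lborel_distr_plus borel_measurable_integrable)

section \<open>Passage between the two measures, and convolution\<close>

lemma measurable_lebesgue_on_borel:
  "f \<in> borel_measurable borel \<Longrightarrow> f \<in> borel_measurable (lebesgue_on \<Omega>)"
  by (intro measurable_restrict_space1 measurable_completion) simp

text \<open>Sobolev integrals live on \<open>lebesgue_on \<Omega>\<close>, whereas translation,
  reflection and Tonelli are applied on \<open>lborel\<close>; this is the passage between the
  two.\<close>

lemma lebesgue_on_eq_lborel:
  fixes f :: "'a::euclidean_space \<Rightarrow> 'b::euclidean_space"
  assumes "open \<Omega>" "f \<in> borel_measurable borel" "\<And>x. x \<notin> \<Omega> \<Longrightarrow> f x = 0"
  shows "(\<integral>x. f x \<partial>lebesgue_on \<Omega>) = (\<integral>x. f x \<partial>lborel)"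
    and "integrable (lebesgue_on \<Omega>) f \<longleftrightarrow> integrable lborel f"
proof -
  have *: "(\<lambda>x. indicator \<Omega> x *\<^sub>R f x) = f"
    using assms(3) by (auto simp: indicator_def fun_eq_iff)
  have "\<Omega> \<inter> space lebesgue \<in> sets lebesgue" using assms(1) by auto
  from integral_restrict_space[OF this, of f] integrable_restrict_space[OF this, of f]
  show "(\<integral>x. f x \<partial>lebesgue_on \<Omega>) = (\<integral>x. f x \<partial>lborel)"
    and "integrable (lebesgue_on \<Omega>) f \<longleftrightarrow> integrable lborel f"
    using assms(2) by (simp_all add: * integral_completion integrable_completion)
qed

lemma integrable_bounded_scaleR:
  fixes k :: "'a \<Rightarrow> 'b::euclidean_space" and f :: "'a \<Rightarrow> real"
  assumes "integrable M f" "k \<in> borel_measurable M" "\<And>x. norm (k x) \<le> B"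
  shows "integrable M (\<lambda>x. f x *\<^sub>R k x)"
proof (rule Bochner_Integration.integrable_bound[of M "\<lambda>x. B * norm (f x)"])
  show "AE x in M. norm (f x *\<^sub>R k x) \<le> norm (B * norm (f x))"
  proof (rule AE_I2)
    fix x
    have "\<bar>f x\<bar> * norm (k x) \<le> \<bar>f x\<bar> * B" using assms(3) by (intro mult_left_mono) auto
    also have "\<dots> \<le> \<bar>f x\<bar> * \<bar>B\<bar>" by (intro mult_left_mono) auto
    finally show "norm (f x *\<^sub>R k x) \<le> norm (B * norm (f x))" by (simp add: abs_mult mult.commute)
  qed
qed (use assms in \<open>auto intro!: borel_measurable_scaleR\<close>)

text \<open>All smoothness comes from the kernel: its first-order remainder, small uniformly in the
  base point, is integrated against \<open>f\<close>.\<close>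

lemma has_derivative_convolution:
  fixes \<rho> f :: "'a::euclidean_space \<Rightarrow> real"
  assumes \<rho>: "C_differentiable (Suc 0) \<rho>" "compact K" "\<And>x. x \<notin> K \<Longrightarrow> \<rho> x = 0"
    and f: "integrable (lebesgue_on \<Omega>) f"
  shows "((\<lambda>x. \<integral>y. \<rho> (x - y) * f y \<partial>lebesgue_on \<Omega>) has_derivative
      (\<lambda>h. (\<integral>y. f y *\<^sub>R grad \<rho> (x - y) \<partial>lebesgue_on \<Omega>) \<bullet> h)) (at x)"
proof -
  let ?M = "lebesgue_on \<Omega>"
  let ?I = "\<integral>y. f y *\<^sub>R grad \<rho> (x - y) \<partial>?M"
  have cont: "continuous_on UNIV \<rho>" "continuous_on UNIV (grad \<rho>)"
    using C_differentiable_imp_continuous[OF \<rho>(1)] continuous_on_grad[OF \<rho>(1)] by auto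
  obtain B where B: "\<And>x. norm (\<rho> x) \<le> B"
    using bounded_compact_support[OF cont(1) \<rho>(2,3)] by blast
  obtain B' where B': "\<And>x. norm (grad \<rho> x) \<le> B'"
    using bounded_compact_support[OF cont(2) \<rho>(2) grad_outside_support(1)[OF \<rho>(2,3)]] by blast
  have meas: "(\<lambda>y. \<rho> (z - y)) \<in> borel_measurable ?M" "(\<lambda>y. grad \<rho> (z - y)) \<in> borel_measurable ?M" for z
    by (intro measurable_lebesgue_on_borel borel_measurable_continuous_onI continuous_intros
        continuous_on_compose2[OF cont(1)] continuous_on_compose2[OF cont(2)]; simp)+
  have int: "integrable ?M (\<lambda>y. f y *\<^sub>R \<rho> (z - y))" "integrable ?M (\<lambda>y. f y *\<^sub>R grad \<rho> (z - y))" for z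
    using f meas B B' by (intro integrable_bounded_scaleR; blast)+
  have "\<exists>d>0. \<forall>z. norm (z - x) < d \<longrightarrow>
      norm ((\<integral>y. \<rho> (z - y) * f y \<partial>?M) - (\<integral>y. \<rho> (x - y) * f y \<partial>?M) - ?I \<bullet> (z - x)) \<le> e * norm (z - x)"
    if "e > 0" for e
  proof -
    let ?A = "(\<integral>y. \<bar>f y\<bar> \<partial>?M)"
    have A: "?A \<ge> 0" by simp
    \<comment> \<open>Integration against \<open>f\<close> multiplies the error by
      \<open>?A\<close>; the summand 1 keeps the quotient meaningful when \<open>?A\<close> is
      0.\<close>
    have "e / (?A + 1) > 0" using that A by (intro divide_pos_pos add_nonneg_pos) auto
    from uniform_linearization[OF \<rho> this] obtain d where d: "d > 0"
      "\<And>x h. norm h < d \<Longrightarrow> \<bar>\<rho> (x + h) - \<rho> x - grad \<rho> x \<bullet> h\<bar> \<le> e / (?A + 1) * norm h" by metis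
    have "norm ((\<integral>y. \<rho> (z - y) * f y \<partial>?M) - (\<integral>y. \<rho> (x - y) * f y \<partial>?M) - ?I \<bullet> (z - x)) \<le> e * norm (z - x)"
      if z: "norm (z - x) < d" for z
    proof -
      let ?g = "\<lambda>y. f y * (\<rho> (z - y) - \<rho> (x - y) - grad \<rho> (x - y) \<bullet> (z - x))"
      have "?I \<bullet> (z - x) = (\<integral>y. (f y *\<^sub>R grad \<rho> (x - y)) \<bullet> (z - x) \<partial>?M)"
        by (rule integral_inner_left[symmetric]) (rule int(2))
      moreover have 1: "integrable ?M (\<lambda>y. \<rho> (z - y) * f y)" "integrable ?M (\<lambda>y. \<rho> (x - y) * f y)"
        using int(1) by (simp_all add: mult.commute)
      moreover have 2: "integrable ?M (\<lambda>y. (f y *\<^sub>R grad \<rho> (x - y)) \<bullet> (z - x))"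
        by (rule integrable_inner_left) (rule int(2))
      moreover have g: "?g = (\<lambda>y. (\<rho> (z - y) * f y - \<rho> (x - y) * f y) - (f y *\<^sub>R grad \<rho> (x - y)) \<bullet> (z - x))"
        by (simp add: fun_eq_iff right_diff_distrib mult.commute)
      ultimately have eq: "(\<integral>y. \<rho> (z - y) * f y \<partial>?M) - (\<integral>y. \<rho> (x - y) * f y \<partial>?M) - ?I \<bullet> (z - x) = (\<integral>y. ?g y \<partial>?M)"
        unfolding g by simp
      have ig: "integrable ?M ?g"
        unfolding g by (rule Bochner_Integration.integrable_diff[OF Bochner_Integration.integrable_diff[OF 1] 2])
      have "norm (\<integral>y. ?g y \<partial>?M) \<le> (\<integral>y. norm (?g y) \<partial>?M)"
        by (rule integral_norm_bound)
      also have "\<dots> \<le> (\<integral>y. \<bar>f y\<bar> * (e / (?A + 1) * norm (z - x)) \<partial>?M)"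
      proof (rule integral_mono)
        show "integrable ?M (\<lambda>y. norm (?g y))"
          by (rule integrable_norm[OF ig])
        show "integrable ?M (\<lambda>y. \<bar>f y\<bar> * (e / (?A + 1) * norm (z - x)))"
          using f by simp
        show "norm (?g y) \<le> \<bar>f y\<bar> * (e / (?A + 1) * norm (z - x))" for y
        proof -
          have "x - y + (z - x) = z - y" by simp
          then show ?thesis
            using d(2)[OF z, of "x - y"] unfolding real_norm_def abs_mult
            by (intro mult_left_mono) simp_all
        qed
      qed
      also have "\<dots> = ?A / (?A + 1) * (e * norm (z - x))"
        by (simp add: field_simps)
      also have "\<dots> \<le> 1 * (e * norm (z - x))"
      proof (rule mult_right_mono)
        have "a / (a + 1) \<le> 1" if "a \<ge> 0" for a :: real using that by simp
        then show "?A / (?A + 1) \<le> 1" using A by blast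
      qed (use \<open>e > 0\<close> in simp)
      finally show ?thesis unfolding eq by simp
    qed
    then show ?thesis using d(1) by blast
  qed
  then show ?thesis
    unfolding has_derivative_at_alt using bounded_linear_inner_right by blast
qed

text \<open>A partial derivative of the convolution is again a convolution, with the partial
  derivative of the kernel; so the kernel varies in the induction.\<close>

lemma C_differentiable_convolution:
  fixes \<rho> f :: "'a::euclidean_space \<Rightarrow> real"
  assumes "\<And>m. C_differentiable m \<rho>" "compact K" "\<And>x. x \<notin> K \<Longrightarrow> \<rho> x = 0"
    and f: "integrable (lebesgue_on \<Omega>) f"
  shows "C_differentiable m (\<lambda>x. \<integral>y. \<rho> (x - y) * f y \<partial>lebesgue_on \<Omega>)"
  using assms(1,3)
proof (induction m arbitrary: \<rho>)
  case 0
  show ?case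
    using has_derivative_convolution[OF 0(1) assms(2) 0(2) f]
    by (simp, intro continuous_at_imp_continuous_on ballI)
      (blast intro: has_derivative_continuous)
next
  case (Suc m)
  have sm: "C_differentiable l (partial_deriv i \<rho>)" if "i \<in> Basis" for l i
    using Suc.prems(1)[of "Suc l"] that by simp
  show ?case
  proof (rule C_differentiable_SucI)
    show "((\<lambda>x. \<integral>y. \<rho> (x - y) * f y \<partial>lebesgue_on \<Omega>) has_derivative
      (\<lambda>h. (\<integral>y. f y *\<^sub>R grad \<rho> (x - y) \<partial>lebesgue_on \<Omega>) \<bullet> h)) (at x)" for x
      by (rule has_derivative_convolution[OF Suc.prems(1) assms(2) Suc.prems(2) f])
    fix i :: 'a assume i: "i \<in> Basis"
    have cont: "continuous_on UNIV (grad \<rho>)"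
      using continuous_on_grad[OF Suc.prems(1)] by auto
    obtain B' where B': "\<And>x. norm (grad \<rho> x) \<le> B'"
      using bounded_compact_support[OF cont assms(2) grad_outside_support(1)[OF assms(2) Suc.prems(2)]] by blast
    have "integrable (lebesgue_on \<Omega>) (\<lambda>y. f y *\<^sub>R grad \<rho> (x - y))" for x
      using B' by (intro integrable_bounded_scaleR[OF f] measurable_lebesgue_on_borel
          borel_measurable_continuous_onI continuous_on_compose2[OF cont] continuous_intros) auto
    then have "(\<integral>y. f y *\<^sub>R grad \<rho> (x - y) \<partial>lebesgue_on \<Omega>) \<bullet> i =
        (\<integral>y. partial_deriv i \<rho> (x - y) * f y \<partial>lebesgue_on \<Omega>)" for x
      using i by (subst integral_inner_left[symmetric]) (auto simp: grad_inner_Basis mult.commute)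
    then show "C_differentiable m (\<lambda>x. (\<integral>y. f y *\<^sub>R grad \<rho> (x - y) \<partial>lebesgue_on \<Omega>) \<bullet> i)"
      using Suc.IH[OF sm[OF i] grad_outside_support(2)[OF assms(2) Suc.prems(2)]] by simp
  qed
qed

text \<open>By translation invariance every difference quotient of \<open>F\<close> has integral 0,
  and dominated convergence carries this over to the derivative.\<close>

lemma integral_grad_eq_0:
  fixes F :: "'a::euclidean_space \<Rightarrow> real"
  assumes F: "C_differentiable (Suc 0) F" "compact K" "\<And>x. x \<notin> K \<Longrightarrow> F x = 0"
  shows "(\<integral>x. grad F x \<bullet> b \<partial>lborel) = 0"
proof -
  obtain B where B: "B > 0" "\<And>x y. \<bar>F x - F y\<bar> \<le> B * norm (x - y)"
    using lipschitz_compact_support[OF F] by metis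
  obtain R where R: "K \<subseteq> ball 0 R" using bounded_subset_ballD compact_imp_bounded F(2) by blast
  define q where "q n x = real (Suc n) * (F (b /\<^sub>R real (Suc n) + x) - F x)" for n x
  have cont: "continuous_on UNIV F" "continuous_on UNIV (grad F)"
    using C_differentiable_imp_continuous[OF F(1)] continuous_on_grad[OF F(1)] by auto
  have meas: "F \<in> borel_measurable borel" using cont(1) by (rule borel_measurable_continuous_onI)
  have intF: "integrable lborel F" by (rule integrable_compact_support[OF cont(1) F(2,3)])
  have q0: "(\<integral>x. q n x \<partial>lborel) = 0" for n
    unfolding q_def using intF lborel_integrable_shift[OF intF] lborel_integral_shift[OF meas] by simp
  \<comment> \<open>The steps are no longer than \<open>norm b\<close>, so all quotients vanish
    outside one ball; inside it the Lipschitz constant bounds them.\<close>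
  have "(\<lambda>n. \<integral>x. q n x \<partial>lborel) \<longlonglongrightarrow> (\<integral>x. grad F x \<bullet> b \<partial>lborel)"
  proof (rule integral_dominated_convergence[where w = "\<lambda>x. B * norm b * indicator (cball 0 (R + norm b)) x"])
    show "integrable lborel (\<lambda>x. B * norm b * indicator (cball 0 (R + norm b)) x :: real)"
      by (intro integrable_mult_right integrable_real_indicator) (use emeasure_bounded_finite[OF bounded_cball] in auto)
    show "AE x in lborel. (\<lambda>n. q n x) \<longlonglongrightarrow> grad F x \<bullet> b"
    proof (rule AE_I2, rule LIMSEQ_I)
      fix x and e :: real assume "e > 0"
      then have "e / (norm b + 1) > 0" by (intro divide_pos_pos add_nonneg_pos) auto
      from uniform_linearization[OF F this] obtain d where d: "d > 0"
        "\<And>x h. norm h < d \<Longrightarrow> \<bar>F (x + h) - F x - grad F x \<bullet> h\<bar> \<le> e / (norm b + 1) * norm h" by metis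
      obtain N where N: "norm b / d < real N" using reals_Archimedean2 by blast
      have "norm (q n x - grad F x \<bullet> b) < e" if "n \<ge> N" for n
      proof -
        let ?n = "real (Suc n)"
        have "norm b / d < ?n" using N that by simp
        then have "norm b < ?n * d" using d(1) by (simp add: field_simps)
        then have "norm (b /\<^sub>R ?n) < d" by (simp add: field_simps)
        from d(2)[OF this, of x] have "\<bar>F (x + b /\<^sub>R ?n) - F x - grad F x \<bullet> (b /\<^sub>R ?n)\<bar> * ?n
            \<le> e / (norm b + 1) * norm (b /\<^sub>R ?n) * ?n" by (intro mult_right_mono) auto
        moreover have "\<bar>F (x + b /\<^sub>R ?n) - F x - grad F x \<bullet> (b /\<^sub>R ?n)\<bar> * ?n
            = \<bar>(F (x + b /\<^sub>R ?n) - F x - grad F x \<bullet> (b /\<^sub>R ?n)) * ?n\<bar>" by (simp add: abs_mult)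
        moreover have "(F (x + b /\<^sub>R ?n) - F x - grad F x \<bullet> (b /\<^sub>R ?n)) * ?n = q n x - grad F x \<bullet> b"
        proof -
          have "grad F x \<bullet> (b /\<^sub>R ?n) * ?n = grad F x \<bullet> b" by (simp add: field_simps)
          moreover have "(A - B - G) * m = m * (A - B) - G * m" for A B G m :: real
            by (simp add: algebra_simps)
          ultimately show ?thesis
            by (simp only: q_def add.commute[of x "b /\<^sub>R ?n"])
        qed
        moreover have "e / (norm b + 1) * norm (b /\<^sub>R ?n) * ?n = e * (norm b / (norm b + 1))"
        proof -
          have "norm (b /\<^sub>R ?n) * ?n = norm b" by (simp add: field_simps)
          then show ?thesis by (simp only: mult.assoc) simp
        qed
        moreover have "e * (norm b / (norm b + 1)) < e * 1"
          using \<open>e > 0\<close> by (intro mult_strict_left_mono) (auto simp: divide_less_eq add_nonneg_pos)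
        ultimately show ?thesis
          unfolding real_norm_def by (metis mult.right_neutral order_le_less_trans)
      qed
      then show "\<exists>N. \<forall>n\<ge>N. norm (q n x - grad F x \<bullet> b) < e" by blast
    qed
    show "AE x in lborel. norm (q n x) \<le> B * norm b * indicator (cball 0 (R + norm b)) x" for n
    proof (rule AE_I2)
      fix x
      let ?n = "real (Suc n)"
      have "\<bar>F (b /\<^sub>R ?n + x) - F x\<bar> \<le> B * norm (b /\<^sub>R ?n)" using B(2)[of "b /\<^sub>R ?n + x" x] by simp
      then have "?n * \<bar>F (b /\<^sub>R ?n + x) - F x\<bar> \<le> ?n * (B * norm (b /\<^sub>R ?n))"
        by (intro mult_left_mono) auto
      moreover have "?n * (B * norm (b /\<^sub>R ?n)) = B * norm b" by (simp add: field_simps)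
      moreover have "norm (q n x) = ?n * \<bar>F (b /\<^sub>R ?n + x) - F x\<bar>" by (simp add: q_def abs_mult)
      ultimately have 1: "norm (q n x) \<le> B * norm b" by metis
      show "norm (q n x) \<le> B * norm b * indicator (cball 0 (R + norm b)) x"
      proof (cases "x \<in> cball 0 (R + norm b)")
        case False
        have "norm (b /\<^sub>R ?n) \<le> norm b" by (simp add: field_simps mult_left_mono)
        moreover have "norm x \<le> norm (b /\<^sub>R ?n + x) + norm (b /\<^sub>R ?n)"
          using norm_triangle_ineq4[of "b /\<^sub>R ?n + x" "b /\<^sub>R ?n"] by simp
        moreover have "norm x > R + norm b" using False by simp
        ultimately have "norm (b /\<^sub>R ?n + x) > R" "norm x > R" using norm_ge_zero[of b] by linarith+
        then have "b /\<^sub>R ?n + x \<notin> K" "x \<notin> K" using R by auto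
        then show ?thesis using F(3) False by (simp add: q_def)
      qed (use 1 in simp)
    qed
    show "q n \<in> borel_measurable lborel" for n
      unfolding q_def by (simp, intro borel_measurable_continuous_onI continuous_intros
          continuous_on_compose2[OF cont(1)]) auto
    show "(\<lambda>x. grad F x \<bullet> b) \<in> borel_measurable lborel"
      by (simp, intro borel_measurable_continuous_onI continuous_intros cont)
  qed
  then show ?thesis using q0 LIMSEQ_unique[of "\<lambda>n. 0" 0] by simp
qed

lemma grad_mult:
  assumes "C_differentiable (Suc 0) f" "C_differentiable (Suc 0) g"
  shows "grad (\<lambda>x. f x * g x) x = f x *\<^sub>R grad g x + g x *\<^sub>R grad f x"
proof (rule grad_eqI)
  show "((\<lambda>x. f x * g x) has_derivative (\<lambda>h. (f x *\<^sub>R grad g x + g x *\<^sub>R grad f x) \<bullet> h)) (at x)"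
    using has_derivative_mult[OF C_differentiable_Suc_derivative[OF assms(1), of x]
        C_differentiable_Suc_derivative[OF assms(2), of x]]
    by (rule has_derivative_eq_rhs) (auto simp: inner_add_left algebra_simps)
qed

lemma grad_add:
  assumes "C_differentiable (Suc 0) f" "C_differentiable (Suc 0) g"
  shows "grad (\<lambda>x. f x + g x) x = grad f x + grad g x"
proof (rule grad_eqI)
  show "((\<lambda>x. f x + g x) has_derivative (\<lambda>h. (grad f x + grad g x) \<bullet> h)) (at x)"
    using has_derivative_add[OF C_differentiable_Suc_derivative[OF assms(1), of x]
        C_differentiable_Suc_derivative[OF assms(2), of x]]
    by (rule has_derivative_eq_rhs) (auto simp: inner_add_left)
qed

lemma grad_const: "grad (\<lambda>x. c) x = 0"
  by (rule grad_eqI) simp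

lemma grad_cmult:
  assumes "C_differentiable (Suc 0) f"
  shows "grad (\<lambda>x. c * f x) x = c *\<^sub>R grad f x"
  using grad_mult[OF C_differentiable_const assms] by (simp add: grad_const)

lemma grad_sum:
  "(\<And>i. i \<in> I \<Longrightarrow> C_differentiable (Suc 0) (f i)) \<Longrightarrow> grad (\<lambda>x. \<Sum>i\<in>I. f i x) x = (\<Sum>i\<in>I. grad (f i) x)"
proof (induction I rule: infinite_finite_induct)
  case (insert a I)
  then show ?case
    using grad_add[of "f a" "\<lambda>x. \<Sum>i\<in>I. f i x"] C_differentiable_sum[of I "Suc 0" f]
    by (simp del: C_differentiable.simps)
qed (simp_all add: grad_const del: C_differentiable.simps)

text \<open>The integral of the gradient of the product \<open>f x * g x\<close> vanishes; the
  product inherits the compact support of \<open>g\<close>.\<close>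

lemma integral_by_parts:
  fixes f g :: "'a::euclidean_space \<Rightarrow> real"
  assumes "C_differentiable (Suc 0) f" "C_differentiable (Suc 0) g" "compact K" "\<And>x. x \<notin> K \<Longrightarrow> g x = 0"
  shows "(\<integral>x. f x * (grad g x \<bullet> b) \<partial>lborel) = - (\<integral>x. (grad f x \<bullet> b) * g x \<partial>lborel)"
proof -
  note c = C_differentiable_imp_continuous[OF assms(1), of UNIV] continuous_on_grad[OF assms(1), of UNIV]
    C_differentiable_imp_continuous[OF assms(2), of UNIV] continuous_on_grad[OF assms(2), of UNIV]
  have i: "integrable lborel (\<lambda>x. f x * (grad g x \<bullet> b))" "integrable lborel (\<lambda>x. (grad f x \<bullet> b) * g x)"
    using assms(4) grad_outside_support(1)[OF assms(3,4)]
    by (intro integrable_compact_support[OF _ assms(3)] continuous_intros c; simp)+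
  have "(\<integral>x. grad (\<lambda>x. f x * g x) x \<bullet> b \<partial>lborel) = 0"
    using assms(4) by (intro integral_grad_eq_0[OF C_differentiable_mult[OF assms(1,2)] assms(3)]) simp
  then have "(\<integral>x. f x * (grad g x \<bullet> b) + (grad f x \<bullet> b) * g x \<partial>lborel) = 0"
    by (simp add: grad_mult[OF assms(1,2)] inner_add_left mult.commute)
  then show ?thesis using i by simp
qed

subsection \<open>Local integrability and the fundamental lemma\<close>

text \<open>A bump divided by its integral, which is positive since the bump is positive on a ball
  of positive measure. The centre \<open>c\<close> is free so that one kernel can both shift and
  smooth.\<close>

lemma mollifier:
  fixes c :: "'a::euclidean_space"
  assumes "s > 0"
  obtains \<rho> where "\<And>m. C_differentiable m \<rho>" "\<And>x. \<rho> x \<ge> 0" "\<And>x. x \<notin> ball c s \<Longrightarrow> \<rho> x = 0"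
    "(\<integral>x. \<rho> x \<partial>lborel) = 1"
proof -
  have int: "integrable lborel (bump c s)"
    by (rule integrable_compact_support[OF C_differentiable_imp_continuous[OF C_differentiable_bump] compact_cball[of c s]])
      (simp add: bump_eq_0_iff[OF assms])
  have "(\<integral>x. bump c s x \<partial>lborel) \<noteq> 0"
  proof
    assume "(\<integral>x. bump c s x \<partial>lborel) = 0"
    then have "AE x in lborel. bump c s x = 0"
      using int by (subst (asm) integral_nonneg_eq_0_iff_AE) (auto simp: bump_nonneg)
    then have "AE x in lebesgue. x \<notin> ball c s"
      using bump_eq_0_iff[OF assms, of c] by (intro AE_completion) simp
    then have "negligible (ball c s)"
      by (simp add: completion.AE_iff_null_sets negligible_iff_null_sets ball_def)
    then show False using open_not_negligible[of "ball c s"] assms by auto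
  qed
  then have "(\<integral>x. bump c s x \<partial>lborel) > 0"
    using Bochner_Integration.integral_nonneg[of lborel "bump c s", OF bump_nonneg] by linarith
  with int show ?thesis
    using assms by (intro that[of "\<lambda>x. inverse (\<integral>x. bump c s x \<partial>lborel) * bump c s x"]
        C_differentiable_mult C_differentiable_const C_differentiable_bump)
      (auto simp: bump_nonneg bump_eq_0_iff)
qed

lemma compact_sets_lebesgue: "compact K \<Longrightarrow> K \<in> sets lebesgue"
  by (simp add: fmeasurableD lmeasurable_compact)

lemma open_sets_lebesgue: "open K \<Longrightarrow> K \<in> sets lebesgue"
  by (simp add: borel_open sets_completionI_sets)

lemma locally_integrable_iff:
  "locally_integrable \<Omega> f \<longleftrightarrow>
    (\<forall>K. compact K \<and> K \<subseteq> \<Omega> \<longrightarrow> integrable lebesgue (\<lambda>x. indicator K x *\<^sub>R f x))"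
  unfolding locally_integrable_def set_integrable_def ..

lemma locally_integrable_lborel:
  fixes f :: "'a::euclidean_space \<Rightarrow> 'b::euclidean_space"
  assumes "integrable lborel f"
  shows "locally_integrable \<Omega> f"
  unfolding locally_integrable_iff
proof (intro allI impI)
  fix K :: "'a set" assume "compact K \<and> K \<subseteq> \<Omega>"
  then show "integrable lebesgue (\<lambda>x. indicator K x *\<^sub>R f x)"
    using assms borel_measurable_integrable[OF assms]
    by (intro integrable_mult_indicator) (auto simp: integrable_completion compact_sets_lebesgue)
qed

lemma locally_integrable_lincomb:
  fixes f g :: "'a::euclidean_space \<Rightarrow> 'b::euclidean_space"
  assumes "locally_integrable \<Omega> f" "locally_integrable \<Omega> g"
  shows "locally_integrable \<Omega> (\<lambda>x. a *\<^sub>R f x + b *\<^sub>R g x)"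
  unfolding locally_integrable_iff
proof (intro allI impI)
  fix K :: "'a set" assume "compact K \<and> K \<subseteq> \<Omega>"
  then have "integrable lebesgue (\<lambda>x. a *\<^sub>R (indicator K x *\<^sub>R f x) + b *\<^sub>R (indicator K x *\<^sub>R g x))"
    using assms unfolding locally_integrable_iff
    by (intro Bochner_Integration.integrable_add integrable_scaleR_right) auto
  moreover have "a *\<^sub>R (indicator K x *\<^sub>R f x) + b *\<^sub>R (indicator K x *\<^sub>R g x)
      = indicator K x *\<^sub>R (a *\<^sub>R f x + b *\<^sub>R g x)" for x
    by (auto simp: indicator_def)
  ultimately show "integrable lebesgue (\<lambda>x. indicator K x *\<^sub>R (a *\<^sub>R f x + b *\<^sub>R g x))" by simp
qed

lemma locally_integrable_inner:
  fixes f :: "'a::euclidean_space \<Rightarrow> 'b::euclidean_space"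
  assumes "locally_integrable \<Omega> f"
  shows "locally_integrable \<Omega> (\<lambda>x. f x \<bullet> i)"
proof -
  have "integrable lebesgue (\<lambda>x. indicator K x *\<^sub>R (f x \<bullet> i))" if "compact K" "K \<subseteq> \<Omega>" for K
    using assms that integrable_inner_left[of i lebesgue "\<lambda>x. indicator K x *\<^sub>R f x"]
    unfolding locally_integrable_iff by simp
  then show ?thesis unfolding locally_integrable_iff by blast
qed

text \<open>Makes the integrals in \<open>has_weak_gradient\<close> genuine: the Bochner integral of
  a function that is not integrable would be 0 by default.\<close>

lemma locally_integrable_mult_test:
  fixes f k :: "'a::euclidean_space \<Rightarrow> real"
  assumes "open \<Omega>" "locally_integrable \<Omega> f" "continuous_on UNIV k" "compact K" "K \<subseteq> \<Omega>" "\<And>x. x \<notin> K \<Longrightarrow> k x = 0"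
  shows "integrable (lebesgue_on \<Omega>) (\<lambda>x. f x * k x)"
proof -
  obtain B where B: "\<And>x. norm (k x) \<le> B" using bounded_compact_support[OF assms(3,4,6)] by blast
  have "integrable lebesgue (\<lambda>x. indicator K x *\<^sub>R f x)"
    using assms unfolding locally_integrable_iff by blast
  moreover have "k \<in> borel_measurable lebesgue"
    using measurable_lebesgue_on_borel[OF borel_measurable_continuous_onI[OF assms(3)], of UNIV] by simp
  ultimately have "integrable lebesgue (\<lambda>x. (indicator K x *\<^sub>R f x) *\<^sub>R k x)"
    using B by (rule integrable_bounded_scaleR)
  moreover have "(indicator K x *\<^sub>R f x) *\<^sub>R k x = indicator \<Omega> x *\<^sub>R (f x * k x)" for x
    using assms(5) assms(6)[of x] by (auto simp: indicator_def)
  ultimately have "integrable lebesgue (\<lambda>x. indicator \<Omega> x *\<^sub>R (f x * k x))" by (simp only:)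
  then show ?thesis
    using assms(1) by (simp add: integrable_restrict_space open_sets_lebesgue)
qed

text \<open>An open set is a countable union of compact subsets, and on each of these measurability
  comes from integrability.\<close>

lemma locally_integrable_measurable:
  fixes f :: "'a::euclidean_space \<Rightarrow> 'b::euclidean_space"
  assumes "open \<Omega>" "locally_integrable \<Omega> f"
  shows "f \<in> borel_measurable (lebesgue_on \<Omega>)"
proof -
  obtain C where C: "\<And>n. compact (C n)" "\<And>n. C n \<subseteq> \<Omega>" "(\<Union>n::nat. C n) = \<Omega>"
    using open_Union_compact_subsets[OF assms(1)] by metis
  show ?thesis
  proof (rule measurable_piecewise_restrict[of "range C"])
    fix K assume "K \<in> range C"
    then obtain n where n: "K = C n" by blast
    then show "K \<inter> space (lebesgue_on \<Omega>) \<in> sets (lebesgue_on \<Omega>)"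
      using C(1)[of n] C(2)[of n] assms(1)
      by (simp add: sets_restrict_space_iff space_restrict_space open_sets_lebesgue compact_sets_lebesgue
          inf.absorb1)
    have "integrable lebesgue (\<lambda>x. indicator K x *\<^sub>R f x)"
      using assms(2) C n unfolding locally_integrable_iff by blast
    then have "f \<in> borel_measurable (lebesgue_on K)"
      using C(1)[of n] n borel_measurable_integrable
      by (subst borel_measurable_restrict_space_iff) (simp_all add: compact_sets_lebesgue)
    moreover have "restrict_space (lebesgue_on \<Omega>) K = lebesgue_on K"
      using C(1)[of n] C(2)[of n] n assms(1)
      by (subst restrict_restrict_space) (simp_all add: inf.absorb2 open_sets_lebesgue compact_sets_lebesgue)
    ultimately show "f \<in> borel_measurable (restrict_space (lebesgue_on \<Omega>) K)" by simp
  qed (use C in \<open>auto simp: space_restrict_space\<close>)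
qed

text \<open>Inner regularity: the set where \<open>f\<close> is positive is exhausted, up to small
  measure, by closed subsets. They lie in \<open>C\<close> and are therefore compact, and a positive
  function with integral 0 over such a set forces it to be null.\<close>

lemma AE_nonpos_if_integral_compact_zero:
  fixes f :: "'a::euclidean_space \<Rightarrow> real"
  assumes f: "integrable lebesgue f" "compact C" "\<And>x. x \<notin> C \<Longrightarrow> f x = 0"
    and zero: "\<And>K. compact K \<Longrightarrow> K \<subseteq> C \<Longrightarrow> (\<integral>x. indicator K x * f x \<partial>lebesgue) = 0"
  shows "AE x in lebesgue. f x \<le> 0"
proof -
  define S where "S = {x. f x > 0}"
  have [measurable]: "f \<in> borel_measurable lebesgue" using f(1) by (rule borel_measurable_integrable)
  have "S = {x \<in> space lebesgue. 0 < f x}" by (simp add: S_def)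
  moreover have "{x \<in> space lebesgue. 0 < f x} \<in> sets lebesgue" by measurable
  ultimately have S: "S \<in> sets lebesgue" by (simp only:)
  have SC: "S \<subseteq> C" using f(3) by (force simp: S_def)
  have "emeasure lebesgue S \<le> ennreal e" if e: "e > 0" for e
  proof -
    obtain T where T: "closed T" "T \<subseteq> S" "emeasure lebesgue (S - T) < ennreal e"
      using sets_lebesgue_inner_closed[OF S e] by metis
    have "T \<subseteq> C" using T(2) SC by blast
    have "compact (C \<inter> T)" by (rule compact_Int_closed[OF f(2) T(1)])
    then have T': "compact T" using \<open>T \<subseteq> C\<close> by (simp add: inf.absorb2)
    then have "(\<integral>x. indicator T x * f x \<partial>lebesgue) = 0" using zero \<open>T \<subseteq> C\<close> by blast
    moreover have "integrable lebesgue (\<lambda>x. indicator T x * f x)"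
      using integrable_mult_indicator[of T lebesgue f, OF compact_sets_lebesgue[OF T'] f(1)] by simp
    moreover have "AE x in lebesgue. indicator T x * f x \<ge> 0"
      using T(2) by (intro AE_I2) (auto simp: S_def indicator_def)
    ultimately have "AE x in lebesgue. indicator T x * f x = 0"
      using integral_nonneg_eq_0_iff_AE by blast
    then have "AE x in lebesgue. x \<notin> T"
    proof eventually_elim
      case (elim x)
      then show ?case using T(2) by (auto simp: S_def indicator_def)
    qed
    then have "T \<in> null_sets lebesgue"
      using compact_sets_lebesgue[OF T'] by (simp add: completion.AE_iff_null_sets)
    then have "emeasure lebesgue T = 0" by (rule null_setsD1)
    moreover have "(S - T) \<union> T = S" using T(2) by blast
    ultimately have "emeasure lebesgue S \<le> emeasure lebesgue (S - T) + 0"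
      using emeasure_subadditive[of "S - T" lebesgue T] S compact_sets_lebesgue[OF T'] by simp
    then show ?thesis using T(3) by simp
  qed
  then have "emeasure lebesgue S = 0"
    by (metis ennreal_le_epsilon add.left_neutral le_zero_eq)
  then have "AE x in lebesgue. x \<notin> S" using S by (intro AE_not_in) (simp add: null_sets_def)
  then show ?thesis by (auto simp: S_def not_less elim: eventually_mono)
qed

text \<open>Mollify the indicators of shrinking neighbourhoods of \<open>K\<close>. With equal radii
  for neighbourhood and mollifier the result is exactly 1 on \<open>K\<close>, and at a point off
  \<open>K\<close> it is eventually 0. The fixed set \<open>L\<close> later provides an integrable
  majorant.\<close>

lemma smooth_approximation_indicator:
  fixes K :: "'a::euclidean_space set"
  assumes "open \<Omega>" "compact K" "K \<subseteq> \<Omega>"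
  obtains L \<phi> where "compact L" "L \<subseteq> \<Omega>" "\<And>n. \<phi> n \<in> test_functions \<Omega>"
    "\<And>n x. \<bar>\<phi> n x\<bar> \<le> 1" "\<And>n x. x \<notin> L \<Longrightarrow> \<phi> n x = 0" "\<And>x. (\<lambda>n::nat. \<phi> n x) \<longlonglongrightarrow> indicator K x"
proof -
  obtain d where d: "d > 0" "(\<Union>x\<in>K. cball x d) \<subseteq> \<Omega>"
    using compact_subset_open_imp_cball_epsilon_subset[OF assms(2,1,3)] by metis
  define E where "E s = (\<Union>x\<in>K. cball x s)" for s
  have E: "compact (E s)" for s
  proof -
    have "E s = (\<Union>x\<in>K. \<Union>y\<in>cball 0 s. {x + y})"
      by (auto simp: E_def dist_norm) (metis add.commute diff_add_cancel mem_cball_0 norm_minus_commute)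
    then show ?thesis using compact_sums'[OF assms(2) compact_cball] by simp
  qed
  \<comment> \<open>The radius counts twice, once for the neighbourhood and once for the mollifier,
    and the sum must not exceed \<open>d\<close>.\<close>
  define s where "s n = d / (2 * real (Suc n))" for n
  have s: "s n > 0" "2 * s n \<le> d" for n using d(1) by (auto simp: s_def field_simps)
  have "\<exists>\<rho>. (\<forall>m. C_differentiable m \<rho>) \<and> (\<forall>x. \<rho> x \<ge> 0) \<and> (\<forall>x. x \<notin> ball 0 (s n) \<longrightarrow> \<rho> x = 0) \<and>
      (\<integral>x. \<rho> x \<partial>lborel) = 1" for n
    using mollifier[OF s(1)[of n], of 0] by metis
  then have "\<exists>\<rho>. \<forall>n. (\<forall>m. C_differentiable m (\<rho> n)) \<and> (\<forall>x. \<rho> n x \<ge> 0) \<and>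
      (\<forall>x. x \<notin> ball 0 (s n) \<longrightarrow> \<rho> n x = 0) \<and> (\<integral>x. \<rho> n x \<partial>lborel) = 1"
    by (intro choice allI)
  then obtain \<rho> :: "nat \<Rightarrow> 'a \<Rightarrow> real" where \<rho>: "\<And>n m. C_differentiable m (\<rho> n)" "\<And>n x. \<rho> n x \<ge> 0"
    "\<And>n x. x \<notin> ball 0 (s n) \<Longrightarrow> \<rho> n x = 0" "\<And>n. (\<integral>x. \<rho> n x \<partial>lborel) = 1"
    by blast
  define \<phi> where "\<phi> n x = (\<integral>y. \<rho> n (x - y) * indicator (E (s n)) y \<partial>lebesgue_on \<Omega>)" for n x
  have sub: "E t \<subseteq> \<Omega>" if "t \<le> d" for t using d(2) that by (force simp: E_def)
  have \<rho>K: "\<rho> n x = 0" if "x \<notin> cball 0 (s n)" for n x using that \<rho>(3)[of x n] by auto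
  have int\<rho>: "integrable lborel (\<rho> n)" for n
    by (rule integrable_compact_support[OF C_differentiable_imp_continuous[OF \<rho>(1)] compact_cball \<rho>K])
  have meas: "(\<lambda>y. \<rho> n (x - y)) \<in> borel_measurable borel" for n x
    by (intro borel_measurable_continuous_onI continuous_on_compose2[OF C_differentiable_imp_continuous[OF \<rho>(1)]] continuous_intros) auto
  have one: "(\<integral>y. \<rho> n (x - y) \<partial>lborel) = 1" for n x
    using lborel_integral_reflect[OF borel_measurable_continuous_onI[OF C_differentiable_imp_continuous[OF \<rho>(1)]]] \<rho>(4) by simp
  have eqb: "\<phi> n x = (\<integral>y. \<rho> n (x - y) * indicator (E (s n)) y \<partial>lborel)" for n x
    unfolding \<phi>_def
  proof (rule lebesgue_on_eq_lborel(1)[OF assms(1)])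
    show "(\<lambda>y. \<rho> n (x - y) * indicator (E (s n)) y) \<in> borel_measurable borel"
      using E[of "s n"] meas by (intro borel_measurable_times borel_measurable_indicator) (auto intro: borel_compact)
    have "E (s n) \<subseteq> \<Omega>" using sub[of "s n"] s[of n] by linarith
    then show "\<rho> n (x - y) * indicator (E (s n)) y = 0" if "y \<notin> \<Omega>" for y
      using that by (auto simp: indicator_def)
  qed
  have nz: "y \<in> E (s n) \<and> dist x y < s n" if "\<rho> n (x - y) * indicator (E (s n)) y \<noteq> 0" for n x y
  proof -
    have "\<rho> n (x - y) \<noteq> 0" "y \<in> E (s n)" using that by (auto simp: indicator_def split: if_splits)
    moreover from this(1) have "x - y \<in> ball 0 (s n)" using \<rho>(3) by blast
    ultimately show ?thesis by (simp add: dist_norm norm_minus_commute)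
  qed
  have far: "\<phi> n x = 0" if "x \<notin> E (2 * s n)" for n x
  proof -
    have "\<rho> n (x - y) * indicator (E (s n)) y = 0" for y
    proof (rule ccontr)
      assume "\<rho> n (x - y) * indicator (E (s n)) y \<noteq> 0"
      from nz[OF this] obtain z where "z \<in> K" "dist z y \<le> s n" "dist x y < s n"
        unfolding E_def by auto
      then have "dist z x \<le> 2 * s n" using dist_triangle[of z x y] by (simp add: dist_commute)
      then show False using that \<open>z \<in> K\<close> by (auto simp: E_def)
    qed
    then show ?thesis by (simp only: \<phi>_def) simp
  qed
  show ?thesis
  proof (rule that[of "E d" \<phi>])
    show "compact (E d)" "E d \<subseteq> \<Omega>" using E sub by auto
    have mono: "E (2 * s n) \<subseteq> E d" for n using s(2)[of n] by (force simp: E_def)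
    show zero: "\<phi> n x = 0" if "x \<notin> E d" for n x using far mono that by blast
    have int1: "integrable (lebesgue_on \<Omega>) (indicat_real (E (s n)))" for n
    proof -
      have "E (s n) \<subseteq> \<Omega>" using sub[of "s n"] s[of n] by linarith
      then have z: "indicat_real (E (s n)) x = 0" if "x \<notin> \<Omega>" for x
        using that by (auto simp: indicator_def)
      have b: "E (s n) \<in> sets borel" using E by (rule borel_compact)
      have "integrable lborel (indicat_real (E (s n)))"
        using b emeasure_compact_finite[OF E, of "s n"] by (intro integrable_real_indicator) simp_all
      then show ?thesis
        by (rule lebesgue_on_eq_lborel(2)[OF assms(1) borel_measurable_indicator[OF b] z, THEN iffD2, rotated])
    qed
    show "\<phi> n \<in> test_functions \<Omega>" for n
    proof (rule test_functionsI[OF _ E[of d] sub[of d] zero])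
      show "C_differentiable m (\<phi> n)" for m
        unfolding \<phi>_def[abs_def] using C_differentiable_convolution[OF \<rho>(1) compact_cball \<rho>K int1] .
    qed auto
    show "\<bar>\<phi> n x\<bar> \<le> 1" for n x
    proof -
      have "\<bar>\<phi> n x\<bar> \<le> (\<integral>y. norm (\<rho> n (x - y) * indicator (E (s n)) y) \<partial>lborel)"
        unfolding eqb using integral_norm_bound[of lborel "\<lambda>y. \<rho> n (x - y) * indicator (E (s n)) y"] by simp
      also have "\<dots> \<le> (\<integral>y. \<rho> n (x - y) \<partial>lborel)"
        by (rule Bochner_Integration.integral_mono'[OF lborel_integrable_reflect[OF int\<rho>]])
          (auto simp: indicator_def \<rho>(2))
      finally show ?thesis using one by simp
    qed
    show "(\<lambda>n. \<phi> n x) \<longlonglongrightarrow> indicator K x" for x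
    proof (cases "x \<in> K")
      case True
      have "\<phi> n x = 1" for n
      proof -
        have "\<rho> n (x - y) * indicator (E (s n)) y = \<rho> n (x - y)" for y
        proof (cases "dist x y < s n")
          case near: True
          have "y \<in> E (s n)" unfolding E_def using True near by (intro UN_I[of x]) auto
          then show ?thesis by simp
        next
          case False
          then have "x - y \<notin> ball 0 (s n)" by (simp add: dist_norm norm_minus_commute)
          then show ?thesis using \<rho>(3) by simp
        qed
        then show ?thesis by (simp only: eqb one)
      qed
      then show ?thesis using True by simp
    next
      case False
      then obtain e where e: "e > 0" "ball x e \<subseteq> - K"
        using assms(2) compact_imp_closed open_contains_ball[of "- K"] by (metis ComplI open_Compl)
      have "s \<longlonglongrightarrow> 0"
        unfolding s_def using tendsto_mult_right_zero[OF LIMSEQ_inverse_real_of_nat, of "d/2"] by (simp add: field_simps)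
      then have "eventually (\<lambda>n. s n < e / 2) sequentially"
        using e(1) by (intro order_tendstoD) auto
      then have "eventually (\<lambda>n. \<phi> n x = 0) sequentially"
      proof eventually_elim
        case (elim n)
        have "x \<notin> E (2 * s n)" using elim e(2) by (force simp: E_def dist_commute)
        then show ?case by (rule far)
      qed
      then show ?thesis using False by (simp add: tendsto_eventually)
    qed
  qed
qed

text \<open>The fundamental lemma of the calculus of variations. Approximating indicators shows that
  \<open>w\<close> has integral 0 over every compact subset of \<Omega>; the sign criterion for
  compact sets, applied to \<open>w\<close> and to its negative, then gives
  \<open>w = 0\<close>.\<close>

lemma AE_zero_if_test_integrals_zero:
  fixes w :: "'a::euclidean_space \<Rightarrow> real"
  assumes \<Omega>: "open \<Omega>" and w: "locally_integrable \<Omega> w"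
    and zero: "\<And>\<phi>. \<phi> \<in> test_functions \<Omega> \<Longrightarrow> (\<integral>x. w x * \<phi> x \<partial>lebesgue_on \<Omega>) = 0"
  shows "AE x in lebesgue_on \<Omega>. w x = 0"
proof -
  have on: "\<Omega> \<inter> space lebesgue \<in> sets lebesgue" using \<Omega> by auto
  have int0: "(\<integral>x. indicator K x * w x \<partial>lebesgue) = 0" if K: "compact K" "K \<subseteq> \<Omega>" for K
  proof -
    obtain L \<phi> where L: "compact L" "L \<subseteq> \<Omega>" and \<phi>: "\<And>n. \<phi> n \<in> test_functions \<Omega>"
      "\<And>n x. \<bar>\<phi> n x\<bar> \<le> 1" "\<And>n x. x \<notin> L \<Longrightarrow> \<phi> n x = 0" "\<And>x. (\<lambda>n::nat. \<phi> n x) \<longlonglongrightarrow> indicator K x"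
      using smooth_approximation_indicator[OF \<Omega> K] by metis
    have iL: "integrable lebesgue (\<lambda>x. indicator L x *\<^sub>R w x)"
      using w L unfolding locally_integrable_iff by blast
    have eq: "indicator \<Omega> x *\<^sub>R (w x * \<phi> n x) = indicator L x * w x * \<phi> n x" for n x
      using L(2) \<phi>(3)[of x n] by (auto simp: indicator_def)
    have lim: "(\<lambda>n. \<integral>x. indicator L x * w x * \<phi> n x \<partial>lebesgue) \<longlonglongrightarrow> (\<integral>x. indicator L x * w x * indicator K x \<partial>lebesgue)"
    proof (rule integral_dominated_convergence[where w = "\<lambda>x. norm (indicator L x * w x)"])
      show "integrable lebesgue (\<lambda>x. norm (indicator L x * w x))" using iL by simp
      show "AE x in lebesgue. (\<lambda>n. indicator L x * w x * \<phi> n x) \<longlonglongrightarrow> indicator L x * w x * indicator K x"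
        using \<phi>(4) by (intro AE_I2 tendsto_mult_left)
      show "AE x in lebesgue. norm (indicator L x * w x * \<phi> n x) \<le> norm (indicator L x * w x)" for n
      proof (rule AE_I2)
        fix x
        have "norm (indicator L x * w x) * norm (\<phi> n x) \<le> norm (indicator L x * w x) * 1"
          using \<phi>(2) by (intro mult_left_mono) simp_all
        then show "norm (indicator L x * w x * \<phi> n x) \<le> norm (indicator L x * w x)"
          by (simp only: norm_mult mult_1_right)
      qed
      have m: "(\<lambda>x. indicator L x * w x) \<in> borel_measurable lebesgue"
        using borel_measurable_integrable[OF iL] by simp
      show "(\<lambda>x. indicator L x * w x * indicator K x) \<in> borel_measurable lebesgue"
        by (rule borel_measurable_times[OF m borel_measurable_indicator[OF compact_sets_lebesgue[OF K(1)]]])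
      have "\<phi> n \<in> borel_measurable lebesgue" for n
        using measurable_lebesgue_on_borel[OF borel_measurable_continuous_onI[OF
              C_differentiable_imp_continuous[OF test_functions_smooth[OF \<phi>(1)]]], where \<Omega> = UNIV] by simp
      then show "(\<lambda>x. indicator L x * w x * \<phi> n x) \<in> borel_measurable lebesgue" for n
        by (rule borel_measurable_times[OF m])
    qed
    have "(\<integral>x. indicator L x * w x * \<phi> n x \<partial>lebesgue) = 0" for n
      using zero[OF \<phi>(1), of n] unfolding integral_restrict_space[OF on] eq .
    then have Z: "(\<integral>x. indicator L x * w x * indicator K x \<partial>lebesgue) = 0"
      using lim LIMSEQ_unique[OF lim, of 0] by simp
    have "K \<subseteq> L"
    proof
      fix x assume "x \<in> K"
      then have "(\<lambda>n. \<phi> n x) \<longlonglongrightarrow> 1" using \<phi>(4)[of x] by simp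
      then show "x \<in> L" using \<phi>(3)[of x] LIMSEQ_unique[of "\<lambda>n. 0::real" 0 1] by (cases "x \<in> L") auto
    qed
    then have "indicator L x * w x * indicator K x = indicator K x * w x" for x
      by (auto simp: indicator_def)
    with Z show ?thesis by simp
  qed
  obtain C where C: "\<And>n. compact (C n)" "\<And>n. C n \<subseteq> \<Omega>" "(\<Union>n::nat. C n) = \<Omega>"
    using open_Union_compact_subsets[OF \<Omega>] by metis
  have "AE x in lebesgue. x \<in> C n \<longrightarrow> w x = 0" for n
  proof -
    let ?f = "\<lambda>x. indicator (C n) x * w x"
    have f: "integrable lebesgue ?f" using w C unfolding locally_integrable_iff by simp
    have z: "(\<integral>x. indicator K x * ?f x \<partial>lebesgue) = 0" if "compact K" "K \<subseteq> C n" for K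
    proof -
      have "indicator K x * ?f x = indicator K x * w x" for x using that(2) by (auto simp: indicator_def)
      then show ?thesis using int0[OF that(1) order_trans[OF that(2) C(2)]] by (simp only:)
    qed
    have "AE x in lebesgue. ?f x \<le> 0"
      by (rule AE_nonpos_if_integral_compact_zero[OF f C(1)[of n]]) (use z in auto)
    moreover have "AE x in lebesgue. - ?f x \<le> 0"
      by (rule AE_nonpos_if_integral_compact_zero[OF _ C(1)[of n]]) (use z f in auto)
    ultimately show ?thesis by eventually_elim (auto simp: indicator_def)
  qed
  then have "AE x in lebesgue. \<forall>n. x \<in> C n \<longrightarrow> w x = 0" unfolding AE_all_countable by blast
  then have "AE x in lebesgue. x \<in> \<Omega> \<longrightarrow> w x = 0"
  proof eventually_elim
    case (elim x)
    then show ?case using C(3) by blast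
  qed
  then show ?thesis using on by (simp add: AE_restrict_space_iff)
qed

subsection \<open>Weak gradients\<close>

text \<open>Each component of the difference integrates to 0 against all test functions.\<close>

lemma has_weak_gradient_unique:
  assumes \<Omega>: "open \<Omega>" and g: "has_weak_gradient \<Omega> u g" and h: "has_weak_gradient \<Omega> u h"
  shows "AE x in lebesgue_on \<Omega>. g x = h x"
proof -
  have lg: "locally_integrable \<Omega> g" "locally_integrable \<Omega> h"
    using g h unfolding has_weak_gradient_def by auto
  have "AE x in lebesgue_on \<Omega>. g x \<bullet> i - h x \<bullet> i = 0" if i: "i \<in> Basis" for i
  proof (rule AE_zero_if_test_integrals_zero[OF \<Omega>])
    show "locally_integrable \<Omega> (\<lambda>x. g x \<bullet> i - h x \<bullet> i)"
      using locally_integrable_lincomb[OF lg[THEN locally_integrable_inner[where i=i]], of 1 "- 1"]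
      by simp
    fix \<phi> assume \<phi>: "\<phi> \<in> test_functions \<Omega>"
    obtain K where K: "compact K" "K \<subseteq> \<Omega>" "\<And>x. x \<notin> K \<Longrightarrow> \<phi> x = 0" using test_functionsE[OF \<phi>] by metis
    have int: "integrable (lebesgue_on \<Omega>) (\<lambda>x. (f x \<bullet> i) * \<phi> x)" if "locally_integrable \<Omega> f" for f
      using locally_integrable_mult_test[OF \<Omega> locally_integrable_inner[OF that]
          C_differentiable_imp_continuous[OF test_functions_smooth[OF \<phi>]] K] .
    have "(\<integral>x. (g x \<bullet> i) * \<phi> x \<partial>lebesgue_on \<Omega>) = (\<integral>x. (h x \<bullet> i) * \<phi> x \<partial>lebesgue_on \<Omega>)"
    proof -
      have "- (\<integral>x. (g x \<bullet> i) * \<phi> x \<partial>lebesgue_on \<Omega>) = - (\<integral>x. (h x \<bullet> i) * \<phi> x \<partial>lebesgue_on \<Omega>)"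
        using g h \<phi> i unfolding has_weak_gradient_def by metis
      then show ?thesis by linarith
    qed
    then show "(\<integral>x. (g x \<bullet> i - h x \<bullet> i) * \<phi> x \<partial>lebesgue_on \<Omega>) = 0"
      using int[OF lg(1)] int[OF lg(2)] by (simp add: left_diff_distrib)
  qed
  then have "AE x in lebesgue_on \<Omega>. \<forall>i\<in>Basis. g x \<bullet> i - h x \<bullet> i = 0"
    by (intro AE_finite_allI) auto
  then show ?thesis
  proof eventually_elim
    case (elim x)
    then show ?case by (intro euclidean_eqI[of "g x" "h x"]) simp
  qed
qed

lemma has_weak_gradient_lincomb:
  assumes \<Omega>: "open \<Omega>" and u: "has_weak_gradient \<Omega> u g" and v: "has_weak_gradient \<Omega> v h"
  shows "has_weak_gradient \<Omega> (\<lambda>x. a * u x + b * v x) (\<lambda>x. a *\<^sub>R g x + b *\<^sub>R h x)"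
proof -
  have l: "locally_integrable \<Omega> u" "locally_integrable \<Omega> v" "locally_integrable \<Omega> g" "locally_integrable \<Omega> h"
    using u v unfolding has_weak_gradient_def by auto
  show ?thesis
    unfolding has_weak_gradient_def
  proof (intro conjI ballI)
    show "locally_integrable \<Omega> (\<lambda>x. a * u x + b * v x)"
      using locally_integrable_lincomb[OF l(1,2), of a b] by simp
    show "locally_integrable \<Omega> (\<lambda>x. a *\<^sub>R g x + b *\<^sub>R h x)"
      using locally_integrable_lincomb[OF l(3,4), of a b] .
    fix \<phi> and i :: 'a assume \<phi>: "\<phi> \<in> test_functions \<Omega>" and i: "i \<in> Basis"
    obtain K where K: "compact K" "K \<subseteq> \<Omega>" "\<And>x. x \<notin> K \<Longrightarrow> \<phi> x = 0" using test_functionsE[OF \<phi>] by metis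
    have pd: "continuous_on UNIV (partial_deriv i \<phi>)"
      using test_functions_smooth[OF \<phi>, of "Suc 0"] i by simp
    have int1: "integrable (lebesgue_on \<Omega>) (\<lambda>x. f x * partial_deriv i \<phi> x)" if "locally_integrable \<Omega> f" for f
      using locally_integrable_mult_test[OF \<Omega> that pd K(1,2) grad_outside_support(2)[OF K(1,3)]] .
    have int2: "integrable (lebesgue_on \<Omega>) (\<lambda>x. (f x \<bullet> i) * \<phi> x)" if "locally_integrable \<Omega> f" for f
      using locally_integrable_mult_test[OF \<Omega> locally_integrable_inner[OF that]
          C_differentiable_imp_continuous[OF test_functions_smooth[OF \<phi>]] K] .
    have "(\<integral>x. (a * u x + b * v x) * partial_deriv i \<phi> x \<partial>lebesgue_on \<Omega>) =
        a * (\<integral>x. u x * partial_deriv i \<phi> x \<partial>lebesgue_on \<Omega>) + b * (\<integral>x. v x * partial_deriv i \<phi> x \<partial>lebesgue_on \<Omega>)"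
      using int1[OF l(1)] int1[OF l(2)] by (simp add: distrib_right mult.assoc)
    also have "(\<integral>x. u x * partial_deriv i \<phi> x \<partial>lebesgue_on \<Omega>) = - (\<integral>x. (g x \<bullet> i) * \<phi> x \<partial>lebesgue_on \<Omega>)"
      using u \<phi> i unfolding has_weak_gradient_def by blast
    also have "(\<integral>x. v x * partial_deriv i \<phi> x \<partial>lebesgue_on \<Omega>) = - (\<integral>x. (h x \<bullet> i) * \<phi> x \<partial>lebesgue_on \<Omega>)"
      using v \<phi> i unfolding has_weak_gradient_def by blast
    also have "a * - (\<integral>x. (g x \<bullet> i) * \<phi> x \<partial>lebesgue_on \<Omega>) + b * - (\<integral>x. (h x \<bullet> i) * \<phi> x \<partial>lebesgue_on \<Omega>)
        = - (\<integral>x. ((a *\<^sub>R g x + b *\<^sub>R h x) \<bullet> i) * \<phi> x \<partial>lebesgue_on \<Omega>)"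
      using int2[OF l(3)] int2[OF l(4)] by (simp add: inner_add_left distrib_right mult.assoc)
    finally show "(\<integral>x. (a * u x + b * v x) * partial_deriv i \<phi> x \<partial>lebesgue_on \<Omega>)
        = - (\<integral>x. ((a *\<^sub>R g x + b *\<^sub>R h x) \<bullet> i) * \<phi> x \<partial>lebesgue_on \<Omega>)" .
  qed
qed

lemma continuous_on_test:
  assumes "\<phi> \<in> test_functions \<Omega>"
  shows "continuous_on UNIV \<phi>" "continuous_on UNIV (grad \<phi>)"
  using C_differentiable_imp_continuous[OF test_functions_smooth[OF assms]]
    continuous_on_grad[OF test_functions_smooth[OF assms]] by auto

lemma integrable_test:
  assumes "\<phi> \<in> test_functions \<Omega>"
  shows "integrable lborel \<phi>" "integrable lborel (grad \<phi>)"
proof -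
  obtain K where K: "compact K" "K \<subseteq> \<Omega>" "\<And>x. x \<notin> K \<Longrightarrow> \<phi> x = 0" using test_functionsE[OF assms] by metis
  show "integrable lborel \<phi>"
    using K by (intro integrable_compact_support[OF continuous_on_test(1)[OF assms] K(1)])
  show "integrable lborel (grad \<phi>)"
  proof (rule integrable_compact_support[OF continuous_on_test(2)[OF assms] K(1)])
    show "grad \<phi> x = 0" if "x \<notin> K" for x
      by (rule grad_outside_support(1)[OF K(1) _ that]) (rule K(3))
  qed
qed

lemma test_zero_outside:
  assumes "\<phi> \<in> test_functions \<Omega>" "x \<notin> \<Omega>"
  shows "\<phi> x = 0" "grad \<phi> x = 0"
proof -
  obtain K where K: "compact K" "K \<subseteq> \<Omega>" "\<And>x. x \<notin> K \<Longrightarrow> \<phi> x = 0" using test_functionsE[OF assms(1)] by metis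
  show "\<phi> x = 0" "grad \<phi> x = 0"
  proof -
    have x: "x \<notin> K" using K(2) assms(2) by blast
    then show "\<phi> x = 0" by (rule K(3))
    show "grad \<phi> x = 0" by (rule grad_outside_support(1)[OF K(1) _ x]) (rule K(3))
  qed
qed

lemma test_has_weak_gradient:
  assumes \<Omega>: "open \<Omega>" and \<psi>: "\<psi> \<in> test_functions \<Omega>"
  shows "has_weak_gradient \<Omega> \<psi> (grad \<psi>)"
  unfolding has_weak_gradient_def
proof (intro conjI ballI)
  show "locally_integrable \<Omega> \<psi>" "locally_integrable \<Omega> (grad \<psi>)"
    using integrable_test[OF \<psi>] by (intro locally_integrable_lborel; simp)+
  fix \<phi> and i :: 'a assume \<phi>: "\<phi> \<in> test_functions \<Omega>" and i: "i \<in> Basis"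
  obtain K where K: "compact K" "K \<subseteq> \<Omega>" "\<And>x. x \<notin> K \<Longrightarrow> \<phi> x = 0" using test_functionsE[OF \<phi>] by metis
  have eq: "\<psi> x * partial_deriv i \<phi> x = \<psi> x * (grad \<phi> x \<bullet> i)" for x
    using i by (simp add: grad_inner_Basis)
  have m: "(\<lambda>x. \<psi> x * (grad \<phi> x \<bullet> i)) \<in> borel_measurable borel" "(\<lambda>x. (grad \<psi> x \<bullet> i) * \<phi> x) \<in> borel_measurable borel"
    by (intro borel_measurable_continuous_onI continuous_intros continuous_on_test[OF \<phi>] continuous_on_test[OF \<psi>])+
  have "(\<integral>x. \<psi> x * (grad \<phi> x \<bullet> i) \<partial>lebesgue_on \<Omega>) = (\<integral>x. \<psi> x * (grad \<phi> x \<bullet> i) \<partial>lborel)"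
    by (rule lebesgue_on_eq_lborel(1)[OF \<Omega> m(1)]) (simp add: test_zero_outside[OF \<psi>])
  moreover have "(\<integral>x. (grad \<psi> x \<bullet> i) * \<phi> x \<partial>lebesgue_on \<Omega>) = (\<integral>x. (grad \<psi> x \<bullet> i) * \<phi> x \<partial>lborel)"
    by (rule lebesgue_on_eq_lborel(1)[OF \<Omega> m(2)]) (simp add: test_zero_outside[OF \<psi>])
  ultimately show "(\<integral>x. \<psi> x * partial_deriv i \<phi> x \<partial>lebesgue_on \<Omega>) = - (\<integral>x. (grad \<psi> x \<bullet> i) * \<phi> x \<partial>lebesgue_on \<Omega>)"
    unfolding eq
    using integral_by_parts[OF test_functions_smooth[OF \<psi>] test_functions_smooth[OF \<phi>] K(1,3), of i] by simp
qed

subsection \<open>Powers of real numbers\<close>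

text \<open>The graph of a convex power lies above its tangents. For \<open>p > 1\<close> and
  positive \<open>t\<close> this is Young's inequality with exponents \<open>p\<close> and
  \<open>p / (p - 1)\<close>. Convexity and Jensen's inequality are both derived from it.\<close>

lemma powr_tangent:
  fixes s t p :: real
  assumes "s > 0" "t \<ge> 0" "p \<ge> 1"
  shows "t powr p \<ge> s powr p + p * s powr (p - 1) * (t - s)"
proof (cases "t = 0")
  case True
  have "s powr (p - 1) * s = s powr p" using assms(1) by (simp add: powr_diff)
  then have "s powr p + p * s powr (p - 1) * (t - s) = s powr p * (1 - p)"
    using True by (simp add: algebra_simps)
  also have "\<dots> \<le> 0" using assms(3) by (intro mult_nonneg_nonpos) auto
  finally show ?thesis using powr_ge_zero[of t p] by linarith
next
  case False
  show ?thesis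
  proof (cases "p = 1")
    case False
    then have p: "p > 1" using assms(3) by simp
    have "t * s powr (p - 1) \<le> t powr p / p + (s powr (p - 1)) powr (p / (p - 1)) / (p / (p - 1))"
      using p assms by (intro Youngs_inequality) (auto simp: field_simps)
    also have "(s powr (p - 1)) powr (p / (p - 1)) = s powr p"
      using p by (simp add: powr_powr)
    finally have "p * (t * s powr (p - 1)) \<le> t powr p + (p - 1) * s powr p"
      using p by (simp add: field_simps)
    moreover have "s powr (p - 1) * s = s powr p" using assms(1) by (simp add: powr_diff)
    then have "p * s powr (p - 1) * (t - s) = p * (t * s powr (p - 1)) - p * s powr p"
      by (simp add: algebra_simps)
    ultimately show ?thesis by (simp only: left_diff_distrib mult_1_left)
  qed (use assms in auto)
qed

text \<open>Average the tangent inequalities taken at the mean \<open>s\<close>; the linear terms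
  cancel.\<close>

lemma powr_convex_comb:
  fixes a b l p :: real
  assumes "a \<ge> 0" "b \<ge> 0" "0 < l" "l < 1" "p \<ge> 1"
  shows "(l * a + (1 - l) * b) powr p \<le> l * a powr p + (1 - l) * b powr p"
proof -
  define s where "s = l * a + (1 - l) * b"
  show ?thesis
  proof (cases "s = 0")
    case False
    have "s \<ge> 0" unfolding s_def using assms by (intro add_nonneg_nonneg mult_nonneg_nonneg) auto
    then have s: "s > 0" using False by simp
    have "l * (s powr p + p * s powr (p - 1) * (a - s)) + (1 - l) * (s powr p + p * s powr (p - 1) * (b - s))
        \<le> l * a powr p + (1 - l) * b powr p"
      using assms powr_tangent[OF s] by (intro add_mono mult_left_mono) auto
    moreover have "l * (A + B * (a - s)) + (1 - l) * (A + B * (b - s)) = A + B * (l * a + (1 - l) * b - s)" for A B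
      by (simp add: algebra_simps)
    ultimately show ?thesis by (simp add: s_def)
  next
    case True
    have "l * a powr p + (1 - l) * b powr p \<ge> 0" using assms by (intro add_nonneg_nonneg mult_nonneg_nonneg) auto
    then show ?thesis using True unfolding s_def by simp
  qed
qed

text \<open>
  The constants are uniform in \<open>p \<in> {1..b}\<close>, and the first one is close to \<open>1\<close> for small \<open>d\<close>.
\<close>

lemma powr_add_le:
  fixes x y d p b :: real
  assumes "x \<ge> 0" "y \<ge> 0" "d > 0" "1 \<le> p" "p \<le> b"
  shows "(x + y) powr p \<le> (1 + d) powr b * x powr p + ((1 + d) / d) powr b * y powr p"
proof -
  let ?l = "1 / (1 + d)"
  have l: "0 < ?l" "?l < 1" "1 - ?l = d / (1 + d)" using assms(3) by (auto simp: field_simps)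
  have "?l * ((1 + d) * x) = x" "(1 - ?l) * ((1 + d) / d * y) = y"
    using assms(3) unfolding l(3) by simp_all
  then have "(x + y) powr p \<le> ?l * ((1 + d) * x) powr p + (1 - ?l) * ((1 + d) / d * y) powr p"
    using powr_convex_comb[OF _ _ l(1,2) assms(4), of "(1 + d) * x" "(1 + d) / d * y"] assms by simp
  also have "\<dots> \<le> 1 * ((1 + d) * x) powr p + 1 * ((1 + d) / d * y) powr p"
    using l by (intro add_mono mult_right_mono) auto
  also have "\<dots> = (1 + d) powr p * x powr p + ((1 + d) / d) powr p * y powr p"
  proof -
    have "((1 + d) * x) powr p = (1 + d) powr p * x powr p"
      "((1 + d) / d * y) powr p = ((1 + d) / d) powr p * y powr p"
      by (rule powr_mult; use assms in simp)+
    then show ?thesis by (simp only: mult_1_left)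
  qed
  also have "\<dots> \<le> (1 + d) powr b * x powr p + ((1 + d) / d) powr b * y powr p"
    using assms by (intro add_mono mult_right_mono powr_mono) (auto simp: field_simps)
  finally show ?thesis .
qed

text \<open>If \<open>t\<close> exceeds \<open>d\<close>, then \<open>t / d\<close> is at least 1
  and so is its power \<open>p - 1\<close>. On a set of finite measure this controls the integral of
  a function by that of its p-th power, with a constant term as small as desired.\<close>

lemma le_const_add_powr:
  fixes t d p :: real
  assumes "t \<ge> 0" "d > 0" "p \<ge> 1"
  shows "t \<le> d + d powr (1 - p) * t powr p"
proof (cases "t \<le> d")
  case False
  have "1 powr (p - 1) \<le> (t / d) powr (p - 1)"
    using False assms by (intro powr_mono2) (auto simp: field_simps)
  then have "t * 1 \<le> t * (t / d) powr (p - 1)" using assms by (intro mult_left_mono) auto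
  also have "\<dots> = d powr (1 - p) * t powr p"
    using False assms by (simp add: powr_divide powr_diff field_simps)
  finally show ?thesis using assms by simp
next
  case True
  have "d powr (1 - p) * t powr p \<ge> 0" by simp
  then show ?thesis using True by linarith
qed

subsection \<open>Powers integrated over a domain\<close>

text \<open>The p-th power of the L^p norm. Without the root, estimates can be added and their
  constants remain uniform in \<open>p\<close>.\<close>

definition pint :: "real \<Rightarrow> 'a::euclidean_space set \<Rightarrow> ('a \<Rightarrow> 'b::euclidean_space) \<Rightarrow> real" where
  "pint p \<Omega> f = (\<integral>x. norm (f x) powr p \<partial>lebesgue_on \<Omega>)"

text \<open>The p-th power of the Sobolev norm \<open>W1p_norm\<close>. It is not a norm, so
  continuity statements rest on \<open>quasi_continuity\<close> below.\<close>

definition sob :: "real \<Rightarrow> 'a::euclidean_space set \<Rightarrow> ('a \<Rightarrow> real) \<Rightarrow> real" where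
  "sob p \<Omega> u = pint p \<Omega> u + energy p \<Omega> u"

lemma pint_nonneg: "pint p \<Omega> f \<ge> 0"
  unfolding pint_def by (intro Bochner_Integration.integral_nonneg) simp

lemma energy_eq_pint: "energy p \<Omega> u = pint p \<Omega> (weak_gradient \<Omega> u)"
  by (simp add: energy_def pint_def)

lemma energy_nonneg: "energy p \<Omega> u \<ge> 0"
  by (simp add: energy_eq_pint pint_nonneg)

lemma sob_nonneg: "sob p \<Omega> u \<ge> 0"
  unfolding sob_def using pint_nonneg[of p \<Omega> u] energy_nonneg[of p \<Omega> u] by linarith

lemma pint_le_sob: "pint p \<Omega> u \<le> sob p \<Omega> u" and energy_le_sob: "energy p \<Omega> u \<le> sob p \<Omega> u"
  unfolding sob_def using pint_nonneg[of p \<Omega> u] energy_nonneg[of p \<Omega> u] by linarith+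

lemma W1p_norm_less_iff:
  assumes "p \<ge> 1" "\<epsilon> > 0"
  shows "W1p_norm p \<Omega> u < \<epsilon> \<longleftrightarrow> sob p \<Omega> u < \<epsilon> powr p"
proof -
  have W: "W1p_norm p \<Omega> u = sob p \<Omega> u powr (1 / p)"
    by (simp add: W1p_norm_def sob_def pint_def)
  have e: "\<epsilon> = (\<epsilon> powr p) powr (1 / p)" using assms by (simp add: powr_powr)
  have "sob p \<Omega> u powr (1 / p) < (\<epsilon> powr p) powr (1 / p) \<longleftrightarrow> sob p \<Omega> u < \<epsilon> powr p"
  proof
    assume *: "sob p \<Omega> u powr (1 / p) < (\<epsilon> powr p) powr (1 / p)"
    show "sob p \<Omega> u < \<epsilon> powr p"
    proof (rule ccontr)
      assume "\<not> sob p \<Omega> u < \<epsilon> powr p"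
      then have "(\<epsilon> powr p) powr (1 / p) \<le> sob p \<Omega> u powr (1 / p)"
        using assms by (intro powr_mono2) auto
      then show False using * by linarith
    qed
  next
    assume "sob p \<Omega> u < \<epsilon> powr p"
    then show "sob p \<Omega> u powr (1 / p) < (\<epsilon> powr p) powr (1 / p)"
      using assms sob_nonneg by (intro powr_less_mono2) auto
  qed
  then show ?thesis using W e by simp
qed

lemma Lp_spaceD:
  assumes "f \<in> Lp_space p \<Omega>"
  shows "f \<in> borel_measurable (lebesgue_on \<Omega>)" "integrable (lebesgue_on \<Omega>) (\<lambda>x. norm (f x) powr p)"
  using assms unfolding Lp_space_def by auto

text \<open>Substitute for the triangle inequality on p-th powers: small \<open>d\<close> brings the
  first coefficient near 1 at the expense of the second. The value types may differ, so that scalar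
  averages can dominate gradients.\<close>

lemma Lp_space_dominated:
  fixes f :: "'a::euclidean_space \<Rightarrow> 'b::euclidean_space" and g :: "'a \<Rightarrow> 'c::euclidean_space"
    and z :: "'a \<Rightarrow> 'd::euclidean_space"
  assumes f: "f \<in> Lp_space p \<Omega>" and g: "g \<in> Lp_space p \<Omega>" and z: "z \<in> borel_measurable (lebesgue_on \<Omega>)"
    and le: "AE x in lebesgue_on \<Omega>. norm (z x) \<le> norm (f x) + norm (g x)"
    and "1 \<le> p" "p \<le> b" "d > 0"
  shows "z \<in> Lp_space p \<Omega>"
    and "pint p \<Omega> z \<le> (1 + d) powr b * pint p \<Omega> f + ((1 + d) / d) powr b * pint p \<Omega> g"
proof -
  let ?h = "\<lambda>x. (1 + d) powr b * norm (f x) powr p + ((1 + d) / d) powr b * norm (g x) powr p"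
  have h: "integrable (lebesgue_on \<Omega>) ?h"
    by (intro Bochner_Integration.integrable_add integrable_mult_right Lp_spaceD(2)[OF f] Lp_spaceD(2)[OF g])
  have zp: "(\<lambda>x. norm (z x) powr p) \<in> borel_measurable (lebesgue_on \<Omega>)"
    using z by measurable
  have AE: "AE x in lebesgue_on \<Omega>. norm (z x) powr p \<le> ?h x"
    using le
  proof eventually_elim
    case (elim x)
    have "norm (z x) powr p \<le> (norm (f x) + norm (g x)) powr p"
      using elim assms by (intro powr_mono2) auto
    also have "\<dots> \<le> ?h x"
      using powr_add_le[OF norm_ge_zero norm_ge_zero assms(7,5,6)] .
    finally show ?case .
  qed
  have "integrable (lebesgue_on \<Omega>) (\<lambda>x. norm (z x) powr p)"
    by (rule Bochner_Integration.integrable_bound[OF h zp]) (use AE in eventually_elim, auto)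
  then show "z \<in> Lp_space p \<Omega>" using z unfolding Lp_space_def by simp
  have "pint p \<Omega> z \<le> (\<integral>x. ?h x \<partial>lebesgue_on \<Omega>)"
    unfolding pint_def by (rule integral_mono_AE[OF \<open>integrable (lebesgue_on \<Omega>) (\<lambda>x. norm (z x) powr p)\<close> h AE])
  also have "\<dots> = (1 + d) powr b * pint p \<Omega> f + ((1 + d) / d) powr b * pint p \<Omega> g"
    unfolding pint_def using Lp_spaceD(2)[OF f] Lp_spaceD(2)[OF g] by simp
  finally show "pint p \<Omega> z \<le> (1 + d) powr b * pint p \<Omega> f + ((1 + d) / d) powr b * pint p \<Omega> g" .
qed

lemma pint_cong_AE:
  assumes "f \<in> borel_measurable (lebesgue_on \<Omega>)" "g \<in> borel_measurable (lebesgue_on \<Omega>)"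
    "AE x in lebesgue_on \<Omega>. f x = g x"
  shows "pint p \<Omega> f = pint p \<Omega> g"
  unfolding pint_def
proof (rule integral_cong_AE)
  show "AE x in lebesgue_on \<Omega>. norm (f x) powr p = norm (g x) powr p"
    using assms(3) by eventually_elim simp
  show "(\<lambda>x. norm (f x) powr p) \<in> borel_measurable (lebesgue_on \<Omega>)"
    "(\<lambda>x. norm (g x) powr p) \<in> borel_measurable (lebesgue_on \<Omega>)"
    using assms(1,2) by measurable
qed

lemma pint_scaleR: "p \<ge> 1 \<Longrightarrow> pint p \<Omega> (\<lambda>x. c *\<^sub>R f x) = \<bar>c\<bar> powr p * pint p \<Omega> f"
  unfolding pint_def by (simp add: powr_mult)

lemma pint_cmult:
  fixes f :: "'a::euclidean_space \<Rightarrow> real"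
  shows "p \<ge> 1 \<Longrightarrow> pint p \<Omega> (\<lambda>x. c * f x) = \<bar>c\<bar> powr p * pint p \<Omega> f"
  using pint_scaleR[of p \<Omega> c f] by simp

lemma Lp_space_scaleR:
  assumes "f \<in> Lp_space p \<Omega>"
  shows "(\<lambda>x. c *\<^sub>R f x) \<in> Lp_space p \<Omega>"
  using Lp_spaceD[OF assms] unfolding Lp_space_def
  by (auto simp: powr_mult intro!: borel_measurable_scaleR)

lemma Lp_space_integrable:
  fixes f :: "'a::euclidean_space \<Rightarrow> 'b::euclidean_space"
  assumes "f \<in> Lp_space p \<Omega>" "open \<Omega>" "bounded \<Omega>" "p \<ge> 1" "d > 0"
  shows "integrable (lebesgue_on \<Omega>) f"
    and "(\<integral>x. norm (f x) \<partial>lebesgue_on \<Omega>) \<le> d * measure lebesgue \<Omega> + d powr (1 - p) * pint p \<Omega> f"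
proof -
  have \<Omega>: "\<Omega> \<in> lmeasurable" using assms(2,3) by (simp add: lmeasurable_open)
  let ?h = "\<lambda>x. d + d powr (1 - p) * norm (f x) powr p"
  have c: "integrable (lebesgue_on \<Omega>) (\<lambda>x. d)" by (rule finite_measure.integrable_const[OF finite_measure_lebesgue_on[OF \<Omega>]])
  have h: "integrable (lebesgue_on \<Omega>) ?h"
    using c Lp_spaceD(2)[OF assms(1)] by simp
  have le: "norm (f x) \<le> ?h x" for x using le_const_add_powr[OF norm_ge_zero assms(5,4)] .
  show i: "integrable (lebesgue_on \<Omega>) f"
  proof (rule Bochner_Integration.integrable_bound[OF h Lp_spaceD(1)[OF assms(1)]], rule AE_I2)
    fix x
    show "norm (f x) \<le> norm (?h x)" using le[of x] unfolding real_norm_def by linarith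
  qed
  have "(\<integral>x. norm (f x) \<partial>lebesgue_on \<Omega>) \<le> (\<integral>x. ?h x \<partial>lebesgue_on \<Omega>)"
    by (rule integral_mono[OF integrable_norm[OF i] h le])
  also have "\<dots> = d * measure lebesgue \<Omega> + d powr (1 - p) * pint p \<Omega> f"
    using c Lp_spaceD(2)[OF assms(1)] \<Omega>
    by (simp add: pint_def measure_restrict_space fmeasurableD)
  finally show "(\<integral>x. norm (f x) \<partial>lebesgue_on \<Omega>) \<le> d * measure lebesgue \<Omega> + d powr (1 - p) * pint p \<Omega> f" .
qed

lemma Lp_space_bounded:
  fixes f :: "'a::euclidean_space \<Rightarrow> 'b::euclidean_space"
  assumes "open \<Omega>" "bounded \<Omega>" "p \<ge> 1" "f \<in> borel_measurable (lebesgue_on \<Omega>)" "\<And>x. norm (f x) \<le> M"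
  shows "f \<in> Lp_space p \<Omega>" "pint p \<Omega> f \<le> M powr p * measure lebesgue \<Omega>"
proof -
  have \<Omega>: "\<Omega> \<in> lmeasurable" using assms(1,2) by (simp add: lmeasurable_open)
  have c: "integrable (lebesgue_on \<Omega>) (\<lambda>x. M powr p)" by (rule finite_measure.integrable_const[OF finite_measure_lebesgue_on[OF \<Omega>]])
  have M: "M \<ge> 0" using assms(5) norm_ge_zero order_trans by blast
  have le: "norm (f x) powr p \<le> M powr p" for x using assms(3,5) by (intro powr_mono2) auto
  have m: "(\<lambda>x. norm (f x) powr p) \<in> borel_measurable (lebesgue_on \<Omega>)" using assms(4) by measurable
  have i: "integrable (lebesgue_on \<Omega>) (\<lambda>x. norm (f x) powr p)"
    by (rule Bochner_Integration.integrable_bound[OF c m]) (use le in simp)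
  then show "f \<in> Lp_space p \<Omega>" using assms(4) unfolding Lp_space_def by simp
  have "pint p \<Omega> f \<le> (\<integral>x. M powr p \<partial>lebesgue_on \<Omega>)"
    unfolding pint_def by (rule integral_mono[OF i c le])
  also have "\<dots> = M powr p * measure lebesgue \<Omega>"
    using \<Omega> by (simp add: measure_restrict_space fmeasurableD)
  finally show "pint p \<Omega> f \<le> M powr p * measure lebesgue \<Omega>" .
qed

subsection \<open>The Sobolev spaces as vector spaces\<close>

lemma weak_gradient_eq:
  assumes "open \<Omega>" "has_weak_gradient \<Omega> u g"
  shows "has_weak_gradient \<Omega> u (weak_gradient \<Omega> u)" "AE x in lebesgue_on \<Omega>. weak_gradient \<Omega> u x = g x"
proof -
  show h: "has_weak_gradient \<Omega> u (weak_gradient \<Omega> u)"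
    unfolding weak_gradient_def by (rule someI[of "has_weak_gradient \<Omega> u", OF assms(2)])
  show "AE x in lebesgue_on \<Omega>. weak_gradient \<Omega> u x = g x"
    by (rule has_weak_gradient_unique[OF assms(1) h assms(2)])
qed

lemma has_weak_gradient_measurable:
  assumes "open \<Omega>" "has_weak_gradient \<Omega> u g"
  shows "g \<in> borel_measurable (lebesgue_on \<Omega>)"
  using assms locally_integrable_measurable unfolding has_weak_gradient_def by blast

lemma energy_eq:
  assumes "open \<Omega>" "has_weak_gradient \<Omega> u g"
  shows "energy p \<Omega> u = pint p \<Omega> g"
  unfolding energy_eq_pint
  using has_weak_gradient_measurable[OF assms(1)] weak_gradient_eq[OF assms] assms(2)
  by (intro pint_cong_AE) auto

text \<open>\<open>W1p\<close> only asks for some integrable weak gradient; uniqueness transfers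
  integrability to the one selected by \<open>weak_gradient\<close>.\<close>

lemma W1pD:
  assumes "open \<Omega>" "u \<in> W1p p \<Omega>"
  shows "u \<in> Lp_space p \<Omega>" "has_weak_gradient \<Omega> u (weak_gradient \<Omega> u)" "weak_gradient \<Omega> u \<in> Lp_space p \<Omega>"
proof -
  obtain g where g: "g \<in> Lp_space p \<Omega>" "has_weak_gradient \<Omega> u g" and u: "u \<in> Lp_space p \<Omega>"
    using assms(2) unfolding W1p_def by blast
  show "u \<in> Lp_space p \<Omega>" by (rule u)
  show h: "has_weak_gradient \<Omega> u (weak_gradient \<Omega> u)" using weak_gradient_eq[OF assms(1) g(2)] by blast
  have m: "weak_gradient \<Omega> u \<in> borel_measurable (lebesgue_on \<Omega>)"
    by (rule has_weak_gradient_measurable[OF assms(1) h])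
  have "integrable (lebesgue_on \<Omega>) (\<lambda>x. norm (weak_gradient \<Omega> u x) powr p)"
  proof (rule Bochner_Integration.integrable_bound[OF Lp_spaceD(2)[OF g(1)]])
    show "(\<lambda>x. norm (weak_gradient \<Omega> u x) powr p) \<in> borel_measurable (lebesgue_on \<Omega>)"
      using m by measurable
    show "AE x in lebesgue_on \<Omega>. norm (norm (weak_gradient \<Omega> u x) powr p) \<le> norm (norm (g x) powr p)"
      using weak_gradient_eq(2)[OF assms(1) g(2)] by eventually_elim simp
  qed
  then show "weak_gradient \<Omega> u \<in> Lp_space p \<Omega>" using m unfolding Lp_space_def by simp
qed

lemma W1pI:
  assumes "u \<in> Lp_space p \<Omega>" "g \<in> Lp_space p \<Omega>" "has_weak_gradient \<Omega> u g"
  shows "u \<in> W1p p \<Omega>"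
  using assms unfolding W1p_def by blast

lemma W1p_cmult:
  assumes "open \<Omega>" "p \<ge> 1" "u \<in> W1p p \<Omega>"
  shows "(\<lambda>x. c * u x) \<in> W1p p \<Omega>" "sob p \<Omega> (\<lambda>x. c * u x) = \<bar>c\<bar> powr p * sob p \<Omega> u"
    "energy p \<Omega> (\<lambda>x. c * u x) = \<bar>c\<bar> powr p * energy p \<Omega> u"
proof -
  note u = W1pD[OF assms(1,3)]
  have h: "has_weak_gradient \<Omega> (\<lambda>x. c * u x) (\<lambda>x. c *\<^sub>R weak_gradient \<Omega> u x)"
    using has_weak_gradient_lincomb[OF assms(1) u(2) u(2), of c 0] by simp
  show "(\<lambda>x. c * u x) \<in> W1p p \<Omega>"
    using Lp_space_scaleR[OF u(1), of c] by (intro W1pI[OF _ Lp_space_scaleR[OF u(3)] h]) simp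
  show e: "energy p \<Omega> (\<lambda>x. c * u x) = \<bar>c\<bar> powr p * energy p \<Omega> u"
    unfolding energy_eq[OF assms(1) h] by (simp add: pint_scaleR[OF assms(2)] energy_eq_pint)
  show "sob p \<Omega> (\<lambda>x. c * u x) = \<bar>c\<bar> powr p * sob p \<Omega> u"
    unfolding sob_def e by (simp add: pint_cmult[OF assms(2)] algebra_simps)
qed

lemma W1p_add:
  assumes "open \<Omega>" "1 \<le> p" "u \<in> W1p p \<Omega>" "v \<in> W1p p \<Omega>"
  shows "(\<lambda>x. u x + v x) \<in> W1p p \<Omega>"
    and "\<And>b d. p \<le> b \<Longrightarrow> d > 0 \<Longrightarrow> pint p \<Omega> (\<lambda>x. u x + v x)
      \<le> (1 + d) powr b * pint p \<Omega> u + ((1 + d) / d) powr b * pint p \<Omega> v"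
    and "\<And>b d. p \<le> b \<Longrightarrow> d > 0 \<Longrightarrow> energy p \<Omega> (\<lambda>x. u x + v x)
      \<le> (1 + d) powr b * energy p \<Omega> u + ((1 + d) / d) powr b * energy p \<Omega> v"
    and "\<And>b d. p \<le> b \<Longrightarrow> d > 0 \<Longrightarrow> sob p \<Omega> (\<lambda>x. u x + v x)
      \<le> (1 + d) powr b * sob p \<Omega> u + ((1 + d) / d) powr b * sob p \<Omega> v"
proof -
  note u = W1pD[OF assms(1,3)] and v = W1pD[OF assms(1,4)]
  let ?g = "\<lambda>x. weak_gradient \<Omega> u x + weak_gradient \<Omega> v x"
  have h: "has_weak_gradient \<Omega> (\<lambda>x. u x + v x) ?g"
    using has_weak_gradient_lincomb[OF assms(1) u(2) v(2), of 1 1] by simp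
  have m: "(\<lambda>x. u x + v x) \<in> borel_measurable (lebesgue_on \<Omega>)" "?g \<in> borel_measurable (lebesgue_on \<Omega>)"
    using Lp_spaceD(1)[OF u(1)] Lp_spaceD(1)[OF v(1)] Lp_spaceD(1)[OF u(3)] Lp_spaceD(1)[OF v(3)]
    by measurable
  note D = Lp_space_dominated[OF u(1) v(1) m(1) AE_I2[OF norm_triangle_ineq] assms(2)]
    and E = Lp_space_dominated[OF u(3) v(3) m(2) AE_I2[OF norm_triangle_ineq] assms(2)]
  show "(\<lambda>x. u x + v x) \<in> W1p p \<Omega>"
    using D(1)[of p 1] E(1)[of p 1] h by (intro W1pI) auto
  fix b d :: real assume bd: "p \<le> b" "d > 0"
  show 1: "pint p \<Omega> (\<lambda>x. u x + v x) \<le> (1 + d) powr b * pint p \<Omega> u + ((1 + d) / d) powr b * pint p \<Omega> v"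
    using D(2)[OF bd] .
  show 2: "energy p \<Omega> (\<lambda>x. u x + v x) \<le> (1 + d) powr b * energy p \<Omega> u + ((1 + d) / d) powr b * energy p \<Omega> v"
    using E(2)[OF bd] unfolding energy_eq[OF assms(1) h] energy_eq_pint[of p \<Omega> u] energy_eq_pint[of p \<Omega> v] .
  show "sob p \<Omega> (\<lambda>x. u x + v x) \<le> (1 + d) powr b * sob p \<Omega> u + ((1 + d) / d) powr b * sob p \<Omega> v"
    unfolding sob_def using 1 2 by (simp add: distrib_left)
qed

lemma test_W1p:
  assumes \<Omega>: "open \<Omega>" "bounded \<Omega>" and p: "p \<ge> 1" and \<phi>: "\<phi> \<in> test_functions \<Omega>"
  shows "\<phi> \<in> W1p p \<Omega>" "energy p \<Omega> \<phi> = pint p \<Omega> (grad \<phi>)"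
    "\<And>M. (\<And>x. \<bar>\<phi> x\<bar> \<le> M) \<Longrightarrow> (\<And>x. norm (grad \<phi> x) \<le> M) \<Longrightarrow> sob p \<Omega> \<phi> \<le> 2 * measure lebesgue \<Omega> * M powr p"
proof -
  note h = test_has_weak_gradient[OF \<Omega>(1) \<phi>]
  obtain K where K: "compact K" "K \<subseteq> \<Omega>" "\<And>x. x \<notin> K \<Longrightarrow> \<phi> x = 0" using test_functionsE[OF \<phi>] by metis
  have G: "grad \<phi> x = 0" if "x \<notin> K" for x
    by (rule grad_outside_support(1)[OF K(1) _ that]) (rule K(3))
  obtain B where B: "\<And>x. norm (\<phi> x) \<le> B"
    using bounded_compact_support[OF continuous_on_test(1)[OF \<phi>] K(1,3)] by blast
  obtain B' where B': "\<And>x. norm (grad \<phi> x) \<le> B'"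
    using bounded_compact_support[OF continuous_on_test(2)[OF \<phi>] K(1) G] by blast
  have m: "\<phi> \<in> borel_measurable (lebesgue_on \<Omega>)" "grad \<phi> \<in> borel_measurable (lebesgue_on \<Omega>)"
    by (intro measurable_lebesgue_on_borel borel_measurable_continuous_onI continuous_on_test[OF \<phi>])+
  show "\<phi> \<in> W1p p \<Omega>"
    by (rule W1pI[OF Lp_space_bounded(1)[OF \<Omega> p m(1) B] Lp_space_bounded(1)[OF \<Omega> p m(2) B'] h])
  show e: "energy p \<Omega> \<phi> = pint p \<Omega> (grad \<phi>)" by (rule energy_eq[OF \<Omega>(1) h])
  fix M assume M: "\<And>x. \<bar>\<phi> x\<bar> \<le> M" "\<And>x. norm (grad \<phi> x) \<le> M"
  show "sob p \<Omega> \<phi> \<le> 2 * measure lebesgue \<Omega> * M powr p"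
    unfolding sob_def e
    using Lp_space_bounded(2)[OF \<Omega> p m(1), of M] Lp_space_bounded(2)[OF \<Omega> p m(2) M(2)] M(1)
    by (simp add: mult.commute)
qed

section \<open>The closure of the test functions, and continuity of the integrals\<close>

lemma W0_iff:
  assumes "p \<ge> 1"
  shows "u \<in> W0 p \<Omega> \<longleftrightarrow> u \<in> W1p p \<Omega> \<and> (\<forall>\<epsilon>>0. \<exists>\<phi>\<in>test_functions \<Omega>. sob p \<Omega> (\<lambda>x. u x - \<phi> x) < \<epsilon>)"
proof -
  have "(\<forall>\<epsilon>>0. \<exists>\<phi>\<in>test_functions \<Omega>. W1p_norm p \<Omega> (\<lambda>x. u x - \<phi> x) < \<epsilon>) \<longleftrightarrow>
      (\<forall>\<epsilon>>0. \<exists>\<phi>\<in>test_functions \<Omega>. sob p \<Omega> (\<lambda>x. u x - \<phi> x) < \<epsilon>)" (is "?L \<longleftrightarrow> ?R")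
  proof (intro iffI allI impI)
    fix \<epsilon> :: real assume L: ?L and e: "\<epsilon> > 0"
    then obtain \<phi> where "\<phi> \<in> test_functions \<Omega>" "W1p_norm p \<Omega> (\<lambda>x. u x - \<phi> x) < \<epsilon> powr (1 / p)"
      by (metis powr_gt_zero less_numeral_extra(3))
    then show "\<exists>\<phi>\<in>test_functions \<Omega>. sob p \<Omega> (\<lambda>x. u x - \<phi> x) < \<epsilon>"
      using e assms by (auto simp: W1p_norm_less_iff[OF assms] powr_powr)
  next
    fix \<epsilon> :: real assume R: ?R and e: "\<epsilon> > 0"
    then obtain \<phi> where "\<phi> \<in> test_functions \<Omega>" "sob p \<Omega> (\<lambda>x. u x - \<phi> x) < \<epsilon> powr p"
      by (metis powr_gt_zero less_numeral_extra(3))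
    then show "\<exists>\<phi>\<in>test_functions \<Omega>. W1p_norm p \<Omega> (\<lambda>x. u x - \<phi> x) < \<epsilon>"
      using e by (auto simp: W1p_norm_less_iff[OF assms])
  qed
  then show ?thesis unfolding W0_def by blast
qed

lemma sob_zero: "open \<Omega> \<Longrightarrow> sob p \<Omega> (\<lambda>x. 0) = 0"
  using energy_eq[OF _ test_has_weak_gradient[OF _ test_functions_zero], of \<Omega> p]
  by (simp add: sob_def pint_def grad_const)

lemma test_W0:
  assumes "open \<Omega>" "bounded \<Omega>" "p \<ge> 1" "\<phi> \<in> test_functions \<Omega>"
  shows "\<phi> \<in> W0 p \<Omega>"
  unfolding W0_iff[OF assms(3)]
  using test_W1p(1)[OF assms] assms(4) sob_zero[OF assms(1), of p] by (auto intro!: bexI[of _ \<phi>])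

lemma W0_W1p: "u \<in> W0 p \<Omega> \<Longrightarrow> u \<in> W1p p \<Omega>"
  unfolding W0_def by blast

lemma W1p_diff:
  assumes "open \<Omega>" "1 \<le> p" "u \<in> W1p p \<Omega>" "v \<in> W1p p \<Omega>"
  shows "(\<lambda>x. u x - v x) \<in> W1p p \<Omega>"
  using W1p_add(1)[OF assms(1-3) W1p_cmult(1)[OF assms(1,2,4), of "-1"]] by simp

lemma W0_cmult:
  assumes "open \<Omega>" "bounded \<Omega>" "p \<ge> 1" "u \<in> W0 p \<Omega>"
  shows "(\<lambda>x. c * u x) \<in> W0 p \<Omega>"
  unfolding W0_iff[OF assms(3)]
proof (intro conjI allI impI)
  show "(\<lambda>x. c * u x) \<in> W1p p \<Omega>" by (rule W1p_cmult(1)[OF assms(1,3) W0_W1p[OF assms(4)]])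
  fix \<epsilon> :: real assume e: "\<epsilon> > 0"
  then have "\<epsilon> / (\<bar>c\<bar> powr p + 1) > 0" by (intro divide_pos_pos add_nonneg_pos) auto
  then obtain \<phi> where \<phi>: "\<phi> \<in> test_functions \<Omega>" "sob p \<Omega> (\<lambda>x. u x - \<phi> x) < \<epsilon> / (\<bar>c\<bar> powr p + 1)"
    using assms(4) unfolding W0_iff[OF assms(3)] by blast
  have d: "(\<lambda>x. u x - \<phi> x) \<in> W1p p \<Omega>"
    by (rule W1p_diff[OF assms(1,3) W0_W1p[OF assms(4)] test_W1p(1)[OF assms(1-3) \<phi>(1)]])
  have "sob p \<Omega> (\<lambda>x. c * u x - c * \<phi> x) = \<bar>c\<bar> powr p * sob p \<Omega> (\<lambda>x. u x - \<phi> x)"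
    using W1p_cmult(2)[OF assms(1,3) d, of c] by (simp add: right_diff_distrib)
  also have "\<dots> \<le> \<bar>c\<bar> powr p * (\<epsilon> / (\<bar>c\<bar> powr p + 1))"
    using \<phi>(2) by (intro mult_left_mono) auto
  also have "\<dots> < \<epsilon>"
  proof -
    have "c' * (\<epsilon> / (c' + 1)) < \<epsilon>" if "c' \<ge> 0" for c' using that e by (simp add: field_simps)
    then show ?thesis by simp
  qed
  finally show "\<exists>\<phi>\<in>test_functions \<Omega>. sob p \<Omega> (\<lambda>x. c * u x - \<phi> x) < \<epsilon>"
    by (intro bexI[of _ "\<lambda>x. c * \<phi> x"] test_functions_cmult[OF \<phi>(1)])
qed

text \<open>Takes the place of the reverse triangle inequality, which fails for p-th powers: the two
  bounds, with first coefficients near 1, squeeze \<open>B\<close> towards \<open>A\<close>. The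
  exponent \<open>b\<close> need not be that of the integrals, so one \<delta> can serve all
  exponents up to \<open>b\<close>.\<close>

lemma quasi_continuity:
  fixes A b \<epsilon> :: real
  assumes "A \<ge> 0" "\<epsilon> > 0"
  obtains \<delta> where "\<delta> > 0"
    "\<And>B D. 0 \<le> B \<Longrightarrow> 0 \<le> D \<Longrightarrow> D < \<delta> \<Longrightarrow>
      (\<And>d. d > 0 \<Longrightarrow> B \<le> (1 + d) powr b * A + ((1 + d) / d) powr b * D) \<Longrightarrow>
      (\<And>d. d > 0 \<Longrightarrow> A \<le> (1 + d) powr b * B + ((1 + d) / d) powr b * D) \<Longrightarrow> \<bar>B - A\<bar> < \<epsilon>"
proof -
  \<comment> \<open>The second bound produces the error \<eta> * B, where \<open>B\<close> is only
    known to be below \<open>A + \<epsilon>\<close>; hence this sum in the denominator.\<close>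
  define \<eta> where "\<eta> = \<epsilon> / (4 * (A + \<epsilon> + 1))"
  have \<eta>: "\<eta> > 0" "\<eta> * (A + \<epsilon>) \<le> \<epsilon> / 4" "\<eta> * A \<le> \<epsilon> / 4"
  proof -
    show "\<eta> > 0" unfolding \<eta>_def using assms by (intro divide_pos_pos) auto
    have "\<eta> * (A + \<epsilon> + 1) = \<epsilon> / 4" unfolding \<eta>_def using assms by (simp add: field_simps)
    moreover have "\<eta> * (A + \<epsilon>) \<le> \<eta> * (A + \<epsilon> + 1)" "\<eta> * A \<le> \<eta> * (A + \<epsilon> + 1)"
      using \<open>\<eta> > 0\<close> assms by (intro mult_left_mono; simp)+
    ultimately show "\<eta> * (A + \<epsilon>) \<le> \<epsilon> / 4" "\<eta> * A \<le> \<epsilon> / 4" by simp_all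
  qed
  have "((\<lambda>d. (1 + d) powr b) \<longlongrightarrow> (1 + 0) powr b) (at_right 0)"
    by (intro tendsto_intros) auto
  then have "eventually (\<lambda>d. (1 + d) powr b < 1 + \<eta>) (at_right 0)"
    using \<eta>(1) by (intro order_tendstoD) auto
  moreover have "eventually (\<lambda>d::real. d > 0) (at_right 0)" by (simp add: eventually_at_filter)
  ultimately have "eventually (\<lambda>d. (1 + d) powr b < 1 + \<eta> \<and> d > 0) (at_right 0)"
    by (rule eventually_conj)
  then obtain d where d: "d > 0" "(1 + d) powr b < 1 + \<eta>"
    using eventually_happens'[OF trivial_limit_at_right_real] by blast
  define C where "C = ((1 + d) / d) powr b"
  have C: "C > 0" using d(1) by (simp add: C_def)
  show ?thesis
  proof (rule that)
    show "\<epsilon> / (4 * C) > 0" using assms C by simp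
    fix B D assume BD: "0 \<le> B" "0 \<le> D" "D < \<epsilon> / (4 * C)"
      and 1: "\<And>d. d > 0 \<Longrightarrow> B \<le> (1 + d) powr b * A + ((1 + d) / d) powr b * D"
      and 2: "\<And>d. d > 0 \<Longrightarrow> A \<le> (1 + d) powr b * B + ((1 + d) / d) powr b * D"
    have CD: "C * D < \<epsilon> / 4" using BD(3) C by (simp add: field_simps)
    have "B \<le> (1 + \<eta>) * A + C * D"
      using 1[OF d(1)] mult_right_mono[OF less_imp_le[OF d(2)] assms(1)] by (simp add: C_def)
    then have B: "B < A + \<epsilon>" using CD \<eta> assms(2) by (simp add: algebra_simps)
    have "A \<le> (1 + \<eta>) * B + C * D"
      using 2[OF d(1)] mult_right_mono[OF less_imp_le[OF d(2)] BD(1)] by (simp add: C_def)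
    moreover have "\<eta> * B \<le> \<eta> * (A + \<epsilon>)" using B \<eta>(1) by (intro mult_left_mono) auto
    ultimately have "A < B + \<epsilon>" using CD \<eta> assms(2) by (simp add: algebra_simps)
    with B show "\<bar>B - A\<bar> < \<epsilon>" by linarith
  qed
qed

lemma W1p_continuity:
  assumes \<Omega>: "open \<Omega>" and p: "p \<ge> 1" and u: "u \<in> W1p p \<Omega>" and "\<epsilon> > 0"
  obtains \<delta> where "\<delta> > 0"
    "\<And>v. v \<in> W1p p \<Omega> \<Longrightarrow> sob p \<Omega> (\<lambda>x. v x - u x) < \<delta> \<Longrightarrow>
      \<bar>pint p \<Omega> v - pint p \<Omega> u\<bar> < \<epsilon> \<and> \<bar>energy p \<Omega> v - energy p \<Omega> u\<bar> < \<epsilon> \<and> \<bar>sob p \<Omega> v - sob p \<Omega> u\<bar> < \<epsilon>"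
proof -
  \<comment> \<open>Half for each integral, because \<open>sob\<close> is their sum.\<close>
  have e: "\<epsilon> / 2 > 0" using assms(4) by simp
  obtain \<delta>1 where \<delta>1: "\<delta>1 > 0" "\<And>B D. 0 \<le> B \<Longrightarrow> 0 \<le> D \<Longrightarrow> D < \<delta>1 \<Longrightarrow>
      (\<And>d. d > 0 \<Longrightarrow> B \<le> (1 + d) powr p * pint p \<Omega> u + ((1 + d) / d) powr p * D) \<Longrightarrow>
      (\<And>d. d > 0 \<Longrightarrow> pint p \<Omega> u \<le> (1 + d) powr p * B + ((1 + d) / d) powr p * D) \<Longrightarrow> \<bar>B - pint p \<Omega> u\<bar> < \<epsilon> / 2"
    using quasi_continuity[OF pint_nonneg e] by metis
  obtain \<delta>2 where \<delta>2: "\<delta>2 > 0" "\<And>B D. 0 \<le> B \<Longrightarrow> 0 \<le> D \<Longrightarrow> D < \<delta>2 \<Longrightarrow>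
      (\<And>d. d > 0 \<Longrightarrow> B \<le> (1 + d) powr p * energy p \<Omega> u + ((1 + d) / d) powr p * D) \<Longrightarrow>
      (\<And>d. d > 0 \<Longrightarrow> energy p \<Omega> u \<le> (1 + d) powr p * B + ((1 + d) / d) powr p * D) \<Longrightarrow> \<bar>B - energy p \<Omega> u\<bar> < \<epsilon> / 2"
    using quasi_continuity[OF energy_nonneg e] by metis
  show ?thesis
  proof (rule that[of "min \<delta>1 \<delta>2"])
    show "min \<delta>1 \<delta>2 > 0" using \<delta>1(1) \<delta>2(1) by simp
    fix v assume v: "v \<in> W1p p \<Omega>" and s: "sob p \<Omega> (\<lambda>x. v x - u x) < min \<delta>1 \<delta>2"
    let ?w = "\<lambda>x. v x - u x"
    have w: "?w \<in> W1p p \<Omega>" by (rule W1p_diff[OF \<Omega> p v u])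
    \<comment> \<open>\<open>u\<close> is \<open>v\<close> plus the negative of \<open>?w\<close>,
      which has the same integrals as \<open>?w\<close>; this gives the second of the two
      bounds.\<close>
    have m: "(\<lambda>x. (- 1) * ?w x) \<in> W1p p \<Omega>" "pint p \<Omega> (\<lambda>x. (- 1) * ?w x) = pint p \<Omega> ?w"
      "energy p \<Omega> (\<lambda>x. (- 1) * ?w x) = energy p \<Omega> ?w"
      using W1p_cmult(1)[OF \<Omega> p w, of "- 1"] W1p_cmult(3)[OF \<Omega> p w, of "- 1"] pint_cmult[OF p, of \<Omega> "- 1" ?w]
      by simp_all
    note a = W1p_add(2,3)[OF \<Omega> p u w order_refl] and b = W1p_add(2,3)[OF \<Omega> p v m(1) order_refl]
    have "\<bar>pint p \<Omega> v - pint p \<Omega> u\<bar> < \<epsilon> / 2"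
    proof (rule \<delta>1(2)[OF pint_nonneg pint_nonneg])
      show "pint p \<Omega> ?w < \<delta>1" using s pint_le_sob[of p \<Omega> ?w] by linarith
      show "pint p \<Omega> v \<le> (1 + d) powr p * pint p \<Omega> u + ((1 + d) / d) powr p * pint p \<Omega> ?w" if "d > 0" for d
        using a(1)[OF that] by simp
      show "pint p \<Omega> u \<le> (1 + d) powr p * pint p \<Omega> v + ((1 + d) / d) powr p * pint p \<Omega> ?w" if "d > 0" for d
        using b(1)[OF that] unfolding m(2) by simp
    qed
    moreover have "\<bar>energy p \<Omega> v - energy p \<Omega> u\<bar> < \<epsilon> / 2"
    proof (rule \<delta>2(2)[OF energy_nonneg energy_nonneg])
      show "energy p \<Omega> ?w < \<delta>2" using s energy_le_sob[of p \<Omega> ?w] by linarith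
      show "energy p \<Omega> v \<le> (1 + d) powr p * energy p \<Omega> u + ((1 + d) / d) powr p * energy p \<Omega> ?w" if "d > 0" for d
        using a(2)[OF that] by simp
      show "energy p \<Omega> u \<le> (1 + d) powr p * energy p \<Omega> v + ((1 + d) / d) powr p * energy p \<Omega> ?w" if "d > 0" for d
        using b(2)[OF that] unfolding m(3) by simp
    qed
    ultimately show "\<bar>pint p \<Omega> v - pint p \<Omega> u\<bar> < \<epsilon> \<and> \<bar>energy p \<Omega> v - energy p \<Omega> u\<bar> < \<epsilon> \<and> \<bar>sob p \<Omega> v - sob p \<Omega> u\<bar> < \<epsilon>"
      unfolding sob_def by linarith
  qed
qed

subsection \<open>The topology of the Sobolev space\<close>

lemma W1p_continuity_ex:
  assumes "open \<Omega>" "p \<ge> 1" "u \<in> W1p p \<Omega>" "\<epsilon> > 0"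
  shows "\<exists>\<delta>>0. \<forall>v\<in>W1p p \<Omega>. sob p \<Omega> (\<lambda>x. v x - u x) < \<delta> \<longrightarrow>
      \<bar>pint p \<Omega> v - pint p \<Omega> u\<bar> < \<epsilon> \<and> \<bar>energy p \<Omega> v - energy p \<Omega> u\<bar> < \<epsilon> \<and> \<bar>sob p \<Omega> v - sob p \<Omega> u\<bar> < \<epsilon>"
proof (rule W1p_continuity[OF assms])
  fix \<delta> assume "\<delta> > 0" "\<And>v. v \<in> W1p p \<Omega> \<Longrightarrow> sob p \<Omega> (\<lambda>x. v x - u x) < \<delta> \<Longrightarrow>
      \<bar>pint p \<Omega> v - pint p \<Omega> u\<bar> < \<epsilon> \<and> \<bar>energy p \<Omega> v - energy p \<Omega> u\<bar> < \<epsilon> \<and> \<bar>sob p \<Omega> v - sob p \<Omega> u\<bar> < \<epsilon>"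
  then show ?thesis by blast
qed

lemma openin_W0_iff:
  assumes "p \<ge> 1"
  shows "openin (W0_topology p \<Omega>) U \<longleftrightarrow> U \<subseteq> W0 p \<Omega> \<and>
     (\<forall>u\<in>U. \<exists>\<epsilon>>0. \<forall>v\<in>W0 p \<Omega>. sob p \<Omega> (\<lambda>x. v x - u x) < \<epsilon> \<longrightarrow> v \<in> U)"
proof -
  have "(\<exists>\<epsilon>>0. \<forall>v\<in>W0 p \<Omega>. W1p_norm p \<Omega> (\<lambda>x. v x - u x) < \<epsilon> \<longrightarrow> v \<in> U) \<longleftrightarrow>
      (\<exists>\<epsilon>>0. \<forall>v\<in>W0 p \<Omega>. sob p \<Omega> (\<lambda>x. v x - u x) < \<epsilon> \<longrightarrow> v \<in> U)" for u
  proof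
    assume "\<exists>\<epsilon>>0. \<forall>v\<in>W0 p \<Omega>. W1p_norm p \<Omega> (\<lambda>x. v x - u x) < \<epsilon> \<longrightarrow> v \<in> U"
    then obtain \<epsilon> where e: "\<epsilon> > 0" "\<forall>v\<in>W0 p \<Omega>. W1p_norm p \<Omega> (\<lambda>x. v x - u x) < \<epsilon> \<longrightarrow> v \<in> U" by blast
    then show "\<exists>\<epsilon>>0. \<forall>v\<in>W0 p \<Omega>. sob p \<Omega> (\<lambda>x. v x - u x) < \<epsilon> \<longrightarrow> v \<in> U"
      by (intro exI[of _ "\<epsilon> powr p"]) (simp add: W1p_norm_less_iff[OF assms])
  next
    assume "\<exists>\<epsilon>>0. \<forall>v\<in>W0 p \<Omega>. sob p \<Omega> (\<lambda>x. v x - u x) < \<epsilon> \<longrightarrow> v \<in> U"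
    then obtain \<epsilon> where e: "\<epsilon> > 0" "\<forall>v\<in>W0 p \<Omega>. sob p \<Omega> (\<lambda>x. v x - u x) < \<epsilon> \<longrightarrow> v \<in> U" by blast
    then show "\<exists>\<epsilon>>0. \<forall>v\<in>W0 p \<Omega>. W1p_norm p \<Omega> (\<lambda>x. v x - u x) < \<epsilon> \<longrightarrow> v \<in> U"
      using assms by (intro exI[of _ "\<epsilon> powr (1 / p)"]) (simp add: W1p_norm_less_iff powr_powr)
  qed
  then show ?thesis unfolding openin_W0_topology by simp
qed

text \<open>The filter is arbitrary, so the result serves both approximating sequences and limits at
  points of the sphere.\<close>

lemma tendsto_W1p:
  assumes "open \<Omega>" "p \<ge> 1" "u \<in> W1p p \<Omega>" "eventually (\<lambda>\<xi>. f \<xi> \<in> W1p p \<Omega>) F"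
    "((\<lambda>\<xi>. sob p \<Omega> (\<lambda>x. f \<xi> x - u x)) \<longlongrightarrow> 0) F"
  shows "((\<lambda>\<xi>. pint p \<Omega> (f \<xi>)) \<longlongrightarrow> pint p \<Omega> u) F"
    and "((\<lambda>\<xi>. energy p \<Omega> (f \<xi>)) \<longlongrightarrow> energy p \<Omega> u) F"
    and "((\<lambda>\<xi>. sob p \<Omega> (f \<xi>)) \<longlongrightarrow> sob p \<Omega> u) F"
proof -
  have *: "eventually (\<lambda>\<xi>. \<bar>pint p \<Omega> (f \<xi>) - pint p \<Omega> u\<bar> < \<epsilon> \<and> \<bar>energy p \<Omega> (f \<xi>) - energy p \<Omega> u\<bar> < \<epsilon>
      \<and> \<bar>sob p \<Omega> (f \<xi>) - sob p \<Omega> u\<bar> < \<epsilon>) F" if e: "\<epsilon> > 0" for \<epsilon>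
  proof -
    obtain \<delta> where d: "\<delta> > 0" "\<And>v. v \<in> W1p p \<Omega> \<Longrightarrow> sob p \<Omega> (\<lambda>x. v x - u x) < \<delta> \<Longrightarrow>
      \<bar>pint p \<Omega> v - pint p \<Omega> u\<bar> < \<epsilon> \<and> \<bar>energy p \<Omega> v - energy p \<Omega> u\<bar> < \<epsilon> \<and> \<bar>sob p \<Omega> v - sob p \<Omega> u\<bar> < \<epsilon>"
      using W1p_continuity[OF assms(1-3) e] by metis
    have "eventually (\<lambda>\<xi>. sob p \<Omega> (\<lambda>x. f \<xi> x - u x) < \<delta>) F"
      using assms(5) d(1) by (rule order_tendstoD(2))
    with assms(4) show ?thesis
      by eventually_elim (rule d(2))
  qed
  show "((\<lambda>\<xi>. pint p \<Omega> (f \<xi>)) \<longlongrightarrow> pint p \<Omega> u) F" "((\<lambda>\<xi>. energy p \<Omega> (f \<xi>)) \<longlongrightarrow> energy p \<Omega> u) F"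
    "((\<lambda>\<xi>. sob p \<Omega> (f \<xi>)) \<longlongrightarrow> sob p \<Omega> u) F"
    by (rule tendstoI, drule *, erule eventually_mono, simp add: dist_real_def)+
qed

lemma eventually_atin_openin:
  "openin X U \<Longrightarrow> \<xi> \<in> U \<Longrightarrow> (\<And>x. x \<in> U \<Longrightarrow> P x) \<Longrightarrow> eventually P (atin X \<xi>)"
  unfolding eventually_atin by blast

lemma continuous_map_W0_in:
  assumes "continuous_map X (W0_topology p \<Omega>) f" "\<xi> \<in> topspace X"
  shows "f \<xi> \<in> W0 p \<Omega>"
proof -
  have "f ` topspace X \<subseteq> W0 p \<Omega>"
    using continuous_map_image_subset_topspace[OF assms(1)] by simp
  then show ?thesis using assms(2) by blast
qed

text \<open>A set of small \<open>sob\<close>-distance from \<open>f \<xi>\<close> is open by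
  continuity of \<open>sob\<close>, in place of the triangle inequality; its preimage is the
  required neighbourhood.\<close>

lemma continuous_map_W0D:
  assumes \<Omega>: "open \<Omega>" and p: "p \<ge> 1" and f: "continuous_map X (W0_topology p \<Omega>) f" and \<xi>: "\<xi> \<in> topspace X"
  shows "((\<lambda>\<zeta>. sob p \<Omega> (\<lambda>x. f \<zeta> x - f \<xi> x)) \<longlongrightarrow> 0) (atin X \<xi>)"
proof (rule order_tendstoI)
  fix a :: real assume "a < 0"
  then have "a < sob p \<Omega> w" for w using sob_nonneg[of p \<Omega> w] by linarith
  then show "eventually (\<lambda>\<zeta>. a < sob p \<Omega> (\<lambda>x. f \<zeta> x - f \<xi> x)) (atin X \<xi>)" by simp
next
  fix \<epsilon> :: real assume e: "0 < \<epsilon>"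
  let ?u = "f \<xi>"
  let ?V = "{v \<in> W0 p \<Omega>. sob p \<Omega> (\<lambda>x. v x - ?u x) < \<epsilon>}"
  have u: "?u \<in> W0 p \<Omega>" by (rule continuous_map_W0_in[OF f \<xi>])
  have "openin (W0_topology p \<Omega>) ?V"
    unfolding openin_W0_iff[OF p]
  proof (intro conjI ballI)
    fix v assume v: "v \<in> ?V"
    let ?w = "\<lambda>x. v x - ?u x"
    have w: "?w \<in> W1p p \<Omega>" using v by (intro W1p_diff[OF \<Omega> p _ W0_W1p[OF u]] W0_W1p) simp
    have "\<epsilon> - sob p \<Omega> ?w > 0" using v by simp
    from W1p_continuity_ex[OF \<Omega> p w this] obtain \<delta> where d: "\<delta> > 0" "\<forall>v\<in>W1p p \<Omega>.
      sob p \<Omega> (\<lambda>x. v x - ?w x) < \<delta> \<longrightarrow> \<bar>pint p \<Omega> v - pint p \<Omega> ?w\<bar> < \<epsilon> - sob p \<Omega> ?w \<and>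
      \<bar>energy p \<Omega> v - energy p \<Omega> ?w\<bar> < \<epsilon> - sob p \<Omega> ?w \<and> \<bar>sob p \<Omega> v - sob p \<Omega> ?w\<bar> < \<epsilon> - sob p \<Omega> ?w"
      by (elim exE conjE)
    have "v' \<in> ?V" if v': "v' \<in> W0 p \<Omega>" "sob p \<Omega> (\<lambda>x. v' x - v x) < \<delta>" for v'
    proof -
      have "\<bar>sob p \<Omega> (\<lambda>x. v' x - ?u x) - sob p \<Omega> ?w\<bar> < \<epsilon> - sob p \<Omega> ?w"
        using v'(2) bspec[OF d(2) W1p_diff[OF \<Omega> p W0_W1p[OF v'(1)] W0_W1p[OF u]]] by simp
      then show ?thesis using v'(1) by simp
    qed
    then show "\<exists>\<epsilon>>0. \<forall>v'\<in>W0 p \<Omega>. sob p \<Omega> (\<lambda>x. v' x - v x) < \<epsilon> \<longrightarrow> v' \<in> ?V"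
      using d(1) by blast
  qed blast
  then have o: "openin X {\<zeta> \<in> topspace X. f \<zeta> \<in> ?V}"
    by (rule openin_continuous_map_preimage[OF f])
  have "f \<xi> \<in> ?V" using u e sob_zero[OF \<Omega>, of p] by simp
  then show "eventually (\<lambda>\<zeta>. sob p \<Omega> (\<lambda>x. f \<zeta> x - f \<xi> x) < \<epsilon>) (atin X \<xi>)"
    using \<xi> by (intro eventually_atin_openin[OF o]) auto
qed

lemma continuous_map_W0I:
  assumes p: "p \<ge> 1" and f: "\<And>\<xi>. \<xi> \<in> topspace X \<Longrightarrow> f \<xi> \<in> W0 p \<Omega>"
    and lim: "\<And>\<xi>. \<xi> \<in> topspace X \<Longrightarrow> ((\<lambda>\<zeta>. sob p \<Omega> (\<lambda>x. f \<zeta> x - f \<xi> x)) \<longlongrightarrow> 0) (atin X \<xi>)"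
  shows "continuous_map X (W0_topology p \<Omega>) f"
  unfolding continuous_map_def
proof (intro conjI allI impI)
  show "f \<in> topspace X \<rightarrow> topspace (W0_topology p \<Omega>)" using f by simp
  fix V assume V: "openin (W0_topology p \<Omega>) V"
  show "openin X {x \<in> topspace X. f x \<in> V}"
  proof (subst openin_subopen, intro ballI)
    fix \<xi> assume "\<xi> \<in> {x \<in> topspace X. f x \<in> V}"
    then have \<xi>: "\<xi> \<in> topspace X" "f \<xi> \<in> V" by auto
    then obtain \<epsilon> where e: "\<epsilon> > 0" "\<forall>v\<in>W0 p \<Omega>. sob p \<Omega> (\<lambda>x. v x - f \<xi> x) < \<epsilon> \<longrightarrow> v \<in> V"
      using V unfolding openin_W0_iff[OF p] by blast
    have "eventually (\<lambda>\<zeta>. sob p \<Omega> (\<lambda>x. f \<zeta> x - f \<xi> x) < \<epsilon>) (atin X \<xi>)"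
      using lim[OF \<xi>(1)] e(1) by (rule order_tendstoD(2))
    then obtain U where U: "openin X U" "\<xi> \<in> U" "\<forall>\<zeta>\<in>U - {\<xi>}. sob p \<Omega> (\<lambda>x. f \<zeta> x - f \<xi> x) < \<epsilon>"
      using \<xi>(1) unfolding eventually_atin by blast
    have "U \<subseteq> {x \<in> topspace X. f x \<in> V}"
    proof
      fix \<zeta> assume z: "\<zeta> \<in> U"
      then have "\<zeta> \<in> topspace X" using U(1) openin_subset by blast
      \<comment> \<open>The filter \<open>atin\<close> says nothing at the point \<xi> itself, where
        membership in \<open>V\<close> is known already.\<close>
      then show "\<zeta> \<in> {x \<in> topspace X. f x \<in> V}" using \<xi>(2) z U(3) e(2) f by (cases "\<zeta> = \<xi>") auto
    qed
    then show "\<exists>T. openin X T \<and> \<xi> \<in> T \<and> T \<subseteq> {x \<in> topspace X. f x \<in> V}" using U by blast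
  qed
qed

lemma continuous_map_W0_functionals:
  assumes \<Omega>: "open \<Omega>" and p: "p \<ge> 1" and f: "continuous_map X (W0_topology p \<Omega>) f" and \<xi>: "\<xi> \<in> topspace X"
  shows "((\<lambda>\<zeta>. pint p \<Omega> (f \<zeta>)) \<longlongrightarrow> pint p \<Omega> (f \<xi>)) (atin X \<xi>)"
    and "((\<lambda>\<zeta>. energy p \<Omega> (f \<zeta>)) \<longlongrightarrow> energy p \<Omega> (f \<xi>)) (atin X \<xi>)"
proof -
  have f': "f \<zeta> \<in> W1p p \<Omega>" if "\<zeta> \<in> topspace X" for \<zeta>
    by (rule W0_W1p[OF continuous_map_W0_in[OF f that]])
  have ev: "eventually (\<lambda>\<zeta>. f \<zeta> \<in> W1p p \<Omega>) (atin X \<xi>)"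
    by (rule eventually_atin_openin[OF openin_topspace \<xi> f'])
  show "((\<lambda>\<zeta>. pint p \<Omega> (f \<zeta>)) \<longlongrightarrow> pint p \<Omega> (f \<xi>)) (atin X \<xi>)"
    "((\<lambda>\<zeta>. energy p \<Omega> (f \<zeta>)) \<longlongrightarrow> energy p \<Omega> (f \<xi>)) (atin X \<xi>)"
    using tendsto_W1p(1,2)[OF \<Omega> p f'[OF \<xi>] ev continuous_map_W0D[OF \<Omega> p f \<xi>]] by auto
qed

subsection \<open>Odd maps of the sphere\<close>

text \<open>\<open>Sigma_DR\<close> collects images, but the constructions act on the parametrizing
  maps.\<close>

definition odd_sphere_map :: "nat \<Rightarrow> real \<Rightarrow> 'a::euclidean_space set \<Rightarrow> ((nat \<Rightarrow> real) \<Rightarrow> 'a \<Rightarrow> real) \<Rightarrow> bool" where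
  "odd_sphere_map k p \<Omega> h \<longleftrightarrow>
     continuous_map (nsphere (k - 1)) (subtopology (W0_topology p \<Omega>) (unit_Lp_sphere p \<Omega>)) h \<and>
     (\<forall>\<xi>\<in>topspace (nsphere (k - 1)). AE x in lebesgue_on \<Omega>. h (\<lambda>i. - \<xi> i) x = - h \<xi> x)"

lemma Sigma_DR_eq: "Sigma_DR k p \<Omega> = {h ` topspace (nsphere (k - 1)) | h. odd_sphere_map k p \<Omega> h}"
  unfolding Sigma_DR_def odd_sphere_map_def by (rule refl)

text \<open>A closed subset of the infinite product of the intervals \<open>{-1..1}\<close>, which
  is compact by Tychonoff's theorem.\<close>

lemma compact_space_nsphere: "compact_space (nsphere n)"
proof -
  let ?S = "{x :: nat \<Rightarrow> real. (\<Sum>i\<le>n. x i ^ 2) = 1 \<and> (\<forall>i>n. x i = 0)}"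
  let ?P = "powertop_real (UNIV :: nat set)"
  let ?K = "PiE UNIV (\<lambda>i::nat. {-1..1::real})"
  have "compactin ?P ?K" by (simp add: compactin_PiE)
  moreover have "?S \<subseteq> ?K"
  proof
    fix x assume x: "x \<in> ?S"
    have "x i \<in> {-1..1}" for i
    proof (cases "i \<le> n")
      case True
      have "(x i)\<^sup>2 \<le> (\<Sum>i\<le>n. (x i)\<^sup>2)" using True by (intro member_le_sum) auto
      then have "(x i)\<^sup>2 \<le> 1" using x by simp
      then have "\<bar>x i\<bar> \<le> 1" by (simp add: abs_square_le_1)
      then show ?thesis by auto
    qed (use x in auto)
    then show "x \<in> ?K" by auto
  qed
  moreover have "closedin ?P ?S"
  proof -
    have pr: "continuous_map ?P euclideanreal (\<lambda>x. x i)" for i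
      by (rule continuous_map_product_projection) simp
    have "closedin ?P {x \<in> topspace ?P. (\<Sum>i\<le>n. (x i)\<^sup>2) \<in> {1}}"
      by (rule closedin_continuous_map_preimage) (auto intro!: continuous_map_sum continuous_map_real_pow pr)
    moreover have "closedin ?P {x \<in> topspace ?P. x i \<in> {0}}" for i
      by (rule closedin_continuous_map_preimage[OF pr]) simp
    then have "closedin ?P (\<Inter>i\<in>{n<..}. {x \<in> topspace ?P. x i \<in> {0}})"
      by (intro closedin_INT) auto
    ultimately have "closedin ?P ({x \<in> topspace ?P. (\<Sum>i\<le>n. (x i)\<^sup>2) \<in> {1}} \<inter> (\<Inter>i\<in>{n<..}. {x \<in> topspace ?P. x i \<in> {0}}))"
      by (rule closedin_Int)
    moreover have "{x \<in> topspace ?P. (\<Sum>i\<le>n. (x i)\<^sup>2) \<in> {1}} \<inter> (\<Inter>i\<in>{n<..}. {x \<in> topspace ?P. x i \<in> {0}}) = ?S"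
      by auto
    ultimately show ?thesis by simp
  qed
  ultimately have "compactin ?P ?S" using closed_compactin by blast
  then show ?thesis unfolding nsphere by (simp add: compact_space_subtopology)
qed

section \<open>The maximal energy on an image and the infimum over images\<close>

lemma odd_sphere_map_continuous:
  "odd_sphere_map k p \<Omega> h \<Longrightarrow> continuous_map (nsphere (k - 1)) (W0_topology p \<Omega>) h"
  unfolding odd_sphere_map_def by (simp add: continuous_map_in_subtopology)

lemma odd_sphere_mapD:
  assumes "odd_sphere_map k p \<Omega> h" "\<xi> \<in> topspace (nsphere (k - 1))"
  shows "h \<xi> \<in> W0 p \<Omega>" "pint p \<Omega> (h \<xi>) = 1" "AE x in lebesgue_on \<Omega>. h (\<lambda>i. - \<xi> i) x = - h \<xi> x"
proof -
  have "h \<xi> \<in> unit_Lp_sphere p \<Omega>"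
    using assms unfolding odd_sphere_map_def continuous_map_in_subtopology by blast
  then show "h \<xi> \<in> W0 p \<Omega>" "pint p \<Omega> (h \<xi>) = 1" unfolding unit_Lp_sphere_def pint_def by auto
  show "AE x in lebesgue_on \<Omega>. h (\<lambda>i. - \<xi> i) x = - h \<xi> x"
    using assms unfolding odd_sphere_map_def by blast
qed

text \<open>The energies form a nonempty compact set of reals. Hence the maximum is attained, and
  \<open>GREATEST\<close> denotes it rather than an unspecified value.\<close>

lemma odd_sphere_map_max_energy:
  assumes "open \<Omega>" "p \<ge> 1" "odd_sphere_map k p \<Omega> h"
  defines "E \<equiv> energy p \<Omega> ` h ` topspace (nsphere (k - 1))"
  shows "(GREATEST c. c \<in> E) \<in> E" "\<And>c. c \<in> E \<Longrightarrow> c \<le> (GREATEST c. c \<in> E)"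
proof -
  let ?X = "nsphere (k - 1)"
  have "continuous_map ?X euclideanreal (\<lambda>\<xi>. energy p \<Omega> (h \<xi>))"
    unfolding continuous_map_atin
    using continuous_map_W0_functionals(2)[OF assms(1,2) odd_sphere_map_continuous[OF assms(3)]] by simp
  then have "compactin euclideanreal ((\<lambda>\<xi>. energy p \<Omega> (h \<xi>)) ` topspace ?X)"
    using compact_space_nsphere[of "k - 1"] unfolding compact_space_def by (rule image_compactin[rotated])
  then have "compact E" by (simp add: E_def image_image)
  moreover have "E \<noteq> {}" using in_topspace_nsphere unfolding E_def by blast
  ultimately obtain m where m: "m \<in> E" "\<And>c. c \<in> E \<Longrightarrow> c \<le> m"
    using compact_attains_sup[of E] by blast
  then have "(GREATEST c. c \<in> E) = m" by (intro Greatest_equality)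
  then show "(GREATEST c. c \<in> E) \<in> E" "\<And>c. c \<in> E \<Longrightarrow> c \<le> (GREATEST c. c \<in> E)" using m by auto
qed

lemma bdd_below_max_energy:
  assumes "open \<Omega>" "p \<ge> 1"
  shows "bdd_below ((\<lambda>A. GREATEST c. c \<in> energy p \<Omega> ` A) ` Sigma_DR k p \<Omega>)"
proof (rule bdd_belowI2)
  fix A assume "A \<in> Sigma_DR k p \<Omega>"
  then obtain g where g: "odd_sphere_map k p \<Omega> g" "A = g ` topspace (nsphere (k - 1))"
    unfolding Sigma_DR_eq by blast
  obtain u where "(GREATEST c. c \<in> energy p \<Omega> ` A) = energy p \<Omega> u"
    using odd_sphere_map_max_energy(1)[OF assms g(1)] unfolding g(2) by (elim imageE)
  then show "0 \<le> (GREATEST c. c \<in> energy p \<Omega> ` A)"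
    by (simp only: energy_nonneg)
qed

lemma lambda_DR_le:
  assumes "open \<Omega>" "p \<ge> 1" "odd_sphere_map k p \<Omega> h"
    and "\<And>\<xi>. \<xi> \<in> topspace (nsphere (k - 1)) \<Longrightarrow> energy p \<Omega> (h \<xi>) \<le> c"
  shows "lambda_DR k p \<Omega> \<le> c"
  unfolding lambda_DR_def
proof (rule cINF_lower2)
  show "bdd_below ((\<lambda>A. GREATEST c. c \<in> energy p \<Omega> ` A) ` Sigma_DR k p \<Omega>)"
    by (rule bdd_below_max_energy[OF assms(1,2)])
  show "h ` topspace (nsphere (k - 1)) \<in> Sigma_DR k p \<Omega>" unfolding Sigma_DR_eq using assms(3) by blast
  show "(GREATEST c. c \<in> energy p \<Omega> ` h ` topspace (nsphere (k - 1))) \<le> c"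
    using odd_sphere_map_max_energy(1)[OF assms(1-3)] assms(4) by (auto simp del: topspace_subtopology)
qed

text \<open>The map \<open>g\<close> is a witness that the family is nonempty, so that the infimum
  can be approached; \<open>h\<close> is otherwise unrelated to it.\<close>

lemma lambda_DR_approx:
  assumes "open \<Omega>" "p \<ge> 1" "odd_sphere_map k p \<Omega> g" "\<epsilon> > 0"
  obtains h where "odd_sphere_map k p \<Omega> h"
    "\<And>\<xi>. \<xi> \<in> topspace (nsphere (k - 1)) \<Longrightarrow> energy p \<Omega> (h \<xi>) \<le> lambda_DR k p \<Omega> + \<epsilon>"
proof -
  have ne: "Sigma_DR k p \<Omega> \<noteq> {}" unfolding Sigma_DR_eq using assms(3) by blast
  note bdd_below_max_energy[OF assms(1,2), of k]
  moreover have "(INF A\<in>Sigma_DR k p \<Omega>. GREATEST c. c \<in> energy p \<Omega> ` A) < lambda_DR k p \<Omega> + \<epsilon>"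
    using assms(4) by (simp add: lambda_DR_def)
  ultimately obtain A where A: "A \<in> Sigma_DR k p \<Omega>" "(GREATEST c. c \<in> energy p \<Omega> ` A) < lambda_DR k p \<Omega> + \<epsilon>"
    using cINF_less_iff[OF ne] by blast
  then obtain h where h: "odd_sphere_map k p \<Omega> h" "A = h ` topspace (nsphere (k - 1))"
    unfolding Sigma_DR_eq by blast
  show ?thesis
  proof (rule that[OF h(1)])
    fix \<xi> assume "\<xi> \<in> topspace (nsphere (k - 1))"
    then have "energy p \<Omega> (h \<xi>) \<in> energy p \<Omega> ` h ` topspace (nsphere (k - 1))" by blast
    then show "energy p \<Omega> (h \<xi>) \<le> lambda_DR k p \<Omega> + \<epsilon>"
      using odd_sphere_map_max_energy(2)[OF assms(1,2) h(1)] A(2) h(2) by fastforce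
  qed
qed

text \<open>Division by the L^p norm projects onto the unit sphere; since energy and p-th power
  integral scale alike, the energy becomes a Rayleigh quotient.\<close>

lemma odd_sphere_map_normalize:
  assumes \<Omega>: "open \<Omega>" "bounded \<Omega>" and p: "p \<ge> 1"
    and f: "continuous_map (nsphere (k - 1)) (W0_topology p \<Omega>) f"
    and odd: "\<And>\<xi>. \<xi> \<in> topspace (nsphere (k - 1)) \<Longrightarrow> AE x in lebesgue_on \<Omega>. f (\<lambda>i. - \<xi> i) x = - f \<xi> x"
    and pos: "\<And>\<xi>. \<xi> \<in> topspace (nsphere (k - 1)) \<Longrightarrow> pint p \<Omega> (f \<xi>) > 0"
  obtains h where "odd_sphere_map k p \<Omega> h"
    "\<And>\<xi>. \<xi> \<in> topspace (nsphere (k - 1)) \<Longrightarrow> energy p \<Omega> (h \<xi>) = energy p \<Omega> (f \<xi>) / pint p \<Omega> (f \<xi>)"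
proof -
  let ?X = "nsphere (k - 1)"
  define a where "a \<xi> = pint p \<Omega> (f \<xi>) powr (- 1 / p)" for \<xi>
  define h where "h \<xi> x = a \<xi> * f \<xi> x" for \<xi> x
  have fW: "f \<xi> \<in> W0 p \<Omega>" if "\<xi> \<in> topspace ?X" for \<xi>
    by (rule continuous_map_W0_in[OF f that])
  have ap: "\<bar>a \<xi>\<bar> powr p = 1 / pint p \<Omega> (f \<xi>)" if "\<xi> \<in> topspace ?X" for \<xi>
  proof -
    have "\<bar>a \<xi>\<bar> powr p = pint p \<Omega> (f \<xi>) powr (- 1 / p * p)"
      unfolding a_def abs_of_nonneg[OF powr_ge_zero] by (rule powr_powr)
    also have "- 1 / p * p = - 1" using p by simp
    finally show ?thesis using pos[OF that] by (simp add: powr_minus_divide)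
  qed
  have h1: "pint p \<Omega> (h \<xi>) = 1" "energy p \<Omega> (h \<xi>) = energy p \<Omega> (f \<xi>) / pint p \<Omega> (f \<xi>)" "h \<xi> \<in> W0 p \<Omega>"
    if \<xi>: "\<xi> \<in> topspace ?X" for \<xi>
  proof -
    have eq: "h \<xi> = (\<lambda>x. a \<xi> * f \<xi> x)" by (simp add: h_def fun_eq_iff)
    show "pint p \<Omega> (h \<xi>) = 1"
      unfolding eq pint_cmult[OF p] ap[OF \<xi>] using pos[OF \<xi>] by simp
    show "energy p \<Omega> (h \<xi>) = energy p \<Omega> (f \<xi>) / pint p \<Omega> (f \<xi>)"
      unfolding eq W1p_cmult(3)[OF \<Omega>(1) p W0_W1p[OF fW[OF \<xi>]]] ap[OF \<xi>] by simp
    show "h \<xi> \<in> W0 p \<Omega>" unfolding eq by (rule W0_cmult[OF \<Omega> p fW[OF \<xi>]])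
  qed
  have at: "(a \<longlongrightarrow> a \<xi>) (atin ?X \<xi>)" if \<xi>: "\<xi> \<in> topspace ?X" for \<xi>
    unfolding a_def using continuous_map_W0_functionals(1)[OF \<Omega>(1) p f \<xi>] pos[OF \<xi>]
    by (intro tendsto_intros) auto
  have "continuous_map ?X (W0_topology p \<Omega>) h"
  proof (rule continuous_map_W0I[OF p h1(3)])
    fix \<xi> assume \<xi>: "\<xi> \<in> topspace ?X"
    \<comment> \<open>Bound for a(\<zeta>) f(\<zeta>) - a(\<xi>) f(\<xi>), split into a(\<zeta>)
      (f(\<zeta>) - f(\<xi>)) and (a(\<zeta>) - a(\<xi>)) f(\<xi>); \<open>W1p_add\<close> with
      \<open>d = 1\<close> gives the factors \<open>2 powr p\<close>.\<close>
    let ?B = "\<lambda>\<zeta>. 2 powr p * (\<bar>a \<zeta>\<bar> powr p * sob p \<Omega> (\<lambda>x. f \<zeta> x - f \<xi> x)) + 2 powr p * (\<bar>a \<zeta> - a \<xi>\<bar> powr p * sob p \<Omega> (f \<xi>))"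
    have "((\<lambda>\<zeta>. a \<zeta> - a \<xi>) \<longlongrightarrow> a \<xi> - a \<xi>) (atin ?X \<xi>)" by (intro tendsto_intros at[OF \<xi>])
    then have "((\<lambda>\<zeta>. \<bar>a \<zeta> - a \<xi>\<bar>) \<longlongrightarrow> 0) (atin ?X \<xi>)" by (simp add: tendsto_rabs_zero)
    then have A1: "((\<lambda>\<zeta>. \<bar>a \<zeta> - a \<xi>\<bar> powr p) \<longlongrightarrow> 0 powr p) (atin ?X \<xi>)"
      using p by (intro tendsto_powr' tendsto_const) auto
    have A2: "((\<lambda>\<zeta>. \<bar>a \<zeta>\<bar> powr p) \<longlongrightarrow> \<bar>a \<xi>\<bar> powr p) (atin ?X \<xi>)"
      using p by (intro tendsto_powr' tendsto_const tendsto_rabs at[OF \<xi>]) auto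
    have "(?B \<longlongrightarrow> 2 powr p * (\<bar>a \<xi>\<bar> powr p * 0) + 2 powr p * (0 powr p * sob p \<Omega> (f \<xi>))) (atin ?X \<xi>)"
      by (intro tendsto_add tendsto_mult tendsto_const A1 A2 continuous_map_W0D[OF \<Omega>(1) p f \<xi>])
    then have B: "(?B \<longlongrightarrow> 0) (atin ?X \<xi>)" by simp
    have le: "sob p \<Omega> (\<lambda>x. h \<zeta> x - h \<xi> x) \<le> ?B \<zeta>" if \<zeta>: "\<zeta> \<in> topspace ?X" for \<zeta>
    proof -
      have w: "(\<lambda>x. f \<zeta> x - f \<xi> x) \<in> W1p p \<Omega>"
        by (rule W1p_diff[OF \<Omega>(1) p fW[OF \<zeta>, THEN W0_W1p] fW[OF \<xi>, THEN W0_W1p]])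
      note 1 = W1p_cmult(1,2)[OF \<Omega>(1) p w, of "a \<zeta>"] and 2 = W1p_cmult(1,2)[OF \<Omega>(1) p fW[OF \<xi>, THEN W0_W1p], of "a \<zeta> - a \<xi>"]
      have "(\<lambda>x. h \<zeta> x - h \<xi> x) = (\<lambda>x. a \<zeta> * (f \<zeta> x - f \<xi> x) + (a \<zeta> - a \<xi>) * f \<xi> x)"
        by (simp add: h_def fun_eq_iff algebra_simps)
      then show ?thesis
        using W1p_add(4)[OF \<Omega>(1) p 1(1) 2(1) order_refl, of 1] 1(2) 2(2) by simp
    qed
    show "((\<lambda>\<zeta>. sob p \<Omega> (\<lambda>x. h \<zeta> x - h \<xi> x)) \<longlongrightarrow> 0) (atin ?X \<xi>)"
    proof (rule tendsto_sandwich[OF _ _ tendsto_const B])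
      show "eventually (\<lambda>\<zeta>. 0 \<le> sob p \<Omega> (\<lambda>x. h \<zeta> x - h \<xi> x)) (atin ?X \<xi>)" by (simp add: sob_nonneg)
      show "eventually (\<lambda>\<zeta>. sob p \<Omega> (\<lambda>x. h \<zeta> x - h \<xi> x) \<le> ?B \<zeta>) (atin ?X \<xi>)"
        by (rule eventually_atin_openin[OF openin_topspace \<xi> le])
    qed
  qed
  moreover have "h ` topspace ?X \<subseteq> unit_Lp_sphere p \<Omega>"
    using h1 unfolding unit_Lp_sphere_def pint_def by auto
  moreover have "AE x in lebesgue_on \<Omega>. h (\<lambda>i. - \<xi> i) x = - h \<xi> x" if \<xi>: "\<xi> \<in> topspace ?X" for \<xi>
  proof -
    have m: "- \<xi> \<in> topspace ?X" using \<xi> by (simp add: nsphere)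
    then have m': "(\<lambda>i. - \<xi> i) \<in> topspace ?X" by (simp add: fun_Compl_def)
    have meas: "f \<zeta> \<in> borel_measurable (lebesgue_on \<Omega>)" if "\<zeta> \<in> topspace ?X" for \<zeta>
      using W1pD(1)[OF \<Omega>(1) W0_W1p[OF fW[OF that]]] Lp_spaceD(1) by blast
    \<comment> \<open>Antipodal values are opposite only almost everywhere, which is enough for
      equal normalizing factors.\<close>
    have "pint p \<Omega> (f (\<lambda>i. - \<xi> i)) = pint p \<Omega> (\<lambda>x. (- 1) * f \<xi> x)"
      using meas[OF m'] meas[OF \<xi>] odd[OF \<xi>] by (intro pint_cong_AE) auto
    also have "\<dots> = pint p \<Omega> (f \<xi>)" unfolding pint_cmult[OF p] by simp
    finally have "a (\<lambda>i. - \<xi> i) = a \<xi>" by (simp add: a_def)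
    then show ?thesis using odd[OF \<xi>] by (auto simp: h_def elim: eventually_mono)
  qed
  ultimately have "odd_sphere_map k p \<Omega> h"
    unfolding odd_sphere_map_def continuous_map_in_subtopology by blast
  then show ?thesis using h1(2) that by blast
qed

lemma test_pint_pos:
  assumes \<Omega>: "open \<Omega>" "bounded \<Omega>" and p: "p \<ge> 1" and \<phi>: "\<phi> \<in> test_functions \<Omega>" and "\<phi> y \<noteq> 0"
  shows "pint p \<Omega> \<phi> > 0"
proof (rule ccontr)
  assume "\<not> pint p \<Omega> \<phi> > 0"
  then have 0: "pint p \<Omega> \<phi> = 0" using pint_nonneg[of p \<Omega> \<phi>] by linarith
  have "integrable (lebesgue_on \<Omega>) (\<lambda>x. norm (\<phi> x) powr p)"
    using Lp_spaceD(2)[OF W1pD(1)[OF \<Omega>(1) test_W1p(1)[OF \<Omega> p \<phi>]]] .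
  then have "AE x in lebesgue_on \<Omega>. norm (\<phi> x) powr p = 0"
    using 0 unfolding pint_def by (subst (asm) integral_nonneg_eq_0_iff_AE) auto
  then have "AE x in lebesgue. x \<in> \<Omega> \<longrightarrow> \<phi> x = 0"
    using \<Omega>(1) by (subst (asm) AE_restrict_space_iff) (auto simp: open_sets_lebesgue)
  then have "AE x in lebesgue. x \<notin> {x. \<phi> x \<noteq> 0}"
  proof eventually_elim
    case (elim x)
    then show ?case using test_zero_outside(1)[OF \<phi>, of x] by blast
  qed
  moreover have op: "open {x. \<phi> x \<noteq> 0}"
    using continuous_on_test(1)[OF \<phi>] by (intro open_Collect_neq) auto
  ultimately have "negligible {x. \<phi> x \<noteq> 0}"
    unfolding negligible_iff_null_sets using AE_iff_null_sets[OF open_sets_lebesgue[OF op]] by blast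
  then show False using open_not_negligible[OF op] assms(5) by blast
qed

subsection \<open>Averaging in \<open>L\<^sup>p\<close>\<close>

text \<open>Jensen's inequality for a kernel of mass at most \<open>A\<close>: integrate the tangent
  inequality at \<open>s = ?I / A\<close> against \<open>K\<close>. The factor
  \<open>A powr (p - 1)\<close> is near 1 when \<open>A\<close> is.\<close>

lemma jensen_powr:
  fixes K g :: "'z \<Rightarrow> real"
  assumes K: "integrable M K" "\<And>z. K z \<ge> 0" "(\<integral>z. K z \<partial>M) \<le> A" "A > 0" and g: "\<And>z. g z \<ge> 0"
    and int: "integrable M (\<lambda>z. K z * g z)" "integrable M (\<lambda>z. K z * g z powr p)" and p: "p \<ge> 1"
  shows "(\<integral>z. K z * g z \<partial>M) powr p \<le> A powr (p - 1) * (\<integral>z. K z * g z powr p \<partial>M)"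
proof -
  let ?I = "\<integral>z. K z * g z \<partial>M"
  let ?J = "\<integral>z. K z * g z powr p \<partial>M"
  have I: "?I \<ge> 0" using K(2) g by (intro Bochner_Integration.integral_nonneg mult_nonneg_nonneg)
  have J: "?J \<ge> 0" using K(2) by (intro Bochner_Integration.integral_nonneg mult_nonneg_nonneg) auto
  show ?thesis
  proof (cases "?I = 0")
    case True
    then show ?thesis using J by simp
  next
    case False
    define s where "s = ?I / A"
    have s: "s > 0" using I False K(4) by (simp add: s_def)
    have "(\<integral>z. K z * (s powr p + p * s powr (p - 1) * (g z - s)) \<partial>M) \<le> ?J"
    proof (rule integral_mono)
      have "integrable M (\<lambda>z. (s powr p - p * s powr (p - 1) * s) * K z + (p * s powr (p - 1)) * (K z * g z))"
        using K(1) int(1) by simp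
      then show "integrable M (\<lambda>z. K z * (s powr p + p * s powr (p - 1) * (g z - s)))"
        by (simp add: algebra_simps)
      show "K z * (s powr p + p * s powr (p - 1) * (g z - s)) \<le> K z * g z powr p" for z
        using powr_tangent[OF s g p] K(2) by (intro mult_left_mono)
    qed (rule int(2))
    also have "(\<integral>z. K z * (s powr p + p * s powr (p - 1) * (g z - s)) \<partial>M) =
        (\<integral>z. (s powr p - p * s powr (p - 1) * s) * K z + (p * s powr (p - 1)) * (K z * g z) \<partial>M)"
      by (rule Bochner_Integration.integral_cong) (simp_all add: algebra_simps)
    also have "\<dots> = (s powr p - p * s powr (p - 1) * s) * (\<integral>z. K z \<partial>M) + (p * s powr (p - 1)) * ?I"
      using K(1) int(1) by simp
    finally have le: "(s powr p - p * s powr (p - 1) * s) * (\<integral>z. K z \<partial>M) + (p * s powr (p - 1)) * ?I \<le> ?J" .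
    have sp: "s powr (p - 1) * s = s powr p" using s by (simp add: powr_diff)
    have e1: "s powr p - p * s powr (p - 1) * s = (1 - p) * s powr p"
      using sp by (simp add: mult.assoc left_diff_distrib)
    have e2: "(p * s powr (p - 1)) * ?I = p * s powr p * A"
    proof -
      have "?I = s * A" using K(4) by (simp add: s_def)
      then have "(p * s powr (p - 1)) * ?I = p * (s powr (p - 1) * s) * A" by simp
      then show ?thesis unfolding sp .
    qed
    \<comment> \<open>As \<open>1 - p\<close> is not positive, replacing the mass by the larger
      \<open>A\<close> lowers this term.\<close>
    have "(1 - p) * s powr p * (\<integral>z. K z \<partial>M) \<ge> (1 - p) * s powr p * A"
      using K(3) p by (intro mult_left_mono_neg mult_nonpos_nonneg) auto
    then have "(1 - p) * s powr p * A + p * s powr p * A \<le> ?J" using le unfolding e1 e2 by linarith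
    then have "s powr p * A \<le> ?J" by (simp add: algebra_simps)
    then have "A powr (p - 1) * (s powr p * A) \<le> A powr (p - 1) * ?J" by (intro mult_left_mono) auto
    moreover have "A powr (p - 1) * (s powr p * A) = ?I powr p"
    proof -
      have "A powr (p - 1) * A = A powr p" using K(4) by (simp add: powr_diff)
      moreover have "s powr p * A powr p = ?I powr p" using K(4) I by (simp add: s_def powr_divide)
      moreover have "A powr (p - 1) * (s powr p * A) = s powr p * (A powr (p - 1) * A)" by (simp only: mult_ac)
      ultimately show ?thesis by simp
    qed
    ultimately show ?thesis by simp
  qed
qed

lemma Lp_space_nn_integral:
  fixes f :: "'a::euclidean_space \<Rightarrow> real"
  assumes "open \<Omega>" "f \<in> borel_measurable borel" "(\<integral>\<^sup>+x. ennreal (norm (f x) powr p) \<partial>lborel) \<le> ennreal c" "c \<ge> 0"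
  shows "f \<in> Lp_space p \<Omega>" "pint p \<Omega> f \<le> c"
proof -
  have m: "(\<lambda>x. norm (f x) powr p) \<in> borel_measurable borel" using assms(2) by measurable
  have i: "integrable lborel (\<lambda>x. norm (f x) powr p)"
    using assms(3) m by (intro integrableI_bounded) (auto intro: le_less_trans)
  let ?g = "\<lambda>x. indicator \<Omega> x * norm (f x) powr p"
  have ig: "integrable lborel ?g"
    using integrable_mult_indicator[of \<Omega> lborel, OF _ i] assms(1) by simp
  have mg: "?g \<in> borel_measurable borel" using assms(1) m by (intro borel_measurable_times borel_measurable_indicator) auto
  have on: "\<Omega> \<inter> space lebesgue \<in> sets lebesgue" using assms(1) by (simp add: open_sets_lebesgue)
  have "integrable (lebesgue_on \<Omega>) (\<lambda>x. norm (f x) powr p)"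
    unfolding integrable_restrict_space[OF on] using ig mg by (simp add: integrable_completion)
  then show "f \<in> Lp_space p \<Omega>"
    unfolding Lp_space_def using measurable_lebesgue_on_borel[OF assms(2)] by simp
  have "pint p \<Omega> f = (\<integral>x. ?g x \<partial>lborel)"
    unfolding pint_def integral_restrict_space[OF on] using mg by (simp add: integral_completion)
  also have "\<dots> \<le> (\<integral>x. norm (f x) powr p \<partial>lborel)"
    by (rule integral_mono[OF ig i]) (auto simp: indicator_def)
  also have "\<dots> \<le> c"
    using assms(3,4) nn_integral_eq_integral[OF i] by (simp add: ennreal_le_iff)
  finally show "pint p \<Omega> f \<le> c" .
qed

lemma test_bounds:
  fixes \<phi> :: "'a::euclidean_space \<Rightarrow> real"
  assumes "\<phi> \<in> test_functions \<Omega>"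
  obtains B where "B > 0" "\<And>x. \<bar>\<phi> x\<bar> \<le> B" "\<And>x. norm (grad \<phi> x) \<le> B"
proof -
  obtain K where K: "compact K" "K \<subseteq> \<Omega>" "\<And>x. x \<notin> K \<Longrightarrow> \<phi> x = 0" using test_functionsE[OF assms] by metis
  have G: "grad \<phi> x = 0" if "x \<notin> K" for x
    by (rule grad_outside_support(1)[OF K(1) _ that]) (rule K(3))
  obtain B1 where B1: "B1 > 0" "\<And>x. norm (\<phi> x) \<le> B1"
    using bounded_compact_support[OF continuous_on_test(1)[OF assms] K(1,3)] by blast
  obtain B2 where B2: "B2 > 0" "\<And>x. norm (grad \<phi> x) \<le> B2"
    using bounded_compact_support[OF continuous_on_test(2)[OF assms] K(1) G] by blast
  show ?thesis
  proof (rule that[of "max B1 B2"])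
    show "max B1 B2 > 0" using B1(1) by simp
    show "\<bar>\<phi> x\<bar> \<le> max B1 B2" "norm (grad \<phi> x) \<le> max B1 B2" for x
      using B1(2)[of x] B2(2)[of x] by auto
  qed
qed

lemma test_measurable:
  assumes "\<phi> \<in> test_functions \<Omega>"
  shows "\<phi> \<in> borel_measurable borel" "grad \<phi> \<in> borel_measurable borel"
  using continuous_on_test[OF assms] by (auto intro: borel_measurable_continuous_onI)

lemma pint_test:
  assumes "open \<Omega>" "p \<ge> 1" "\<phi> \<in> test_functions \<Omega>"
  shows "(\<integral>\<^sup>+x. ennreal (norm (\<phi> x) powr p) \<partial>lborel) = ennreal (pint p \<Omega> \<phi>)"
    and "(\<integral>\<^sup>+x. ennreal (norm (grad \<phi> x) powr p) \<partial>lborel) = ennreal (pint p \<Omega> (grad \<phi>))"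
proof -
  obtain K where K: "compact K" "K \<subseteq> \<Omega>" "\<And>x. x \<notin> K \<Longrightarrow> \<phi> x = 0" using test_functionsE[OF assms(3)] by metis
  have G: "grad \<phi> x = 0" if "x \<notin> K" for x
    by (rule grad_outside_support(1)[OF K(1) _ that]) (rule K(3))
  have *: "(\<integral>\<^sup>+x. ennreal (norm (f x) powr p) \<partial>lborel) = ennreal (pint p \<Omega> f)"
    if f: "continuous_on UNIV f" "\<And>x. x \<notin> K \<Longrightarrow> f x = 0" for f :: "'a \<Rightarrow> 'c::euclidean_space"
  proof -
    have c: "continuous_on UNIV (\<lambda>x. norm (f x) powr p)"
      using f(1) assms(2) by (intro continuous_on_powr' continuous_intros) auto
    have i: "integrable lborel (\<lambda>x. norm (f x) powr p)"
      using f(2) by (intro integrable_compact_support[OF c K(1)]) simp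
    have "pint p \<Omega> f = (\<integral>x. norm (f x) powr p \<partial>lborel)"
      unfolding pint_def
      by (rule lebesgue_on_eq_lborel(1)[OF assms(1) borel_measurable_continuous_onI[OF c]]) (use f(2) K(2) in auto)
    then show ?thesis using nn_integral_eq_integral[OF i] by simp
  qed
  show "(\<integral>\<^sup>+x. ennreal (norm (\<phi> x) powr p) \<partial>lborel) = ennreal (pint p \<Omega> \<phi>)"
    using *[OF continuous_on_test(1)[OF assms(3)] K(3)] .
  show "(\<integral>\<^sup>+x. ennreal (norm (grad \<phi> x) powr p) \<partial>lborel) = ennreal (pint p \<Omega> (grad \<phi>))"
    using *[OF continuous_on_test(2)[OF assms(3)] G] .
qed

text \<open>The difference is the integral of a directional derivative along the segment from
  \<open>x\<close> to \<open>x - z\<close>. Jensen moves the power inside, and Tonelli with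
  translation invariance removes the dependence on the position along the segment.\<close>

lemma test_translation:
  fixes \<phi> :: "'a::euclidean_space \<Rightarrow> real"
  assumes \<Omega>: "open \<Omega>" and p: "p \<ge> 1" and \<phi>: "\<phi> \<in> test_functions \<Omega>" and z: "norm z \<le> t"
  shows "(\<integral>\<^sup>+x. ennreal (\<bar>\<phi> (x - z) - \<phi> x\<bar> powr p) \<partial>lborel) \<le> ennreal (t powr p * pint p \<Omega> (grad \<phi>))"
proof -
  note [measurable] = test_measurable[OF \<phi>]
  have t: "t \<ge> 0" using z norm_ge_zero order_trans by blast
  obtain B where B: "B > 0" "\<And>x. norm (grad \<phi> x) \<le> B" using test_bounds[OF \<phi>] by metis
  let ?K = "\<lambda>s::real. indicator {0..1} s :: real"
  have K: "integrable lborel ?K" by (intro integrable_real_indicator) auto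
  have i1: "integrable lborel (\<lambda>s. ?K s * norm (grad \<phi> (x - s *\<^sub>R z)))" for x
    using integrable_bounded_scaleR[OF K, of "\<lambda>s. norm (grad \<phi> (x - s *\<^sub>R z))" B] B(2) by simp
  have i2: "integrable lborel (\<lambda>s. ?K s * norm (grad \<phi> (x - s *\<^sub>R z)) powr p)" for x
  proof -
    have "norm (norm (grad \<phi> (x - s *\<^sub>R z)) powr p) \<le> B powr p" for s
      using B(2) p by (simp add: powr_mono2)
    then show ?thesis
      using integrable_bounded_scaleR[OF K, of "\<lambda>s. norm (grad \<phi> (x - s *\<^sub>R z)) powr p" "B powr p"] by simp
  qed
  have pw: "\<bar>\<phi> (x - z) - \<phi> x\<bar> powr p \<le> t powr p * (\<integral>s. ?K s * norm (grad \<phi> (x - s *\<^sub>R z)) powr p \<partial>lborel)" for x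
  proof -
    have D: "((\<lambda>s. \<phi> (x - s *\<^sub>R z)) has_real_derivative grad \<phi> (x - s *\<^sub>R z) \<bullet> (- z)) (at s)" for s
    proof -
      have "((\<lambda>s. x - s *\<^sub>R z) has_derivative (\<lambda>h. - (h *\<^sub>R z))) (at s)"
        by (auto intro!: derivative_eq_intros)
      from has_derivative_compose[OF this, of \<phi>, OF C_differentiable_Suc_derivative[OF test_functions_smooth[OF \<phi>]]]
      show ?thesis unfolding has_field_derivative_def by (rule has_derivative_eq_rhs) (auto simp: fun_eq_iff)
    qed
    have cont: "isCont (\<lambda>s. grad \<phi> (x - s *\<^sub>R z) \<bullet> (- z)) s" for s
    proof -
      have "continuous_on UNIV (\<lambda>s. grad \<phi> (x - s *\<^sub>R z) \<bullet> (- z))"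
        by (intro continuous_intros continuous_on_compose2[OF continuous_on_test(2)[OF \<phi>]]) auto
      then show ?thesis by (simp add: continuous_on_eq_continuous_at)
    qed
    have "(\<integral>s. (grad \<phi> (x - s *\<^sub>R z) \<bullet> (- z)) * ?K s \<partial>lborel) = \<phi> (x - 1 *\<^sub>R z) - \<phi> (x - 0 *\<^sub>R z)"
      by (rule integral_FTC_Icc_real) (use D cont in auto)
    then have "\<bar>\<phi> (x - z) - \<phi> x\<bar> = norm (\<integral>s. (grad \<phi> (x - s *\<^sub>R z) \<bullet> (- z)) * ?K s \<partial>lborel)" by simp
    also have "\<dots> \<le> (\<integral>s. norm ((grad \<phi> (x - s *\<^sub>R z) \<bullet> (- z)) * ?K s) \<partial>lborel)"
      by (rule integral_norm_bound)
    also have "\<dots> \<le> (\<integral>s. t * (?K s * norm (grad \<phi> (x - s *\<^sub>R z))) \<partial>lborel)"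
    proof (rule integral_mono')
      show "integrable lborel (\<lambda>s. t * (?K s * norm (grad \<phi> (x - s *\<^sub>R z))))" using i1 by simp
      fix s
      have "norm (grad \<phi> (x - s *\<^sub>R z) \<bullet> (- z)) \<le> norm (grad \<phi> (x - s *\<^sub>R z)) * norm (- z)"
        unfolding real_norm_def by (rule Cauchy_Schwarz_ineq2)
      also have "\<dots> \<le> norm (grad \<phi> (x - s *\<^sub>R z)) * t" using z by (intro mult_left_mono) auto
      finally show "norm ((grad \<phi> (x - s *\<^sub>R z) \<bullet> (- z)) * ?K s) \<le> t * (?K s * norm (grad \<phi> (x - s *\<^sub>R z)))"
        by (simp add: indicator_def mult.commute)
      show "0 \<le> t * (?K s * norm (grad \<phi> (x - s *\<^sub>R z)))" using t by simp
    qed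
    also have "\<dots> = t * (\<integral>s. ?K s * norm (grad \<phi> (x - s *\<^sub>R z)) \<partial>lborel)" by simp
    finally have "\<bar>\<phi> (x - z) - \<phi> x\<bar> powr p \<le> (t * (\<integral>s. ?K s * norm (grad \<phi> (x - s *\<^sub>R z)) \<partial>lborel)) powr p"
      using p by (intro powr_mono2) auto
    also have "\<dots> = t powr p * (\<integral>s. ?K s * norm (grad \<phi> (x - s *\<^sub>R z)) \<partial>lborel) powr p"
      by (rule powr_mult; use t in \<open>auto intro!: Bochner_Integration.integral_nonneg\<close>)
    also have "\<dots> \<le> t powr p * (1 powr (p - 1) * (\<integral>s. ?K s * norm (grad \<phi> (x - s *\<^sub>R z)) powr p \<partial>lborel))"
    proof (rule mult_left_mono)
      show "(\<integral>s. ?K s * norm (grad \<phi> (x - s *\<^sub>R z)) \<partial>lborel) powr p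
          \<le> 1 powr (p - 1) * (\<integral>s. ?K s * norm (grad \<phi> (x - s *\<^sub>R z)) powr p \<partial>lborel)"
        by (rule jensen_powr[OF K _ _ _ _ i1 i2 p]) auto
    qed simp
    finally show ?thesis by simp
  qed
  have "(\<integral>\<^sup>+x. ennreal (\<bar>\<phi> (x - z) - \<phi> x\<bar> powr p) \<partial>lborel)
      \<le> (\<integral>\<^sup>+x. ennreal (t powr p) * (\<integral>\<^sup>+s. ennreal (?K s * norm (grad \<phi> (x - s *\<^sub>R z)) powr p) \<partial>lborel) \<partial>lborel)"
  proof (rule nn_integral_mono)
    fix x
    have "(\<integral>\<^sup>+s. ennreal (?K s * norm (grad \<phi> (x - s *\<^sub>R z)) powr p) \<partial>lborel)
        = ennreal (\<integral>s. ?K s * norm (grad \<phi> (x - s *\<^sub>R z)) powr p \<partial>lborel)"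
      by (rule nn_integral_eq_integral[OF i2]) auto
    then show "ennreal (\<bar>\<phi> (x - z) - \<phi> x\<bar> powr p)
        \<le> ennreal (t powr p) * (\<integral>\<^sup>+s. ennreal (?K s * norm (grad \<phi> (x - s *\<^sub>R z)) powr p) \<partial>lborel)"
      using pw[of x] by (simp add: ennreal_mult'[symmetric] ennreal_leI)
  qed
  also have "\<dots> = ennreal (t powr p) *
      (\<integral>\<^sup>+x. (\<integral>\<^sup>+s. ennreal (?K s * norm (grad \<phi> (x - s *\<^sub>R z)) powr p) \<partial>lborel) \<partial>lborel)"
    by (rule nn_integral_cmult) measurable
  also have "(\<integral>\<^sup>+x. (\<integral>\<^sup>+s. ennreal (?K s * norm (grad \<phi> (x - s *\<^sub>R z)) powr p) \<partial>lborel) \<partial>lborel)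
      = (\<integral>\<^sup>+s. (\<integral>\<^sup>+x. ennreal (?K s * norm (grad \<phi> (x - s *\<^sub>R z)) powr p) \<partial>lborel) \<partial>lborel)"
    by (rule lborel_pair.Fubini') measurable
  also have "\<dots> = (\<integral>\<^sup>+s. ennreal (?K s) * ennreal (pint p \<Omega> (grad \<phi>)) \<partial>lborel)"
  proof (rule nn_integral_cong)
    fix s
    have "(\<integral>\<^sup>+x. ennreal (?K s * norm (grad \<phi> (x - s *\<^sub>R z)) powr p) \<partial>lborel)
        = ennreal (?K s) * (\<integral>\<^sup>+x. ennreal (norm (grad \<phi> (x - s *\<^sub>R z)) powr p) \<partial>lborel)"
      by (subst nn_integral_cmult[symmetric]) (measurable, simp add: ennreal_mult')
    also have "(\<integral>\<^sup>+x. ennreal (norm (grad \<phi> (x - s *\<^sub>R z)) powr p) \<partial>lborel)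
        = (\<integral>\<^sup>+x. ennreal (norm (grad \<phi> x) powr p) \<partial>lborel)"
      using lborel_nn_integral_shift[of "\<lambda>x. ennreal (norm (grad \<phi> x) powr p)" "- (s *\<^sub>R z)"] by simp
    finally show "(\<integral>\<^sup>+x. ennreal (?K s * norm (grad \<phi> (x - s *\<^sub>R z)) powr p) \<partial>lborel)
        = ennreal (?K s) * ennreal (pint p \<Omega> (grad \<phi>))"
      unfolding pint_test(2)[OF \<Omega> p \<phi>] .
  qed
  also have "\<dots> = ennreal (pint p \<Omega> (grad \<phi>))"
    by (subst nn_integral_multc) (auto simp: ennreal_indicator)
  finally show ?thesis by (simp add: ennreal_mult' pint_nonneg)
qed

subsection \<open>Smoothing by inward shifts\<close>

text \<open>
  \<open>\<theta>\<close> is a partition of unity on \<open>\<Omega>\<close>, and \<open>\<rho> i\<close> is a mollifier concentrated near a short vector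
  which points into \<open>\<Omega>\<close> along the support of \<open>\<theta> i\<close>; so each piece is shifted inwards and mollified.
\<close>

locale smoothing =
  fixes \<Omega> :: "'a::euclidean_space set" and I :: "'i set" and \<theta> \<rho> :: "'i \<Rightarrow> 'a \<Rightarrow> real" and t \<omega> B s :: real
  assumes \<Omega>: "open \<Omega>" "bounded \<Omega>" and I: "finite I" and t: "t > 0" and \<omega>: "\<omega> \<ge> 0" and B: "B \<ge> 0" and s: "s > 0"
    and \<theta>_C1: "\<And>i. i \<in> I \<Longrightarrow> C_differentiable (Suc 0) (\<theta> i)"
    and \<theta>_nonneg: "\<And>i x. i \<in> I \<Longrightarrow> \<theta> i x \<ge> 0"
    and \<theta>_sum_le: "\<And>x. (\<Sum>i\<in>I. \<theta> i x) \<le> 1"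
    and \<theta>_sum: "\<And>x. x \<in> \<Omega> \<Longrightarrow> (\<Sum>i\<in>I. \<theta> i x) = 1"
    and \<theta>_grad: "\<And>i x. i \<in> I \<Longrightarrow> norm (grad (\<theta> i) x) \<le> B"
    and \<theta>_osc: "\<And>i x z. i \<in> I \<Longrightarrow> norm z \<le> t \<Longrightarrow> \<bar>\<theta> i (x - z) - \<theta> i x\<bar> \<le> \<omega>"
      "\<And>i x z. i \<in> I \<Longrightarrow> norm z \<le> t \<Longrightarrow> norm (grad (\<theta> i) (x - z) - grad (\<theta> i) x) \<le> \<omega>"
    and \<rho>_smooth: "\<And>i m. i \<in> I \<Longrightarrow> C_differentiable m (\<rho> i)"
    and \<rho>_nonneg: "\<And>i x. i \<in> I \<Longrightarrow> \<rho> i x \<ge> 0"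
    and \<rho>_support: "\<And>i x. i \<in> I \<Longrightarrow> \<rho> i x \<noteq> 0 \<Longrightarrow> norm x \<le> t"
    and \<rho>_integral: "\<And>i. i \<in> I \<Longrightarrow> (\<integral>x. \<rho> i x \<partial>lborel) = 1"
    and inward: "\<And>i y z. i \<in> I \<Longrightarrow> y \<in> \<Omega> \<Longrightarrow> \<theta> i y \<noteq> 0 \<Longrightarrow> \<rho> i z \<noteq> 0 \<Longrightarrow> ball (y + z) s \<subseteq> \<Omega>"
begin

text \<open>A sum of convolutions of the zero extensions of \<theta>_i u: integrating over
  \<open>lebesgue_on \<Omega>\<close> discards the values of \<open>u\<close> elsewhere.\<close>

definition T :: "('a \<Rightarrow> real) \<Rightarrow> 'a \<Rightarrow> real" where
  "T u x = (\<Sum>i\<in>I. \<integral>y. \<rho> i (x - y) * (\<theta> i y * u y) \<partial>lebesgue_on \<Omega>)"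

lemma \<rho>_zero: "i \<in> I \<Longrightarrow> x \<notin> cball 0 t \<Longrightarrow> \<rho> i x = 0"
  using \<rho>_support[of i x] by auto

lemma \<theta>_le_1: "i \<in> I \<Longrightarrow> \<theta> i x \<le> 1"
  using member_le_sum[of i I "\<lambda>i. \<theta> i x"] \<theta>_nonneg \<theta>_sum_le[of x] I by auto

lemma continuous_\<theta>: "i \<in> I \<Longrightarrow> continuous_on UNIV (\<theta> i)" "i \<in> I \<Longrightarrow> continuous_on UNIV (grad (\<theta> i))"
  using C_differentiable_imp_continuous[OF \<theta>_C1] continuous_on_grad[OF \<theta>_C1] by auto

lemma continuous_\<rho>: "i \<in> I \<Longrightarrow> continuous_on UNIV (\<rho> i)" "i \<in> I \<Longrightarrow> continuous_on UNIV (grad (\<rho> i))"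
  using C_differentiable_imp_continuous[OF \<rho>_smooth] continuous_on_grad[OF \<rho>_smooth] by auto

lemma measurable_\<rho>\<theta>:
  assumes "i \<in> I"
  shows "\<rho> i \<in> borel_measurable borel" "\<theta> i \<in> borel_measurable borel" "grad (\<theta> i) \<in> borel_measurable borel"
  using continuous_\<rho>[OF assms] continuous_\<theta>[OF assms] by (auto intro: borel_measurable_continuous_onI)

lemma integrable_\<rho>: "i \<in> I \<Longrightarrow> integrable lborel (\<rho> i)"
  using integrable_compact_support[OF continuous_\<rho>(1) compact_cball \<rho>_zero] .

lemma \<rho>_bounds:
  obtains C where "C > 0" "\<And>i x. i \<in> I \<Longrightarrow> norm (\<rho> i x) \<le> C" "\<And>i x. i \<in> I \<Longrightarrow> norm (grad (\<rho> i) x) \<le> C"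
proof -
  have "\<exists>C>0. \<forall>x. norm (\<rho> i x) \<le> C \<and> norm (grad (\<rho> i) x) \<le> C" if i: "i \<in> I" for i
  proof -
    have G: "grad (\<rho> i) x = 0" if "x \<notin> cball 0 t" for x
      by (rule grad_outside_support(1)[OF compact_cball _ that]) (rule \<rho>_zero[OF i])
    obtain B1 where B1: "B1 > 0" "\<And>x. norm (\<rho> i x) \<le> B1"
      using bounded_compact_support[OF continuous_\<rho>(1)[OF i] compact_cball \<rho>_zero[OF i]] by blast
    obtain B2 where B2: "B2 > 0" "\<And>x. norm (grad (\<rho> i) x) \<le> B2"
      using bounded_compact_support[OF continuous_\<rho>(2)[OF i] compact_cball G] by blast
    show ?thesis using B1 B2 by (intro exI[of _ "B1 + B2"]) (auto intro: add_increasing add_increasing2 less_imp_le)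
  qed
  then obtain C where C: "\<And>i. i \<in> I \<Longrightarrow> C i > 0 \<and> (\<forall>x. norm (\<rho> i x) \<le> C i \<and> norm (grad (\<rho> i) x) \<le> C i)"
    by metis
  have le: "C i \<le> (\<Sum>i\<in>I. C i) + 1" if "i \<in> I" for i
  proof -
    have "C i \<le> (\<Sum>i\<in>I. C i)"
      by (rule member_le_sum[OF that _ I]) (use C less_imp_le in blast)
    then show ?thesis by linarith
  qed
  show ?thesis
  proof (rule that)
    have "(\<Sum>i\<in>I. C i) \<ge> 0" using C less_imp_le by (intro sum_nonneg) blast
    then show "(\<Sum>i\<in>I. C i) + 1 > 0" by linarith
    show "norm (\<rho> i x) \<le> (\<Sum>i\<in>I. C i) + 1" "norm (grad (\<rho> i) x) \<le> (\<Sum>i\<in>I. C i) + 1" if "i \<in> I" for i x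
      using C[OF that] le[OF that] order_trans by blast+
  qed
qed

lemma integrable_\<theta>_mult:
  assumes "integrable (lebesgue_on \<Omega>) u" "i \<in> I"
  shows "integrable (lebesgue_on \<Omega>) (\<lambda>y. \<theta> i y * u y)"
proof -
  have "norm (\<theta> i y) \<le> 1" for y using \<theta>_nonneg[OF assms(2), of y] \<theta>_le_1[OF assms(2), of y] by simp
  then have "integrable (lebesgue_on \<Omega>) (\<lambda>y. u y *\<^sub>R \<theta> i y)"
    by (intro integrable_bounded_scaleR[OF assms(1)] measurable_lebesgue_on_borel measurable_\<rho>\<theta> assms(2))
  then show ?thesis by (simp add: mult.commute)
qed

section \<open>Smoothness, support and bounds of the smoothed function\<close>

lemma T_smooth:
  assumes "integrable (lebesgue_on \<Omega>) u"
  shows "C_differentiable m (T u)"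
  unfolding T_def[abs_def]
  by (intro C_differentiable_sum C_differentiable_convolution[OF \<rho>_smooth compact_cball \<rho>_zero] integrable_\<theta>_mult assms)

lemma grad_T:
  assumes "integrable (lebesgue_on \<Omega>) u"
  shows "grad (T u) x = (\<Sum>i\<in>I. \<integral>y. (\<theta> i y * u y) *\<^sub>R grad (\<rho> i) (x - y) \<partial>lebesgue_on \<Omega>)"
proof -
  have "grad (T u) x = (\<Sum>i\<in>I. grad (\<lambda>x. \<integral>y. \<rho> i (x - y) * (\<theta> i y * u y) \<partial>lebesgue_on \<Omega>) x)"
    unfolding T_def[abs_def]
    by (intro grad_sum C_differentiable_convolution[OF \<rho>_smooth compact_cball \<rho>_zero] integrable_\<theta>_mult assms)
  also have "\<dots> = (\<Sum>i\<in>I. \<integral>y. (\<theta> i y * u y) *\<^sub>R grad (\<rho> i) (x - y) \<partial>lebesgue_on \<Omega>)"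
    by (intro sum.cong refl grad_eqI has_derivative_convolution[OF \<rho>_smooth compact_cball \<rho>_zero] integrable_\<theta>_mult assms)
  finally show ?thesis .
qed

lemma T_zero:
  assumes "\<not> ball x s \<subseteq> \<Omega>"
  shows "T u x = 0"
proof -
  have "\<rho> i (x - y) * (\<theta> i y * u y) = 0" if "i \<in> I" "y \<in> \<Omega>" for i y
    using inward[OF that, of "x - y"] assms by auto
  then have "(\<integral>y. \<rho> i (x - y) * (\<theta> i y * u y) \<partial>lebesgue_on \<Omega>) = (\<integral>y. 0 \<partial>lebesgue_on \<Omega>)" if "i \<in> I" for i
    using that by (intro Bochner_Integration.integral_cong) (simp_all add: space_restrict_space)
  then show ?thesis by (simp add: T_def)
qed

text \<open>The points whose \<open>s\<close>-ball lies in \<Omega> form a compact set that does not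
  depend on \<open>u\<close>; by \<open>inward\<close>, the support is contained in it however
  \<open>u\<close> behaves at the boundary.\<close>

lemma T_test:
  assumes "integrable (lebesgue_on \<Omega>) u"
  shows "T u \<in> test_functions \<Omega>"
proof (rule test_functionsI[of _ "{x. ball x s \<subseteq> \<Omega>}"])
  show "{x. ball x s \<subseteq> \<Omega>} \<subseteq> \<Omega>" using s by auto
  then have "bounded {x. ball x s \<subseteq> \<Omega>}" using \<Omega>(2) bounded_subset by blast
  moreover have "closed {x. ball x s \<subseteq> \<Omega>}"
    unfolding closed_sequential_limits
  proof (intro allI impI, elim conjE)
    fix f l assume f: "\<forall>n. f n \<in> {x. ball x s \<subseteq> \<Omega>}" "f \<longlonglongrightarrow> l"
    have "y \<in> \<Omega>" if "y \<in> ball l s" for y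
    proof -
      have "(\<lambda>n. dist (f n) y) \<longlonglongrightarrow> dist l y" using f(2) by (intro tendsto_intros)
      then have "eventually (\<lambda>n. dist (f n) y < s) sequentially" using that by (intro order_tendstoD(2)) auto
      then obtain n where "dist (f n) y < s" using eventually_happens'[OF sequentially_bot] by blast
      then show ?thesis using f(1) by (auto simp: subset_iff)
    qed
    then show "l \<in> {x. ball x s \<subseteq> \<Omega>}" by blast
  qed
  ultimately show "compact {x. ball x s \<subseteq> \<Omega>}" by (simp add: compact_eq_bounded_closed)
  show "C_differentiable m (T u)" for m by (rule T_smooth[OF assms])
  show "T u x = 0" if "x \<notin> {x. ball x s \<subseteq> \<Omega>}" for x using that by (intro T_zero) simp
qed

text \<open>The smooth kernels absorb the derivative, so the L^1 norm of \<open>u\<close> alone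
  controls the result. This is what makes \<open>T\<close> continuous from any exponent to any
  other.\<close>

lemma T_bounds:
  obtains C where "C > 0"
    "\<And>u x. integrable (lebesgue_on \<Omega>) u \<Longrightarrow> \<bar>T u x\<bar> \<le> C * (\<integral>y. \<bar>u y\<bar> \<partial>lebesgue_on \<Omega>)"
    "\<And>u x. integrable (lebesgue_on \<Omega>) u \<Longrightarrow> norm (grad (T u) x) \<le> C * (\<integral>y. \<bar>u y\<bar> \<partial>lebesgue_on \<Omega>)"
proof -
  obtain C where C: "C > 0" "\<And>i x. i \<in> I \<Longrightarrow> norm (\<rho> i x) \<le> C" "\<And>i x. i \<in> I \<Longrightarrow> norm (grad (\<rho> i) x) \<le> C"
    using \<rho>_bounds by metis
  \<comment> \<open>The kernel is vector-valued so that \<open>\<rho>\<close> and its gradient are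
    treated together; the summand 1 keeps the constant positive even for empty
    \<open>I\<close>.\<close>
  have key: "norm (\<Sum>i\<in>I. \<integral>y. (\<theta> i y * u y) *\<^sub>R k i (x - y) \<partial>lebesgue_on \<Omega>)
      \<le> (real (card I) * C + 1) * (\<integral>y. \<bar>u y\<bar> \<partial>lebesgue_on \<Omega>)"
    if u: "integrable (lebesgue_on \<Omega>) u" and k: "\<And>i x. i \<in> I \<Longrightarrow> norm (k i x) \<le> C"
    for u :: "'a \<Rightarrow> real" and k :: "'i \<Rightarrow> 'a \<Rightarrow> 'b::euclidean_space" and x
  proof -
    let ?U = "\<integral>y. \<bar>u y\<bar> \<partial>lebesgue_on \<Omega>"
    have "norm (\<Sum>i\<in>I. \<integral>y. (\<theta> i y * u y) *\<^sub>R k i (x - y) \<partial>lebesgue_on \<Omega>) \<le> (\<Sum>i\<in>I. C * ?U)"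
    proof (rule sum_norm_le)
      fix i assume i: "i \<in> I"
      have "norm (\<integral>y. (\<theta> i y * u y) *\<^sub>R k i (x - y) \<partial>lebesgue_on \<Omega>)
          \<le> (\<integral>y. norm ((\<theta> i y * u y) *\<^sub>R k i (x - y)) \<partial>lebesgue_on \<Omega>)" by (rule integral_norm_bound)
      also have "\<dots> \<le> (\<integral>y. C * \<bar>u y\<bar> \<partial>lebesgue_on \<Omega>)"
      proof (rule integral_mono')
        show "integrable (lebesgue_on \<Omega>) (\<lambda>y. C * \<bar>u y\<bar>)" using u by simp
        fix y
        have "(\<bar>\<theta> i y\<bar> * \<bar>u y\<bar>) * norm (k i (x - y)) \<le> (1 * \<bar>u y\<bar>) * C"
          using \<theta>_nonneg[OF i, of y] \<theta>_le_1[OF i, of y] k[OF i, of "x - y"]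
          by (intro mult_mono) auto
        then show "norm ((\<theta> i y * u y) *\<^sub>R k i (x - y)) \<le> C * \<bar>u y\<bar>" by (simp add: abs_mult mult.commute)
        show "0 \<le> C * \<bar>u y\<bar>" using C(1) by simp
      qed
      finally show "norm (\<integral>y. (\<theta> i y * u y) *\<^sub>R k i (x - y) \<partial>lebesgue_on \<Omega>) \<le> C * ?U" by simp
    qed
    also have "\<dots> = (real (card I) * C) * ?U" by simp
    also have "\<dots> \<le> (real (card I) * C + 1) * ?U" by (intro mult_right_mono) auto
    finally show ?thesis .
  qed
  show ?thesis
  proof (rule that)
    have "real (card I) * C \<ge> 0" using C(1) by simp
    then show "real (card I) * C + 1 > 0" by linarith
    fix u :: "'a \<Rightarrow> real" and x assume u: "integrable (lebesgue_on \<Omega>) u"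
    show "\<bar>T u x\<bar> \<le> (real (card I) * C + 1) * (\<integral>y. \<bar>u y\<bar> \<partial>lebesgue_on \<Omega>)"
    proof -
      have "norm (\<Sum>i\<in>I. \<integral>y. (\<theta> i y * u y) *\<^sub>R \<rho> i (x - y) \<partial>lebesgue_on \<Omega>)
          \<le> (real (card I) * C + 1) * (\<integral>y. \<bar>u y\<bar> \<partial>lebesgue_on \<Omega>)" by (rule key[OF u C(2)])
      then show ?thesis by (simp add: T_def mult.commute)
    qed
    show "norm (grad (T u) x) \<le> (real (card I) * C + 1) * (\<integral>y. \<bar>u y\<bar> \<partial>lebesgue_on \<Omega>)"
      unfolding grad_T[OF u] by (rule key[OF u C(3)])
  qed
qed

lemma integrable_kernel:
  assumes "integrable (lebesgue_on \<Omega>) u" "i \<in> I"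
  shows "integrable (lebesgue_on \<Omega>) (\<lambda>y. \<rho> i (x - y) * (\<theta> i y * u y))"
proof -
  obtain C where C: "C > 0" "\<And>i x. i \<in> I \<Longrightarrow> norm (\<rho> i x) \<le> C" using \<rho>_bounds by metis
  have "(\<lambda>y. \<rho> i (x - y)) \<in> borel_measurable (lebesgue_on \<Omega>)"
    by (intro measurable_lebesgue_on_borel borel_measurable_continuous_onI
        continuous_on_compose2[OF continuous_\<rho>(1)[OF assms(2)]] continuous_intros) auto
  then have "integrable (lebesgue_on \<Omega>) (\<lambda>y. (\<theta> i y * u y) *\<^sub>R \<rho> i (x - y))"
    using C(2)[OF assms(2)] by (intro integrable_bounded_scaleR[OF integrable_\<theta>_mult[OF assms]])
  then show ?thesis by (simp add: mult.commute)
qed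

lemma T_diff:
  assumes "integrable (lebesgue_on \<Omega>) u" "integrable (lebesgue_on \<Omega>) v"
  shows "T (\<lambda>x. u x - v x) x = T u x - T v x"
  unfolding T_def sum_subtractf[symmetric]
  using integrable_kernel[OF assms(1)] integrable_kernel[OF assms(2)]
  by (intro sum.cong refl) (simp add: right_diff_distrib)

text \<open>An almost everywhere identity goes in and a pointwise one comes out, because
  \<open>T\<close> sees its argument only through integrals.\<close>

lemma T_odd:
  assumes "AE x in lebesgue_on \<Omega>. v x = - u x" "u \<in> borel_measurable (lebesgue_on \<Omega>)" "v \<in> borel_measurable (lebesgue_on \<Omega>)"
  shows "T v x = - T u x"
proof -
  have "(\<integral>y. \<rho> i (x - y) * (\<theta> i y * v y) \<partial>lebesgue_on \<Omega>) = - (\<integral>y. \<rho> i (x - y) * (\<theta> i y * u y) \<partial>lebesgue_on \<Omega>)"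
    if i: "i \<in> I" for i
  proof -
    have m: "(\<lambda>y. \<rho> i (x - y)) \<in> borel_measurable (lebesgue_on \<Omega>)" "\<theta> i \<in> borel_measurable (lebesgue_on \<Omega>)"
      using measurable_\<rho>\<theta>(1,2)[OF i] by (intro measurable_lebesgue_on_borel; measurable)+
    have "(\<integral>y. \<rho> i (x - y) * (\<theta> i y * v y) \<partial>lebesgue_on \<Omega>) = (\<integral>y. - (\<rho> i (x - y) * (\<theta> i y * u y)) \<partial>lebesgue_on \<Omega>)"
    proof (rule integral_cong_AE)
      show "AE y in lebesgue_on \<Omega>. \<rho> i (x - y) * (\<theta> i y * v y) = - (\<rho> i (x - y) * (\<theta> i y * u y))"
        using assms(1) by eventually_elim simp
    qed (use m assms(2,3) in measurable)
    then show ?thesis by simp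
  qed
  then show ?thesis by (simp add: T_def sum_negf)
qed

section \<open>The error made by averaging\<close>

definition P :: "'a \<Rightarrow> real" where "P z = (\<Sum>i\<in>I. \<rho> i z)"

text \<open>The mean oscillation of \<phi> at scale \<open>t\<close>. With the sum \<open>P\<close>
  of all mollifiers as weight, one function controls the averaging errors of all pieces.\<close>

definition D :: "('a \<Rightarrow> real) \<Rightarrow> 'a \<Rightarrow> real" where
  "D \<phi> x = (\<integral>z. P z * \<bar>\<phi> (x - z) - \<phi> x\<bar> \<partial>lborel)"

lemma P_props: "P z \<ge> 0" "integrable lborel P" "(\<integral>z. P z \<partial>lborel) = real (card I)" "P z \<noteq> 0 \<Longrightarrow> norm z \<le> t"
  "P \<in> borel_measurable borel"
proof -
  show "P z \<ge> 0" unfolding P_def by (intro sum_nonneg \<rho>_nonneg)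
  show i: "integrable lborel P" unfolding P_def[abs_def] by (intro Bochner_Integration.integrable_sum integrable_\<rho>)
  show "(\<integral>z. P z \<partial>lborel) = real (card I)"
    unfolding P_def by (subst Bochner_Integration.integral_sum) (auto simp: integrable_\<rho> \<rho>_integral)
  show "norm z \<le> t" if "P z \<noteq> 0"
  proof -
    from that have "(\<Sum>i\<in>I. \<rho> i z) \<noteq> 0" by (simp add: P_def)
    then obtain i where "i \<in> I" "\<rho> i z \<noteq> 0" by (rule sum.not_neutral_contains_not_neutral)
    then show ?thesis by (rule \<rho>_support)
  qed
  show "P \<in> borel_measurable borel" using borel_measurable_integrable[OF i] by simp
qed

lemma D_integrable:
  assumes "\<phi> \<in> test_functions \<Omega>"
  shows "integrable lborel (\<lambda>z. P z * \<bar>\<phi> (x - z) - \<phi> x\<bar>)"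
    and "p \<ge> 1 \<Longrightarrow> integrable lborel (\<lambda>z. P z * \<bar>\<phi> (x - z) - \<phi> x\<bar> powr p)"
proof -
  note [measurable] = test_measurable[OF assms]
  obtain M where M: "M > 0" "\<And>x. \<bar>\<phi> x\<bar> \<le> M" using test_bounds[OF assms] by metis
  have le: "\<bar>\<phi> (x - z) - \<phi> x\<bar> \<le> 2 * M" for z using M(2)[of "x - z"] M(2)[of x] by linarith
  show "integrable lborel (\<lambda>z. P z * \<bar>\<phi> (x - z) - \<phi> x\<bar>)"
    using integrable_bounded_scaleR[OF P_props(2), of "\<lambda>z. \<bar>\<phi> (x - z) - \<phi> x\<bar>" "2 * M"] le by simp
  assume "p \<ge> 1"
  then have "norm (\<bar>\<phi> (x - z) - \<phi> x\<bar> powr p) \<le> (2 * M) powr p" for z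
    using le by (simp add: powr_mono2)
  then show "integrable lborel (\<lambda>z. P z * \<bar>\<phi> (x - z) - \<phi> x\<bar> powr p)"
    using integrable_bounded_scaleR[OF P_props(2), of "\<lambda>z. \<bar>\<phi> (x - z) - \<phi> x\<bar> powr p" "(2 * M) powr p"] by simp
qed

lemma D_nonneg: "D \<phi> x \<ge> 0"
  unfolding D_def by (intro Bochner_Integration.integral_nonneg mult_nonneg_nonneg P_props) auto

text \<open>Write m for \<open>card I\<close>, the mass of \<open>P\<close>. Jensen contributes
  m^(p-1), the integral over \<open>z\<close> another m, and \<open>test_translation\<close> the
  factor \<open>t powr p\<close> for each shift in the support of \<open>P\<close>.\<close>

lemma D_Lp:
  assumes I0: "I \<noteq> {}" and p: "p \<ge> 1" and \<phi>: "\<phi> \<in> test_functions \<Omega>"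
  shows "D \<phi> \<in> Lp_space p \<Omega>" "pint p \<Omega> (D \<phi>) \<le> (real (card I) * t) powr p * pint p \<Omega> (grad \<phi>)"
proof -
  note [measurable] = test_measurable[OF \<phi>] P_props(5)
  let ?m = "real (card I)"
  have m: "?m > 0" using I0 I by (simp add: card_gt_0_iff)
  have D [measurable]: "D \<phi> \<in> borel_measurable borel"
    unfolding D_def[abs_def] by (rule lborel.borel_measurable_lebesgue_integral[of _ borel, simplified]) measurable
  have "(\<integral>\<^sup>+x. ennreal (norm (D \<phi> x) powr p) \<partial>lborel)
      \<le> (\<integral>\<^sup>+x. ennreal (?m powr (p - 1)) * (\<integral>\<^sup>+z. ennreal (P z * \<bar>\<phi> (x - z) - \<phi> x\<bar> powr p) \<partial>lborel) \<partial>lborel)"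
  proof (rule nn_integral_mono)
    fix x
    have "(\<integral>\<^sup>+z. ennreal (P z * \<bar>\<phi> (x - z) - \<phi> x\<bar> powr p) \<partial>lborel)
        = ennreal (\<integral>z. P z * \<bar>\<phi> (x - z) - \<phi> x\<bar> powr p \<partial>lborel)"
      by (rule nn_integral_eq_integral[OF D_integrable(2)[OF \<phi> p]]) (simp add: P_props)
    moreover have "D \<phi> x powr p \<le> ?m powr (p - 1) * (\<integral>z. P z * \<bar>\<phi> (x - z) - \<phi> x\<bar> powr p \<partial>lborel)"
      unfolding D_def
      by (rule jensen_powr[OF P_props(2,1) _ m _ D_integrable(1)[OF \<phi>] D_integrable(2)[OF \<phi> p] p]) (auto simp: P_props(3))
    ultimately show "ennreal (norm (D \<phi> x) powr p)
        \<le> ennreal (?m powr (p - 1)) * (\<integral>\<^sup>+z. ennreal (P z * \<bar>\<phi> (x - z) - \<phi> x\<bar> powr p) \<partial>lborel)"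
      using D_nonneg[of \<phi> x] by (simp add: ennreal_mult'[symmetric] ennreal_leI)
  qed
  also have "\<dots> = ennreal (?m powr (p - 1)) *
      (\<integral>\<^sup>+x. (\<integral>\<^sup>+z. ennreal (P z * \<bar>\<phi> (x - z) - \<phi> x\<bar> powr p) \<partial>lborel) \<partial>lborel)"
    by (rule nn_integral_cmult) measurable
  also have "(\<integral>\<^sup>+x. (\<integral>\<^sup>+z. ennreal (P z * \<bar>\<phi> (x - z) - \<phi> x\<bar> powr p) \<partial>lborel) \<partial>lborel)
      = (\<integral>\<^sup>+z. (\<integral>\<^sup>+x. ennreal (P z * \<bar>\<phi> (x - z) - \<phi> x\<bar> powr p) \<partial>lborel) \<partial>lborel)"
    by (rule lborel_pair.Fubini') measurable
  also have "\<dots> \<le> (\<integral>\<^sup>+z. ennreal (P z) * ennreal (t powr p * pint p \<Omega> (grad \<phi>)) \<partial>lborel)"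
  proof (rule nn_integral_mono)
    fix z
    have "(\<integral>\<^sup>+x. ennreal (P z * \<bar>\<phi> (x - z) - \<phi> x\<bar> powr p) \<partial>lborel)
        = ennreal (P z) * (\<integral>\<^sup>+x. ennreal (\<bar>\<phi> (x - z) - \<phi> x\<bar> powr p) \<partial>lborel)"
      by (subst nn_integral_cmult[symmetric]) (measurable, simp add: ennreal_mult' P_props(1))
    also have "\<dots> \<le> ennreal (P z) * ennreal (t powr p * pint p \<Omega> (grad \<phi>))"
    proof (cases "P z = 0")
      case False
      then show ?thesis by (intro mult_left_mono test_translation[OF \<Omega>(1) p \<phi>] P_props(4)) auto
    qed simp
    finally show "(\<integral>\<^sup>+x. ennreal (P z * \<bar>\<phi> (x - z) - \<phi> x\<bar> powr p) \<partial>lborel)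
        \<le> ennreal (P z) * ennreal (t powr p * pint p \<Omega> (grad \<phi>))" .
  qed
  also have "\<dots> = ennreal ?m * ennreal (t powr p * pint p \<Omega> (grad \<phi>))"
    using nn_integral_eq_integral[OF P_props(2)] P_props(1,3) by (subst nn_integral_multc) auto
  also have "ennreal (?m powr (p - 1)) * (ennreal ?m * ennreal (t powr p * pint p \<Omega> (grad \<phi>)))
      = ennreal ((?m * t) powr p * pint p \<Omega> (grad \<phi>))"
  proof -
    have "?m powr (p - 1) * (?m * (t powr p * pint p \<Omega> (grad \<phi>))) = (?m * t) powr p * pint p \<Omega> (grad \<phi>)"
      using m t by (simp add: powr_diff powr_mult)
    then show ?thesis
      using m pint_nonneg[of p \<Omega> "grad \<phi>"] by (simp add: ennreal_mult'[symmetric])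
  qed
  finally have le: "(\<integral>\<^sup>+x. ennreal (norm (D \<phi> x) powr p) \<partial>lborel) \<le> ennreal ((?m * t) powr p * pint p \<Omega> (grad \<phi>))"
    by (simp add: mult_left_mono)
  show "D \<phi> \<in> Lp_space p \<Omega>" "pint p \<Omega> (D \<phi>) \<le> (?m * t) powr p * pint p \<Omega> (grad \<phi>)"
    using Lp_space_nn_integral[OF \<Omega>(1) D le] pint_nonneg[of p \<Omega> "grad \<phi>"] by auto
qed

text \<open>One estimate for two uses: \<kappa> = \<theta> gives \<open>T \<phi> - \<phi>\<close>,
  and \<kappa> = grad \<theta> gives the part of the gradient of \<open>T \<phi>\<close> in which
  the partition is differentiated. In the difference of the products \<phi> \<kappa> at
  \<open>x - z\<close> and at \<open>x\<close>, the oscillation of \<phi> leads to \<open>D\<close>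
  and that of \<kappa> to \<omega>.\<close>

lemma averaging_error:
  fixes \<kappa> :: "'i \<Rightarrow> 'a \<Rightarrow> 'b::euclidean_space"
  assumes \<phi>: "\<phi> \<in> test_functions \<Omega>"
    and \<kappa>: "\<And>i. i \<in> I \<Longrightarrow> continuous_on UNIV (\<kappa> i)" "\<And>i x. i \<in> I \<Longrightarrow> norm (\<kappa> i x) \<le> C" "C \<ge> 0"
      "\<And>i x z. i \<in> I \<Longrightarrow> norm z \<le> t \<Longrightarrow> norm (\<kappa> i (x - z) - \<kappa> i x) \<le> \<omega>"
  shows "norm ((\<Sum>i\<in>I. \<integral>y. (\<rho> i (x - y) * \<phi> y) *\<^sub>R \<kappa> i y \<partial>lborel) - \<phi> x *\<^sub>R (\<Sum>i\<in>I. \<kappa> i x))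
      \<le> C * D \<phi> x + real (card I) * \<omega> * \<bar>\<phi> x\<bar>"
proof -
  note [measurable] = test_measurable(1)[OF \<phi>]
  obtain M where M: "M > 0" "\<And>x. \<bar>\<phi> x\<bar> \<le> M" using test_bounds[OF \<phi>] by metis
  have meas [measurable]: "\<rho> i \<in> borel_measurable borel" "\<kappa> i \<in> borel_measurable borel" if "i \<in> I" for i
    using measurable_\<rho>\<theta>(1)[OF that] \<kappa>(1)[OF that] borel_measurable_continuous_onI by auto
  have int1: "integrable lborel (\<lambda>z. (\<rho> i z * \<phi> (x - z)) *\<^sub>R \<kappa> i (x - z))" if i: "i \<in> I" for i
  proof -
    have "norm (\<phi> (x - z) *\<^sub>R \<kappa> i (x - z)) \<le> M * C" for z
      using M(2) \<kappa>(2)[OF i] M(1) unfolding norm_scaleR by (intro mult_mono) auto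
    moreover have "(\<lambda>z. \<phi> (x - z) *\<^sub>R \<kappa> i (x - z)) \<in> borel_measurable lborel"
      by (simp, intro borel_measurable_continuous_onI continuous_intros
          continuous_on_compose2[OF continuous_on_test(1)[OF \<phi>]] continuous_on_compose2[OF \<kappa>(1)[OF i]]) auto
    ultimately have "integrable lborel (\<lambda>z. \<rho> i z *\<^sub>R (\<phi> (x - z) *\<^sub>R \<kappa> i (x - z)))"
      by (intro integrable_bounded_scaleR[OF integrable_\<rho>[OF i]])
    then show ?thesis by simp
  qed
  have int2: "integrable lborel (\<lambda>z. \<rho> i z *\<^sub>R (\<phi> x *\<^sub>R \<kappa> i x))" if "i \<in> I" for i
    using integrable_\<rho>[OF that] by simp
  have eq: "(\<integral>y. (\<rho> i (x - y) * \<phi> y) *\<^sub>R \<kappa> i y \<partial>lborel) - \<phi> x *\<^sub>R \<kappa> i x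
      = (\<integral>z. \<rho> i z *\<^sub>R (\<phi> (x - z) *\<^sub>R \<kappa> i (x - z) - \<phi> x *\<^sub>R \<kappa> i x) \<partial>lborel)" if i: "i \<in> I" for i
  proof -
    have a: "(\<integral>y. (\<rho> i (x - y) * \<phi> y) *\<^sub>R \<kappa> i y \<partial>lborel) = (\<integral>z. (\<rho> i z * \<phi> (x - z)) *\<^sub>R \<kappa> i (x - z) \<partial>lborel)"
      using lborel_integral_reflect[of "\<lambda>z. (\<rho> i z * \<phi> (x - z)) *\<^sub>R \<kappa> i (x - z)" x] meas[OF i] by simp
    have b: "(\<integral>z. \<rho> i z *\<^sub>R (\<phi> x *\<^sub>R \<kappa> i x) \<partial>lborel) = \<phi> x *\<^sub>R \<kappa> i x"
      using integral_scaleR_left[OF integrable_\<rho>[OF i], of "\<phi> x *\<^sub>R \<kappa> i x"] \<rho>_integral[OF i] by simp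
    have "(\<integral>z. \<rho> i z *\<^sub>R (\<phi> (x - z) *\<^sub>R \<kappa> i (x - z) - \<phi> x *\<^sub>R \<kappa> i x) \<partial>lborel)
        = (\<integral>z. (\<rho> i z * \<phi> (x - z)) *\<^sub>R \<kappa> i (x - z) - \<rho> i z *\<^sub>R (\<phi> x *\<^sub>R \<kappa> i x) \<partial>lborel)"
      by (rule Bochner_Integration.integral_cong) (simp_all add: scaleR_diff_right)
    also have "\<dots> = (\<integral>z. (\<rho> i z * \<phi> (x - z)) *\<^sub>R \<kappa> i (x - z) \<partial>lborel)
        - (\<integral>z. \<rho> i z *\<^sub>R (\<phi> x *\<^sub>R \<kappa> i x) \<partial>lborel)"
      by (rule Bochner_Integration.integral_diff[OF int1[OF i] int2[OF i]])
    also have "\<dots> = (\<integral>y. (\<rho> i (x - y) * \<phi> y) *\<^sub>R \<kappa> i y \<partial>lborel) - \<phi> x *\<^sub>R \<kappa> i x"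
      by (simp only: a b)
    finally show ?thesis by (rule sym)
  qed
  have le: "norm (\<rho> i z *\<^sub>R (\<phi> (x - z) *\<^sub>R \<kappa> i (x - z) - \<phi> x *\<^sub>R \<kappa> i x))
      \<le> C * (\<rho> i z * \<bar>\<phi> (x - z) - \<phi> x\<bar>) + \<omega> * \<bar>\<phi> x\<bar> * \<rho> i z" if i: "i \<in> I" for i z
  proof (cases "\<rho> i z = 0")
    case False
    have "\<phi> (x - z) *\<^sub>R \<kappa> i (x - z) - \<phi> x *\<^sub>R \<kappa> i x
        = (\<phi> (x - z) - \<phi> x) *\<^sub>R \<kappa> i (x - z) + \<phi> x *\<^sub>R (\<kappa> i (x - z) - \<kappa> i x)"
      by (simp add: algebra_simps)
    also have "norm \<dots> \<le> \<bar>\<phi> (x - z) - \<phi> x\<bar> * norm (\<kappa> i (x - z)) + \<bar>\<phi> x\<bar> * norm (\<kappa> i (x - z) - \<kappa> i x)"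
      using norm_triangle_ineq[of "(\<phi> (x - z) - \<phi> x) *\<^sub>R \<kappa> i (x - z)" "\<phi> x *\<^sub>R (\<kappa> i (x - z) - \<kappa> i x)"] by simp
    also have "\<dots> \<le> \<bar>\<phi> (x - z) - \<phi> x\<bar> * C + \<bar>\<phi> x\<bar> * \<omega>"
      using \<kappa>(2)[OF i] \<kappa>(4)[OF i \<rho>_support[OF i False]] by (intro add_mono mult_left_mono) auto
    finally have "\<rho> i z * norm (\<phi> (x - z) *\<^sub>R \<kappa> i (x - z) - \<phi> x *\<^sub>R \<kappa> i x)
        \<le> \<rho> i z * (\<bar>\<phi> (x - z) - \<phi> x\<bar> * C + \<bar>\<phi> x\<bar> * \<omega>)"
      using \<rho>_nonneg[OF i] by (intro mult_left_mono)
    moreover have "\<rho> i z * (a * C + f * \<omega>) = C * (\<rho> i z * a) + \<omega> * f * \<rho> i z" for a f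
      by (simp add: algebra_simps)
    ultimately show ?thesis
      by (simp only: norm_scaleR abs_of_nonneg[OF \<rho>_nonneg[OF i]])
  qed simp
  have int3: "integrable lborel (\<lambda>z. \<rho> i z * \<bar>\<phi> (x - z) - \<phi> x\<bar>)" if i: "i \<in> I" for i
  proof -
    have "\<bar>\<phi> (x - z) - \<phi> x\<bar> \<le> 2 * M" for z using M(2)[of "x - z"] M(2)[of x] by linarith
    then show ?thesis
      using integrable_bounded_scaleR[OF integrable_\<rho>[OF i], of "\<lambda>z. \<bar>\<phi> (x - z) - \<phi> x\<bar>" "2 * M"] by simp
  qed
  have "norm ((\<Sum>i\<in>I. \<integral>y. (\<rho> i (x - y) * \<phi> y) *\<^sub>R \<kappa> i y \<partial>lborel) - \<phi> x *\<^sub>R (\<Sum>i\<in>I. \<kappa> i x))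
      = norm (\<Sum>i\<in>I. \<integral>z. \<rho> i z *\<^sub>R (\<phi> (x - z) *\<^sub>R \<kappa> i (x - z) - \<phi> x *\<^sub>R \<kappa> i x) \<partial>lborel)"
    by (simp add: scaleR_sum_right sum_subtractf[symmetric] eq)
  also have "\<dots> \<le> (\<Sum>i\<in>I. C * (\<integral>z. \<rho> i z * \<bar>\<phi> (x - z) - \<phi> x\<bar> \<partial>lborel) + \<omega> * \<bar>\<phi> x\<bar>)"
  proof (rule sum_norm_le)
    fix i assume i: "i \<in> I"
    have "norm (\<integral>z. \<rho> i z *\<^sub>R (\<phi> (x - z) *\<^sub>R \<kappa> i (x - z) - \<phi> x *\<^sub>R \<kappa> i x) \<partial>lborel)
        \<le> (\<integral>z. norm (\<rho> i z *\<^sub>R (\<phi> (x - z) *\<^sub>R \<kappa> i (x - z) - \<phi> x *\<^sub>R \<kappa> i x)) \<partial>lborel)"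
      by (rule integral_norm_bound)
    also have "\<dots> \<le> (\<integral>z. C * (\<rho> i z * \<bar>\<phi> (x - z) - \<phi> x\<bar>) + \<omega> * \<bar>\<phi> x\<bar> * \<rho> i z \<partial>lborel)"
      by (rule integral_mono'[OF _ le[OF i]])
        (use int3[OF i] integrable_\<rho>[OF i] \<rho>_nonneg[OF i] \<omega> \<kappa>(3) in auto)
    also have "\<dots> = C * (\<integral>z. \<rho> i z * \<bar>\<phi> (x - z) - \<phi> x\<bar> \<partial>lborel) + \<omega> * \<bar>\<phi> x\<bar>"
      using int3[OF i] integrable_\<rho>[OF i] \<rho>_integral[OF i] by simp
    finally show "norm (\<integral>z. \<rho> i z *\<^sub>R (\<phi> (x - z) *\<^sub>R \<kappa> i (x - z) - \<phi> x *\<^sub>R \<kappa> i x) \<partial>lborel)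
        \<le> C * (\<integral>z. \<rho> i z * \<bar>\<phi> (x - z) - \<phi> x\<bar> \<partial>lborel) + \<omega> * \<bar>\<phi> x\<bar>" .
  qed
  also have "\<dots> = C * D \<phi> x + real (card I) * \<omega> * \<bar>\<phi> x\<bar>"
  proof -
    have "D \<phi> x = (\<Sum>i\<in>I. \<integral>z. \<rho> i z * \<bar>\<phi> (x - z) - \<phi> x\<bar> \<partial>lborel)"
      unfolding D_def P_def sum_distrib_right using int3 by (rule Bochner_Integration.integral_sum)
    then show ?thesis by (simp add: sum.distrib sum_distrib_left)
  qed
  finally show ?thesis .
qed

text \<open>For smooth arguments the derivative is moved off the mollifier by parts; differentiating
  the product of \<open>\<theta> i\<close> and \<phi> then yields the two sums. The bound by the
  gradient of \<phi> starts from this formula.\<close>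

lemma T_test_eq:
  assumes \<phi>: "\<phi> \<in> test_functions \<Omega>"
  shows "T \<phi> x = (\<Sum>i\<in>I. \<integral>y. (\<rho> i (x - y) * \<phi> y) *\<^sub>R \<theta> i y \<partial>lborel)"
    and "grad (T \<phi>) x = (\<Sum>i\<in>I. \<integral>y. (\<rho> i (x - y) * \<theta> i y) *\<^sub>R grad \<phi> y \<partial>lborel)
      + (\<Sum>i\<in>I. \<integral>y. (\<rho> i (x - y) * \<phi> y) *\<^sub>R grad (\<theta> i) y \<partial>lborel)"
    and "\<And>i. i \<in> I \<Longrightarrow> integrable lborel (\<lambda>y. (\<rho> i (x - y) * \<theta> i y) *\<^sub>R grad \<phi> y)"
proof -
  obtain K where K: "compact K" "K \<subseteq> \<Omega>" "\<And>x. x \<notin> K \<Longrightarrow> \<phi> x = 0" using test_functionsE[OF \<phi>] by metis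
  have G: "grad \<phi> x = 0" if "x \<notin> K" for x
    by (rule grad_outside_support(1)[OF K(1) _ that]) (rule K(3))
  have refl_cont: "continuous_on UNIV (\<lambda>y. \<rho> i (x - y))" "continuous_on UNIV (\<lambda>y. grad (\<rho> i) (x - y))" if "i \<in> I" for i
    by (intro continuous_on_compose2[OF continuous_\<rho>(1)[OF that]] continuous_on_compose2[OF continuous_\<rho>(2)[OF that]]
        continuous_intros; simp)+
  have int\<phi>: "integrable (lebesgue_on \<Omega>) \<phi>"
    using integrable_test(1)[OF \<phi>] lebesgue_on_eq_lborel(2)[OF \<Omega>(1) test_measurable(1)[OF \<phi>] test_zero_outside(1)[OF \<phi>]] by simp
  have "(\<integral>y. \<rho> i (x - y) * (\<theta> i y * \<phi> y) \<partial>lebesgue_on \<Omega>) = (\<integral>y. (\<rho> i (x - y) * \<phi> y) *\<^sub>R \<theta> i y \<partial>lborel)" if i: "i \<in> I" for i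
  proof -
    have "(\<integral>y. \<rho> i (x - y) * (\<theta> i y * \<phi> y) \<partial>lebesgue_on \<Omega>) = (\<integral>y. \<rho> i (x - y) * (\<theta> i y * \<phi> y) \<partial>lborel)"
      by (rule lebesgue_on_eq_lborel(1)[OF \<Omega>(1)])
        (auto intro!: borel_measurable_continuous_onI continuous_intros refl_cont i continuous_\<theta> continuous_on_test[OF \<phi>]
          simp: test_zero_outside[OF \<phi>])
    then show ?thesis by (simp add: mult_ac)
  qed
  then show "T \<phi> x = (\<Sum>i\<in>I. \<integral>y. (\<rho> i (x - y) * \<phi> y) *\<^sub>R \<theta> i y \<partial>lborel)" by (simp add: T_def)
  show i1: "integrable lborel (\<lambda>y. (\<rho> i (x - y) * \<theta> i y) *\<^sub>R grad \<phi> y)" if i: "i \<in> I" for i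
    using G by (intro integrable_compact_support[OF _ K(1)] continuous_intros refl_cont i continuous_\<theta> continuous_on_test[OF \<phi>]) auto
  have i2: "integrable lborel (\<lambda>y. (\<rho> i (x - y) * \<phi> y) *\<^sub>R grad (\<theta> i) y)" if i: "i \<in> I" for i
    using K(3) by (intro integrable_compact_support[OF _ K(1)] continuous_intros refl_cont i continuous_\<theta> continuous_on_test[OF \<phi>]) auto
  have i3: "integrable lborel (\<lambda>y. (\<theta> i y * \<phi> y) *\<^sub>R grad (\<rho> i) (x - y))" if i: "i \<in> I" for i
    using K(3) by (intro integrable_compact_support[OF _ K(1)] continuous_intros refl_cont i continuous_\<theta> continuous_on_test[OF \<phi>]) auto
  have key: "(\<integral>y. (\<theta> i y * \<phi> y) *\<^sub>R grad (\<rho> i) (x - y) \<partial>lebesgue_on \<Omega>)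
      = (\<integral>y. (\<rho> i (x - y) * \<theta> i y) *\<^sub>R grad \<phi> y \<partial>lborel) + (\<integral>y. (\<rho> i (x - y) * \<phi> y) *\<^sub>R grad (\<theta> i) y \<partial>lborel)"
    if i: "i \<in> I" for i
  proof (rule euclidean_eqI)
    fix b :: 'a assume b: "b \<in> Basis"
    have on: "(\<integral>y. (\<theta> i y * \<phi> y) *\<^sub>R grad (\<rho> i) (x - y) \<partial>lebesgue_on \<Omega>)
        = (\<integral>y. (\<theta> i y * \<phi> y) *\<^sub>R grad (\<rho> i) (x - y) \<partial>lborel)"
      by (rule lebesgue_on_eq_lborel(1)[OF \<Omega>(1)])
        (auto intro!: borel_measurable_continuous_onI continuous_intros refl_cont i continuous_\<theta> continuous_on_test[OF \<phi>]
          simp: test_zero_outside[OF \<phi>])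
    have r1: "((\<lambda>y. \<rho> i (x - y)) has_derivative (\<lambda>h. (- grad (\<rho> i) (x - y)) \<bullet> h)) (at y)" for y
    proof -
      have "((\<lambda>y. x - y) has_derivative (\<lambda>h. - h)) (at y)" by (auto intro!: derivative_eq_intros)
      from has_derivative_compose[OF this, of "\<rho> i", OF C_differentiable_Suc_derivative[OF \<rho>_smooth[OF i]]]
      show ?thesis by (rule has_derivative_eq_rhs) (auto simp: fun_eq_iff)
    qed
    \<comment> \<open>This minus sign, from differentiating in \<open>y\<close> instead of
      \<open>x\<close>, cancels the one from integration by parts.\<close>
    have rg: "grad (\<lambda>y. \<rho> i (x - y)) y = - grad (\<rho> i) (x - y)" for y by (rule grad_eqI[OF r1])
    have rC: "C_differentiable (Suc 0) (\<lambda>y. \<rho> i (x - y))"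
      by (rule C_differentiable_SucI[OF r1]) (auto intro!: continuous_intros refl_cont i)
    have gC: "C_differentiable (Suc 0) (\<lambda>y. \<theta> i y * \<phi> y)"
      by (rule C_differentiable_mult[OF \<theta>_C1[OF i] test_functions_smooth[OF \<phi>]])
    have gg: "grad (\<lambda>y. \<theta> i y * \<phi> y) y = \<theta> i y *\<^sub>R grad \<phi> y + \<phi> y *\<^sub>R grad (\<theta> i) y" for y
      by (rule grad_mult[OF \<theta>_C1[OF i] test_functions_smooth[OF \<phi>]])
    have "(\<integral>y. \<rho> i (x - y) * (grad (\<lambda>y. \<theta> i y * \<phi> y) y \<bullet> b) \<partial>lborel)
        = - (\<integral>y. (grad (\<lambda>y. \<rho> i (x - y)) y \<bullet> b) * (\<theta> i y * \<phi> y) \<partial>lborel)"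
      using K(3) by (intro integral_by_parts[OF rC gC K(1)]) simp
    then have ibp: "(\<integral>y. \<rho> i (x - y) * ((\<theta> i y *\<^sub>R grad \<phi> y + \<phi> y *\<^sub>R grad (\<theta> i) y) \<bullet> b) \<partial>lborel)
        = (\<integral>y. (grad (\<rho> i) (x - y) \<bullet> b) * (\<theta> i y * \<phi> y) \<partial>lborel)"
      unfolding gg rg by simp
    have "(\<integral>y. (\<theta> i y * \<phi> y) *\<^sub>R grad (\<rho> i) (x - y) \<partial>lborel) \<bullet> b
        = (\<integral>y. ((\<theta> i y * \<phi> y) *\<^sub>R grad (\<rho> i) (x - y)) \<bullet> b \<partial>lborel)"
      by (rule integral_inner_left[symmetric]) (rule i3[OF i])
    also have "\<dots> = (\<integral>y. (grad (\<rho> i) (x - y) \<bullet> b) * (\<theta> i y * \<phi> y) \<partial>lborel)"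
      by (simp add: mult.commute)
    also have "\<dots> = (\<integral>y. ((\<rho> i (x - y) * \<theta> i y) *\<^sub>R grad \<phi> y + (\<rho> i (x - y) * \<phi> y) *\<^sub>R grad (\<theta> i) y) \<bullet> b \<partial>lborel)"
      unfolding ibp[symmetric]
      by (rule Bochner_Integration.integral_cong) (simp_all add: inner_add_left distrib_left mult.assoc)
    also have "\<dots> = (\<integral>y. (\<rho> i (x - y) * \<theta> i y) *\<^sub>R grad \<phi> y + (\<rho> i (x - y) * \<phi> y) *\<^sub>R grad (\<theta> i) y \<partial>lborel) \<bullet> b"
      by (rule integral_inner_left) (intro Bochner_Integration.integrable_add i1[OF i] i2[OF i])
    finally show "(\<integral>y. (\<theta> i y * \<phi> y) *\<^sub>R grad (\<rho> i) (x - y) \<partial>lebesgue_on \<Omega>) \<bullet> b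
        = ((\<integral>y. (\<rho> i (x - y) * \<theta> i y) *\<^sub>R grad \<phi> y \<partial>lborel) + (\<integral>y. (\<rho> i (x - y) * \<phi> y) *\<^sub>R grad (\<theta> i) y \<partial>lborel)) \<bullet> b"
      unfolding on Bochner_Integration.integral_add[OF i1[OF i] i2[OF i]] .
  qed
  show "grad (T \<phi>) x = (\<Sum>i\<in>I. \<integral>y. (\<rho> i (x - y) * \<theta> i y) *\<^sub>R grad \<phi> y \<partial>lborel)
      + (\<Sum>i\<in>I. \<integral>y. (\<rho> i (x - y) * \<phi> y) *\<^sub>R grad (\<theta> i) y \<partial>lborel)"
    unfolding grad_T[OF int\<phi>] sum.distrib[symmetric] using key by (intro sum.cong refl)
qed

section \<open>The kernel that averages the gradient\<close>

definition K :: "'a \<Rightarrow> 'a \<Rightarrow> real" where "K x y = (\<Sum>i\<in>I. \<rho> i (x - y) * \<theta> i y)"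

text \<open>Summing the pieces into the single kernel \<open>K\<close> before estimating is
  essential: treated separately they would cost a factor depending on \<open>card I\<close>, whereas
  the mass of \<open>K\<close> is close to that of the partition of unity.\<close>

definition G :: "('a \<Rightarrow> real) \<Rightarrow> 'a \<Rightarrow> real" where
  "G \<phi> x = (\<integral>y. K x y * norm (grad \<phi> y) \<partial>lborel)"

lemma K_nonneg: "K x y \<ge> 0"
  unfolding K_def by (intro sum_nonneg mult_nonneg_nonneg \<rho>_nonneg \<theta>_nonneg)

lemma K_continuous: "continuous_on UNIV (\<lambda>y. K x y)" "continuous_on UNIV (\<lambda>(x, y). K x y)"
proof -
  show "continuous_on UNIV (\<lambda>y. K x y)"
    unfolding K_def
    by (intro continuous_intros continuous_on_compose2[OF continuous_\<rho>(1)] continuous_\<theta>) auto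
  show "continuous_on UNIV (\<lambda>(x, y). K x y)"
    unfolding K_def case_prod_beta
    by (intro continuous_intros continuous_on_compose2[OF continuous_\<rho>(1)] continuous_on_compose2[OF continuous_\<theta>(1)]) auto
qed

lemma integrable_\<rho>\<theta>:
  assumes "i \<in> I"
  shows "integrable lborel (\<lambda>y. \<rho> i (x - y) * \<theta> i y)"
proof -
  have "norm (\<theta> i y) \<le> 1" for y using \<theta>_nonneg[OF assms, of y] \<theta>_le_1[OF assms, of y] by simp
  then have "integrable lborel (\<lambda>y. \<rho> i (x - y) *\<^sub>R \<theta> i y)"
    using measurable_\<rho>\<theta>(2)[OF assms]
    by (intro integrable_bounded_scaleR[OF lborel_integrable_reflect[OF integrable_\<rho>[OF assms]]]) simp_all
  then show ?thesis by simp
qed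

lemma K_integrable: "integrable lborel (\<lambda>y. K x y)"
  unfolding K_def by (intro Bochner_Integration.integrable_sum integrable_\<rho>\<theta>)

text \<open>On the support of \<open>\<rho> i (x - y)\<close> the weight \<open>\<theta> i y\<close>
  exceeds \<open>\<theta> i x\<close> by at most \<omega>, and the weights at \<open>x\<close> add
  up to at most 1.\<close>

lemma K_integral_le: "(\<integral>y. K x y \<partial>lborel) \<le> 1 + real (card I) * \<omega>"
proof -
  have "(\<integral>y. K x y \<partial>lborel) = (\<Sum>i\<in>I. \<integral>y. \<rho> i (x - y) * \<theta> i y \<partial>lborel)"
    unfolding K_def using integrable_\<rho>\<theta> by (rule Bochner_Integration.integral_sum)
  also have "\<dots> \<le> (\<Sum>i\<in>I. \<theta> i x + \<omega>)"
  proof (rule sum_mono)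
    fix i assume i: "i \<in> I"
    have ir: "integrable lborel (\<lambda>y. \<rho> i (x - y))" by (rule lborel_integrable_reflect[OF integrable_\<rho>[OF i]])
    have "(\<integral>y. \<rho> i (x - y) * \<theta> i y \<partial>lborel) \<le> (\<integral>y. \<rho> i (x - y) * (\<theta> i x + \<omega>) \<partial>lborel)"
    proof (rule integral_mono[OF integrable_\<rho>\<theta>[OF i]])
      show "integrable lborel (\<lambda>y. \<rho> i (x - y) * (\<theta> i x + \<omega>))" using ir by simp
      show "\<rho> i (x - y) * \<theta> i y \<le> \<rho> i (x - y) * (\<theta> i x + \<omega>)" for y
      proof (cases "\<rho> i (x - y) = 0")
        case False
        have "\<bar>\<theta> i (x - (x - y)) - \<theta> i x\<bar> \<le> \<omega>" by (rule \<theta>_osc(1)[OF i \<rho>_support[OF i False]])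
        then have "\<theta> i y \<le> \<theta> i x + \<omega>" by simp
        then show ?thesis using \<rho>_nonneg[OF i] by (intro mult_left_mono)
      qed simp
    qed
    also have "\<dots> = \<theta> i x + \<omega>"
      using ir lborel_integral_reflect[OF measurable_\<rho>\<theta>(1)[OF i], of x] \<rho>_integral[OF i] by simp
    finally show "(\<integral>y. \<rho> i (x - y) * \<theta> i y \<partial>lborel) \<le> \<theta> i x + \<omega>" .
  qed
  also have "\<dots> \<le> 1 + real (card I) * \<omega>" using \<theta>_sum_le[of x] by (simp add: sum.distrib)
  finally show ?thesis .
qed

text \<open>In this variable \<open>\<theta> i y\<close> is a constant and the mollifier integrates
  to 1, so the bound carries no error term.\<close>

lemma K_nn_integral_le: "(\<integral>\<^sup>+x. ennreal (K x y) \<partial>lborel) \<le> 1"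
proof -
  have sh: "(\<integral>\<^sup>+x. ennreal (\<rho> i (x - y)) \<partial>lborel) = 1" if i: "i \<in> I" for i
  proof -
    have "(\<integral>\<^sup>+x. ennreal (\<rho> i (x - y)) \<partial>lborel) = (\<integral>\<^sup>+x. ennreal (\<rho> i x) \<partial>lborel)"
      using lborel_nn_integral_shift[of "\<lambda>x. ennreal (\<rho> i x)" "- y"] measurable_\<rho>\<theta>(1)[OF i] by simp
    also have "\<dots> = 1"
      using nn_integral_eq_integral[OF integrable_\<rho>[OF i]] \<rho>_nonneg[OF i] \<rho>_integral[OF i] by simp
    finally show ?thesis .
  qed
  have m: "(\<lambda>x. \<rho> i (x - y)) \<in> borel_measurable borel" if "i \<in> I" for i
    by (intro borel_measurable_continuous_onI continuous_on_compose2[OF continuous_\<rho>(1)[OF that]] continuous_intros) auto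
  have "(\<integral>\<^sup>+x. ennreal (K x y) \<partial>lborel) = (\<integral>\<^sup>+x. (\<Sum>i\<in>I. ennreal (\<theta> i y) * ennreal (\<rho> i (x - y))) \<partial>lborel)"
  proof (rule nn_integral_cong)
    fix x
    have "ennreal (K x y) = (\<Sum>i\<in>I. ennreal (\<rho> i (x - y) * \<theta> i y))"
      unfolding K_def by (rule sum_ennreal[symmetric]) (intro mult_nonneg_nonneg \<rho>_nonneg \<theta>_nonneg)
    also have "\<dots> = (\<Sum>i\<in>I. ennreal (\<theta> i y) * ennreal (\<rho> i (x - y)))"
    proof (rule sum.cong[OF refl])
      fix i assume i: "i \<in> I"
      show "ennreal (\<rho> i (x - y) * \<theta> i y) = ennreal (\<theta> i y) * ennreal (\<rho> i (x - y))"
        unfolding ennreal_mult[OF \<rho>_nonneg[OF i] \<theta>_nonneg[OF i]] by (rule mult.commute)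
    qed
    finally show "ennreal (K x y) = (\<Sum>i\<in>I. ennreal (\<theta> i y) * ennreal (\<rho> i (x - y)))" .
  qed
  also have "\<dots> = (\<Sum>i\<in>I. \<integral>\<^sup>+x. ennreal (\<theta> i y) * ennreal (\<rho> i (x - y)) \<partial>lborel)"
    using m by (intro nn_integral_sum borel_measurable_times measurable_compose[OF _ measurable_ennreal]) auto
  also have "\<dots> = (\<Sum>i\<in>I. ennreal (\<theta> i y))"
  proof (rule sum.cong[OF refl])
    fix i assume i: "i \<in> I"
    have "(\<integral>\<^sup>+x. ennreal (\<theta> i y) * ennreal (\<rho> i (x - y)) \<partial>lborel) = ennreal (\<theta> i y) * (\<integral>\<^sup>+x. ennreal (\<rho> i (x - y)) \<partial>lborel)"
      using m[OF i] by (intro nn_integral_cmult measurable_compose[OF _ measurable_ennreal]) simp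
    then show "(\<integral>\<^sup>+x. ennreal (\<theta> i y) * ennreal (\<rho> i (x - y)) \<partial>lborel) = ennreal (\<theta> i y)" using sh[OF i] by simp
  qed
  also have "\<dots> = ennreal (\<Sum>i\<in>I. \<theta> i y)" by (simp add: sum_ennreal \<theta>_nonneg)
  also have "\<dots> \<le> ennreal 1" using \<theta>_sum_le by (rule ennreal_leI)
  finally show ?thesis by simp
qed

text \<open>A Schur test: the mass of \<open>K\<close> in \<open>y\<close> enters through Jensen,
  the mass in \<open>x\<close> through Tonelli.\<close>

lemma G_Lp:
  assumes p: "p \<ge> 1" and \<phi>: "\<phi> \<in> test_functions \<Omega>"
  shows "G \<phi> \<in> Lp_space p \<Omega>" "pint p \<Omega> (G \<phi>) \<le> (1 + real (card I) * \<omega>) powr (p - 1) * pint p \<Omega> (grad \<phi>)"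
proof -
  let ?A = "1 + real (card I) * \<omega>"
  have A: "?A > 0" using \<omega> by (intro add_pos_nonneg) auto
  note [measurable] = test_measurable[OF \<phi>]
  have [measurable]: "(\<lambda>(x, y). K x y) \<in> borel_measurable (lborel \<Otimes>\<^sub>M lborel)"
  proof -
    have "(\<lambda>(x, y). K x y) \<in> borel_measurable (borel \<Otimes>\<^sub>M borel)"
      unfolding borel_prod by (rule borel_measurable_continuous_onI[OF K_continuous(2)])
    then show ?thesis by (simp cong: measurable_cong_sets add: sets_pair_measure_cong[OF sets_lborel sets_lborel])
  qed
  obtain M where M: "M > 0" "\<And>x. norm (grad \<phi> x) \<le> M" using test_bounds[OF \<phi>] by metis
  have i1: "integrable lborel (\<lambda>y. K x y * norm (grad \<phi> y))" for x
    using integrable_bounded_scaleR[OF K_integrable, of "\<lambda>y. norm (grad \<phi> y)" M] M(2) by simp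
  have i2: "integrable lborel (\<lambda>y. K x y * norm (grad \<phi> y) powr p)" for x
  proof -
    have "norm (norm (grad \<phi> y) powr p) \<le> M powr p" for y using M(2) p by (simp add: powr_mono2)
    then show ?thesis
      using integrable_bounded_scaleR[OF K_integrable, of "\<lambda>y. norm (grad \<phi> y) powr p" "M powr p"] by simp
  qed
  have G0: "G \<phi> x \<ge> 0" for x
    unfolding G_def by (intro Bochner_Integration.integral_nonneg mult_nonneg_nonneg K_nonneg) auto
  have Gm [measurable]: "G \<phi> \<in> borel_measurable borel"
    unfolding G_def[abs_def] by (rule lborel.borel_measurable_lebesgue_integral[of _ lborel, simplified]) measurable
  have "(\<integral>\<^sup>+x. ennreal (norm (G \<phi> x) powr p) \<partial>lborel)
      \<le> (\<integral>\<^sup>+x. ennreal (?A powr (p - 1)) * (\<integral>\<^sup>+y. ennreal (K x y * norm (grad \<phi> y) powr p) \<partial>lborel) \<partial>lborel)"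
  proof (rule nn_integral_mono)
    fix x
    have "(\<integral>\<^sup>+y. ennreal (K x y * norm (grad \<phi> y) powr p) \<partial>lborel)
        = ennreal (\<integral>y. K x y * norm (grad \<phi> y) powr p \<partial>lborel)"
      by (rule nn_integral_eq_integral[OF i2]) (simp add: K_nonneg)
    moreover have "G \<phi> x powr p \<le> ?A powr (p - 1) * (\<integral>y. K x y * norm (grad \<phi> y) powr p \<partial>lborel)"
      unfolding G_def by (rule jensen_powr[OF K_integrable K_nonneg K_integral_le A _ i1 i2 p]) simp
    ultimately show "ennreal (norm (G \<phi> x) powr p)
        \<le> ennreal (?A powr (p - 1)) * (\<integral>\<^sup>+y. ennreal (K x y * norm (grad \<phi> y) powr p) \<partial>lborel)"
      using G0[of x] by (simp add: ennreal_mult'[symmetric] ennreal_leI)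
  qed
  also have "\<dots> = ennreal (?A powr (p - 1)) *
      (\<integral>\<^sup>+x. (\<integral>\<^sup>+y. ennreal (K x y * norm (grad \<phi> y) powr p) \<partial>lborel) \<partial>lborel)"
    by (rule nn_integral_cmult) measurable
  also have "(\<integral>\<^sup>+x. (\<integral>\<^sup>+y. ennreal (K x y * norm (grad \<phi> y) powr p) \<partial>lborel) \<partial>lborel)
      = (\<integral>\<^sup>+y. (\<integral>\<^sup>+x. ennreal (K x y * norm (grad \<phi> y) powr p) \<partial>lborel) \<partial>lborel)"
    by (rule lborel_pair.Fubini') measurable
  also have "\<dots> \<le> (\<integral>\<^sup>+y. ennreal (norm (grad \<phi> y) powr p) \<partial>lborel)"
  proof (rule nn_integral_mono)
    fix y
    have "(\<integral>\<^sup>+x. ennreal (K x y * norm (grad \<phi> y) powr p) \<partial>lborel)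
        = (\<integral>\<^sup>+x. ennreal (K x y) \<partial>lborel) * ennreal (norm (grad \<phi> y) powr p)"
      by (subst nn_integral_multc[symmetric]) (measurable, simp add: ennreal_mult K_nonneg)
    also have "\<dots> \<le> 1 * ennreal (norm (grad \<phi> y) powr p)"
      by (intro mult_right_mono K_nn_integral_le) auto
    finally show "(\<integral>\<^sup>+x. ennreal (K x y * norm (grad \<phi> y) powr p) \<partial>lborel) \<le> ennreal (norm (grad \<phi> y) powr p)" by simp
  qed
  also have "\<dots> = ennreal (pint p \<Omega> (grad \<phi>))" by (rule pint_test(2)[OF \<Omega>(1) p \<phi>])
  finally have "(\<integral>\<^sup>+x. ennreal (norm (G \<phi> x) powr p) \<partial>lborel) \<le> ennreal (?A powr (p - 1)) * ennreal (pint p \<Omega> (grad \<phi>))"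
    by (simp add: mult_left_mono)
  then have le: "(\<integral>\<^sup>+x. ennreal (norm (G \<phi> x) powr p) \<partial>lborel) \<le> ennreal (?A powr (p - 1) * pint p \<Omega> (grad \<phi>))"
    by (simp add: ennreal_mult pint_nonneg)
  show "G \<phi> \<in> Lp_space p \<Omega>" "pint p \<Omega> (G \<phi>) \<le> ?A powr (p - 1) * pint p \<Omega> (grad \<phi>)"
    using Lp_space_nn_integral[OF \<Omega>(1) Gm le] pint_nonneg[of p \<Omega> "grad \<phi>"] by auto
qed

text \<open>The sum of the partition is constant on the open set \<Omega>. This removes the leading
  part of the averages of \<phi> grad \<theta>_i, which would otherwise be of the size of
  \<open>B\<close> times \<phi>.\<close>

lemma \<theta>_grad_sum:
  assumes "x \<in> \<Omega>"
  shows "(\<Sum>i\<in>I. grad (\<theta> i) x) = 0"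
proof -
  have "((\<lambda>x. 1) has_derivative (\<lambda>h. 0 \<bullet> h)) (at x)" by simp
  then have "((\<lambda>x. \<Sum>i\<in>I. \<theta> i x) has_derivative (\<lambda>h. 0 \<bullet> h)) (at x)"
    by (rule has_derivative_transform_within_open[OF _ \<Omega>(1) assms]) (simp add: \<theta>_sum)
  then have "grad (\<lambda>x. \<Sum>i\<in>I. \<theta> i x) x = 0" by (rule grad_eqI)
  then show ?thesis using grad_sum[of I \<theta> x, OF \<theta>_C1] by simp
qed

text \<open>On \<Omega> the error \<open>T \<phi> - \<phi>\<close> is bounded by
  \<open>D \<phi>\<close> and a multiple of \<omega>, and the gradient of \<open>T \<phi>\<close> by
  \<open>G \<phi>\<close> plus a similar remainder. Only the coefficient of \<open>G \<phi>\<close>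
  has to be near 1, hence the free \<open>d\<close>; the remainders carry factors \<open>t\<close>
  or \<omega> and are split with \<open>d = 1\<close>, which gives \<open>2 powr b\<close>.\<close>

lemma T_estimates:
  assumes I0: "I \<noteq> {}" and p: "1 \<le> p" "p \<le> b" and d: "d > 0" and \<phi>: "\<phi> \<in> test_functions \<Omega>"
  defines "m \<equiv> real (card I)"
  shows "pint p \<Omega> (\<lambda>x. T \<phi> x - \<phi> x)
      \<le> 2 powr b * ((m * t) powr p * pint p \<Omega> (grad \<phi>)) + 2 powr b * ((m * \<omega>) powr p * pint p \<Omega> \<phi>)"
    and "pint p \<Omega> (grad (T \<phi>)) \<le> (1 + d) powr b * ((1 + m * \<omega>) powr (p - 1) * pint p \<Omega> (grad \<phi>))
      + ((1 + d) / d) powr b * (2 powr b * (B powr p * ((m * t) powr p * pint p \<Omega> (grad \<phi>)))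
         + 2 powr b * ((m * \<omega>) powr p * pint p \<Omega> \<phi>))"
proof -
  have int\<phi>: "integrable (lebesgue_on \<Omega>) \<phi>"
    using integrable_test(1)[OF \<phi>] lebesgue_on_eq_lborel(2)[OF \<Omega>(1) test_measurable(1)[OF \<phi>] test_zero_outside(1)[OF \<phi>]] by simp
  have T\<phi>: "T \<phi> \<in> test_functions \<Omega>" by (rule T_test[OF int\<phi>])
  have m: "m \<ge> 0" by (simp add: m_def)
  note DL = D_Lp[OF I0 p(1) \<phi>, folded m_def] and GL = G_Lp[OF p(1) \<phi>, folded m_def]
  have \<phi>L: "\<phi> \<in> Lp_space p \<Omega>" by (rule W1pD(1)[OF \<Omega>(1) test_W1p(1)[OF \<Omega> p(1) \<phi>]])
  have w: "(\<lambda>x. m * \<omega> * \<phi> x) \<in> Lp_space p \<Omega>" "pint p \<Omega> (\<lambda>x. m * \<omega> * \<phi> x) = (m * \<omega>) powr p * pint p \<Omega> \<phi>"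
    using Lp_space_scaleR[OF \<phi>L, of "m * \<omega>"] pint_cmult[OF p(1), of \<Omega> "m * \<omega>" \<phi>] m \<omega> by auto
  have 1: "norm (T \<phi> x - \<phi> x) \<le> norm (D \<phi> x) + norm (m * \<omega> * \<phi> x)" if x: "x \<in> \<Omega>" for x
  proof -
    have "norm ((\<Sum>i\<in>I. \<integral>y. (\<rho> i (x - y) * \<phi> y) *\<^sub>R \<theta> i y \<partial>lborel) - \<phi> x *\<^sub>R (\<Sum>i\<in>I. \<theta> i x))
        \<le> 1 * D \<phi> x + real (card I) * \<omega> * \<bar>\<phi> x\<bar>"
      by (rule averaging_error[OF \<phi> continuous_\<theta>(1)]) (use \<theta>_nonneg \<theta>_le_1 \<theta>_osc(1) in auto)
    then show ?thesis
      unfolding T_test_eq(1)[OF \<phi>] \<theta>_sum[OF x] using D_nonneg[of \<phi> x] m \<omega> by (simp add: abs_mult m_def)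
  qed
  have mT: "(\<lambda>x. T \<phi> x - \<phi> x) \<in> borel_measurable (lebesgue_on \<Omega>)" "grad (T \<phi>) \<in> borel_measurable (lebesgue_on \<Omega>)"
    using test_measurable[OF T\<phi>] test_measurable[OF \<phi>]
    by (intro measurable_lebesgue_on_borel; simp)+
  have "pint p \<Omega> (\<lambda>x. T \<phi> x - \<phi> x) \<le> (1 + 1) powr b * pint p \<Omega> (D \<phi>)
      + ((1 + 1) / 1) powr b * pint p \<Omega> (\<lambda>x. m * \<omega> * \<phi> x)"
    by (rule Lp_space_dominated(2)[OF DL(1) w(1) mT(1) _ p]) (use 1 in \<open>auto simp: space_restrict_space intro!: AE_I2\<close>)
  also have "\<dots> \<le> 2 powr b * ((m * t) powr p * pint p \<Omega> (grad \<phi>)) + 2 powr b * ((m * \<omega>) powr p * pint p \<Omega> \<phi>)"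
    unfolding w(2) using DL(2) by (simp add: mult_left_mono)
  finally show "pint p \<Omega> (\<lambda>x. T \<phi> x - \<phi> x)
      \<le> 2 powr b * ((m * t) powr p * pint p \<Omega> (grad \<phi>)) + 2 powr b * ((m * \<omega>) powr p * pint p \<Omega> \<phi>)" .
  let ?R = "\<lambda>x. B * D \<phi> x + m * \<omega> * \<bar>\<phi> x\<bar>"
  have BD: "(\<lambda>x. B * D \<phi> x) \<in> Lp_space p \<Omega>" "pint p \<Omega> (\<lambda>x. B * D \<phi> x) = B powr p * pint p \<Omega> (D \<phi>)"
    using Lp_space_scaleR[OF DL(1), of B] pint_cmult[OF p(1), of \<Omega> B "D \<phi>"] B by auto
  have Rm: "?R \<in> borel_measurable (lebesgue_on \<Omega>)"
    using Lp_spaceD(1)[OF BD(1)] Lp_spaceD(1)[OF \<phi>L] by measurable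
  have Rle: "AE x in lebesgue_on \<Omega>. norm (?R x) \<le> norm (B * D \<phi> x) + norm (m * \<omega> * \<phi> x)"
    using B D_nonneg m \<omega> by (intro AE_I2) (auto simp: abs_mult)
  have R: "?R \<in> Lp_space p \<Omega>" by (rule Lp_space_dominated(1)[OF BD(1) w(1) Rm Rle p zero_less_one])
  have "pint p \<Omega> ?R \<le> (1 + 1) powr b * pint p \<Omega> (\<lambda>x. B * D \<phi> x) + ((1 + 1) / 1) powr b * pint p \<Omega> (\<lambda>x. m * \<omega> * \<phi> x)"
    by (rule Lp_space_dominated(2)[OF BD(1) w(1) Rm Rle p zero_less_one])
  also have "\<dots> \<le> 2 powr b * (B powr p * ((m * t) powr p * pint p \<Omega> (grad \<phi>)))
         + 2 powr b * ((m * \<omega>) powr p * pint p \<Omega> \<phi>)"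
    unfolding w(2) BD(2) using DL(2) by (simp add: mult_left_mono)
  finally have Rp: "pint p \<Omega> ?R \<le> 2 powr b * (B powr p * ((m * t) powr p * pint p \<Omega> (grad \<phi>)))
         + 2 powr b * ((m * \<omega>) powr p * pint p \<Omega> \<phi>)" .
  have 2: "norm (grad (T \<phi>) x) \<le> norm (G \<phi> x) + norm (?R x)" if x: "x \<in> \<Omega>" for x
  proof -
    let ?S1 = "\<Sum>i\<in>I. \<integral>y. (\<rho> i (x - y) * \<theta> i y) *\<^sub>R grad \<phi> y \<partial>lborel"
    let ?S2 = "\<Sum>i\<in>I. \<integral>y. (\<rho> i (x - y) * \<phi> y) *\<^sub>R grad (\<theta> i) y \<partial>lborel"
    have "norm (?S2 - \<phi> x *\<^sub>R (\<Sum>i\<in>I. grad (\<theta> i) x)) \<le> B * D \<phi> x + real (card I) * \<omega> * \<bar>\<phi> x\<bar>"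
      by (rule averaging_error[OF \<phi> continuous_\<theta>(2)]) (use \<theta>_grad \<theta>_osc(2) B in auto)
    then have S2: "norm ?S2 \<le> ?R x" unfolding \<theta>_grad_sum[OF x] by (simp add: m_def)
    have "norm ?S1 \<le> (\<Sum>i\<in>I. \<integral>y. \<rho> i (x - y) * \<theta> i y * norm (grad \<phi> y) \<partial>lborel)"
    proof (rule sum_norm_le)
      fix i assume i: "i \<in> I"
      have "norm (\<integral>y. (\<rho> i (x - y) * \<theta> i y) *\<^sub>R grad \<phi> y \<partial>lborel) \<le> (\<integral>y. norm ((\<rho> i (x - y) * \<theta> i y) *\<^sub>R grad \<phi> y) \<partial>lborel)"
        by (rule integral_norm_bound)
      also have "\<dots> = (\<integral>y. \<rho> i (x - y) * \<theta> i y * norm (grad \<phi> y) \<partial>lborel)"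
        using \<rho>_nonneg[OF i] \<theta>_nonneg[OF i] by (intro Bochner_Integration.integral_cong) (simp_all add: abs_mult)
      finally show "norm (\<integral>y. (\<rho> i (x - y) * \<theta> i y) *\<^sub>R grad \<phi> y \<partial>lborel) \<le> (\<integral>y. \<rho> i (x - y) * \<theta> i y * norm (grad \<phi> y) \<partial>lborel)" .
    qed
    also have "\<dots> = G \<phi> x"
    proof -
      have "integrable lborel (\<lambda>y. \<rho> i (x - y) * \<theta> i y * norm (grad \<phi> y))" if i: "i \<in> I" for i
        using integrable_norm[OF T_test_eq(3)[OF \<phi> i, of x]] \<rho>_nonneg[OF i] \<theta>_nonneg[OF i] by (simp add: abs_mult)
      then show ?thesis unfolding G_def K_def sum_distrib_right by (rule Bochner_Integration.integral_sum[symmetric])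
    qed
    finally have "norm ?S1 \<le> G \<phi> x" .
    then have "norm (grad (T \<phi>) x) \<le> G \<phi> x + ?R x"
      unfolding T_test_eq(2)[OF \<phi>] using S2 norm_triangle_ineq[of ?S1 ?S2] by linarith
    then show ?thesis unfolding real_norm_def by linarith
  qed
  have "pint p \<Omega> (grad (T \<phi>)) \<le> (1 + d) powr b * pint p \<Omega> (G \<phi>) + ((1 + d) / d) powr b * pint p \<Omega> ?R"
    by (rule Lp_space_dominated(2)[OF GL(1) R mT(2) _ p d]) (use 2 in \<open>auto simp: space_restrict_space intro!: AE_I2\<close>)
  also have "\<dots> \<le> (1 + d) powr b * ((1 + m * \<omega>) powr (p - 1) * pint p \<Omega> (grad \<phi>))
      + ((1 + d) / d) powr b * (2 powr b * (B powr p * ((m * t) powr p * pint p \<Omega> (grad \<phi>)))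
         + 2 powr b * ((m * \<omega>) powr p * pint p \<Omega> \<phi>))"
    using GL(2) Rp by (intro add_mono mult_left_mono) auto
  finally show "pint p \<Omega> (grad (T \<phi>)) \<le> (1 + d) powr b * ((1 + m * \<omega>) powr (p - 1) * pint p \<Omega> (grad \<phi>))
      + ((1 + d) / d) powr b * (2 powr b * (B powr p * ((m * t) powr p * pint p \<Omega> (grad \<phi>)))
         + 2 powr b * ((m * \<omega>) powr p * pint p \<Omega> \<phi>))" .
qed

end

subsection \<open>Lipschitz domains\<close>

text \<open>An interior cone condition, uniform near \<open>x\<close>. Moving by \<tau> along the
  chart axis gains height \<tau> over the graph; a further displacement shorter than c \<tau> loses
  at most c \<tau> in height and C c \<tau> through the slope of the graph.\<close>

lemma inward_direction:
  fixes \<Omega> :: "'a::euclidean_space set"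
  assumes L: "bounded_Lipschitz_domain \<Omega>" and x: "x \<in> closure \<Omega>"
  shows "\<exists>r e c t0. r > 0 \<and> c > 0 \<and> t0 > 0 \<and> norm e \<le> 1 \<and> c \<le> 1 \<and>
    (\<forall>y\<in>\<Omega> \<inter> ball x r. \<forall>\<tau>. 0 < \<tau> \<and> \<tau> < t0 \<longrightarrow> ball (y + \<tau> *\<^sub>R e) (c * \<tau>) \<subseteq> \<Omega>)"
proof -
  have op: "open \<Omega>" using L unfolding bounded_Lipschitz_domain_def by blast
  show ?thesis
  proof (cases "x \<in> \<Omega>")
    case True
    then obtain R where R: "R > 0" "ball x R \<subseteq> \<Omega>" using op open_contains_ball by blast
    have "ball (y + \<tau> *\<^sub>R 0) (1 * \<tau>) \<subseteq> \<Omega>" if y: "y \<in> ball x (R / 2)" and \<tau>: "\<tau> < R / 2" for y \<tau>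
    proof
      fix z assume "z \<in> ball (y + \<tau> *\<^sub>R 0) (1 * \<tau>)"
      then have "dist y z < R / 2" using \<tau> by simp
      then have "dist x z < R" using y dist_triangle[of x z y] by (simp add: dist_commute)
      then show "z \<in> \<Omega>" using R(2) by auto
    qed
    \<comment> \<open>At an interior point no shift is necessary: the direction is 0 and the
      constant is 1.\<close>
    then show ?thesis using R(1)
      by (intro exI[of _ "R / 2"] exI[of _ "0::'a"] exI[of _ "1::real"] exI[of _ "R / 2"]) auto
  next
    case False
    then have "x \<in> frontier \<Omega>" using x op by (simp add: frontier_def interior_open)
    then obtain R e \<gamma> C where R: "R > 0" "norm e = 1" "C-lipschitz_on {z. z \<bullet> e = 0} (\<gamma> :: 'a \<Rightarrow> real)"
      "\<Omega> \<inter> ball x R = {y \<in> ball x R. \<gamma> (y - (y \<bullet> e) *\<^sub>R e) < y \<bullet> e}"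
      using L unfolding bounded_Lipschitz_domain_def by blast
    have C: "C \<ge> 0" using R(3) by (rule lipschitz_on_nonneg)
    \<comment> \<open>Solves \<open>C * c + c = 1\<close>, so that the possible loss of height just
      equals the gain.\<close>
    define c where "c = 1 / (1 + C)"
    have c: "c > 0" "c \<le> 1" "C * c + c = 1"
    proof -
      have "1 + C > 0" using C by linarith
      then have "c * (1 + C) = 1" unfolding c_def by simp
      then show "C * c + c = 1" by (simp add: algebra_simps)
      show "c > 0" "c \<le> 1" unfolding c_def using C by simp_all
    qed
    have ee: "e \<bullet> e = 1" using R(2) by (simp add: dot_square_norm)
    have proj0: "(a - (a \<bullet> e) *\<^sub>R e) \<bullet> e = 0" for a by (simp add: inner_diff_left ee)
    have projle: "norm (a - (a \<bullet> e) *\<^sub>R e) \<le> norm a" for a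
    proof -
      have "(norm (a - (a \<bullet> e) *\<^sub>R e))\<^sup>2 = (norm a)\<^sup>2 - (a \<bullet> e)\<^sup>2"
        unfolding power2_norm_eq_inner
        by (simp add: inner_diff_left inner_diff_right ee inner_commute power2_eq_square)
      then have "(norm (a - (a \<bullet> e) *\<^sub>R e))\<^sup>2 \<le> (norm a)\<^sup>2" by simp
      then show ?thesis by (rule power2_le_imp_le) simp
    qed
    \<comment> \<open>The displacement from \<open>y\<close> is shorter than 2 \<tau>, thus than R /
      2, and the result stays in the ball where \<Omega> lies above the graph.\<close>
    have "ball (y + \<tau> *\<^sub>R e) (c * \<tau>) \<subseteq> \<Omega>" if y: "y \<in> \<Omega>" "y \<in> ball x (R / 2)" and \<tau>: "0 < \<tau>" "\<tau> < R / 4" for y \<tau>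
    proof
      fix z assume z: "z \<in> ball (y + \<tau> *\<^sub>R e) (c * \<tau>)"
      define a where "a = z - y - \<tau> *\<^sub>R e"
      have na: "norm a < c * \<tau>" using z by (simp add: a_def dist_norm norm_minus_commute algebra_simps)
      have zy: "z = y + \<tau> *\<^sub>R e + a" by (simp add: a_def)
      have ct: "c * \<tau> \<le> 1 * \<tau>" using c \<tau> by (intro mult_right_mono) auto
      have "norm (z - y) \<le> norm (\<tau> *\<^sub>R e) + norm a" unfolding zy using norm_triangle_ineq[of "\<tau> *\<^sub>R e" a] by simp
      moreover have "norm (\<tau> *\<^sub>R e) = \<tau>" using R(2) \<tau> by simp
      ultimately have "norm (z - y) < R / 2" using na ct \<tau> by linarith
      then have zx: "z \<in> ball x R"
        using y(2) dist_triangle[of x z y] by (simp add: dist_norm norm_minus_commute)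
      have pz: "z - (z \<bullet> e) *\<^sub>R e - (y - (y \<bullet> e) *\<^sub>R e) = a - (a \<bullet> e) *\<^sub>R e"
        unfolding zy by (simp add: inner_add_left ee algebra_simps)
      have "dist (\<gamma> (z - (z \<bullet> e) *\<^sub>R e)) (\<gamma> (y - (y \<bullet> e) *\<^sub>R e)) \<le> C * dist (z - (z \<bullet> e) *\<^sub>R e) (y - (y \<bullet> e) *\<^sub>R e)"
        by (rule lipschitz_onD[OF R(3)]) (simp_all add: proj0)
      also have "\<dots> \<le> C * norm a" unfolding dist_norm pz using C projle by (intro mult_left_mono)
      also have "\<dots> \<le> C * (c * \<tau>)" using C na by (intro mult_left_mono) auto
      finally have g: "\<gamma> (z - (z \<bullet> e) *\<^sub>R e) \<le> \<gamma> (y - (y \<bullet> e) *\<^sub>R e) + C * (c * \<tau>)" by (simp add: dist_real_def)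
      have yR: "y \<in> \<Omega> \<inter> ball x R" using y R(1) by auto
      then have gy: "\<gamma> (y - (y \<bullet> e) *\<^sub>R e) < y \<bullet> e" unfolding R(4) by blast
      have "\<bar>a \<bullet> e\<bar> \<le> norm a * norm e" by (rule Cauchy_Schwarz_ineq2)
      then have ae: "a \<bullet> e > - (c * \<tau>)" using na R(2) by simp
      have "C * (c * \<tau>) + c * \<tau> = (C * c + c) * \<tau>" by (simp add: algebra_simps)
      then have "C * (c * \<tau>) + c * \<tau> = \<tau>" using c(3) by simp
      moreover have "z \<bullet> e = y \<bullet> e + \<tau> + a \<bullet> e" unfolding zy by (simp add: inner_add_left ee)
      ultimately have "\<gamma> (z - (z \<bullet> e) *\<^sub>R e) < z \<bullet> e" using g gy ae by linarith
      then have "z \<in> \<Omega> \<inter> ball x R" unfolding R(4) using zx by blast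
      then show "z \<in> \<Omega>" by blast
    qed
    then show ?thesis using R(1,2) c
      by (intro exI[of _ "R / 2"] exI[of _ e] exI[of _ c] exI[of _ "R / 4"]) auto
  qed
qed

section \<open>A continuously differentiable partition of unity\<close>

lemma C_differentiable_compose_real:
  fixes F F' :: "real \<Rightarrow> real"
  assumes "C_differentiable (Suc 0) f" "\<And>x. (F has_real_derivative F' (f x)) (at (f x))"
    "continuous_on UNIV (\<lambda>x. F' (f x))"
  shows "C_differentiable (Suc 0) (\<lambda>x. F (f x))"
proof (rule C_differentiable_SucI)
  show "((\<lambda>x. F (f x)) has_derivative (\<lambda>h. (grad f x \<bullet> h) * F' (f x))) (at x)" for x
    by (rule DERIV_compose_FDERIV[OF assms(2) C_differentiable_Suc_derivative[OF assms(1)]])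
  show "C_differentiable 0 (\<lambda>x. (grad f x \<bullet> i) * F' (f x))" for i
    by (simp, intro continuous_intros continuous_on_grad[OF assms(1)] assms(3))
qed

text \<open>Bumps divided by their sum \<open>S\<close>, which is positive on the closure of
  \<Omega> but may vanish elsewhere. The divisor is therefore a modification of \<open>S\<close>
  that is positive, never below \<open>S\<close>, and equal to \<open>S\<close> on the
  closure.\<close>

lemma partition_of_unity:
  fixes \<Omega> J :: "'a::euclidean_space set"
  assumes J: "finite J" and r: "\<And>x. x \<in> J \<Longrightarrow> r x > 0" and cover: "closure \<Omega> \<subseteq> (\<Union>x\<in>J. ball x (r x))"
    and "bounded \<Omega>" "\<Omega> \<noteq> {}"
  obtains \<theta> where "\<And>i. i \<in> J \<Longrightarrow> C_differentiable (Suc 0) (\<theta> i)" "\<And>i x. i \<in> J \<Longrightarrow> \<theta> i x \<ge> 0"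
    "\<And>x. (\<Sum>i\<in>J. \<theta> i x) \<le> (1::real)" "\<And>x. x \<in> \<Omega> \<Longrightarrow> (\<Sum>i\<in>J. \<theta> i x) = 1"
    "\<And>i x. i \<in> J \<Longrightarrow> \<theta> i x \<noteq> 0 \<Longrightarrow> x \<in> ball i (r i)"
proof -
  define S where "S x = (\<Sum>i\<in>J. bump i (r i) x)" for x
  have S0: "S x \<ge> 0" for x unfolding S_def by (intro sum_nonneg bump_nonneg)
  have SC: "C_differentiable m S" for m
    unfolding S_def[abs_def] by (intro C_differentiable_sum C_differentiable_bump)
  have Spos: "S x > 0" if x: "x \<in> closure \<Omega>" for x
  proof -
    obtain i where i: "i \<in> J" "x \<in> ball i (r i)" using cover x by blast
    have "bump i (r i) x \<le> S x"
      unfolding S_def by (rule member_le_sum[OF i(1) _ J]) (rule bump_nonneg)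
    moreover have "bump i (r i) x > 0" using bump_pos_iff[OF r[OF i(1)]] i(2) by blast
    ultimately show ?thesis by linarith
  qed
  have "compact (closure \<Omega>)" using assms(4) by simp
  moreover have "closure \<Omega> \<noteq> {}" using assms(5) by simp
  ultimately obtain x0 where x0: "x0 \<in> closure \<Omega>" "\<And>x. x \<in> closure \<Omega> \<Longrightarrow> S x0 \<le> S x"
    using continuous_attains_inf[of "closure \<Omega>" S] C_differentiable_imp_continuous[OF SC] by blast
  define \<beta> where "\<beta> = S x0"
  have \<beta>: "\<beta> > 0" using Spos[OF x0(1)] by (simp add: \<beta>_def)
  \<comment> \<open>The flat exponential vanishes for u >= \<beta>, hence for all values of
    \<open>S\<close> on the closure, and is positive below \<beta>, in particular at 0.\<close>
  define m where "m u = u + flat_exp 0 (\<beta> - u)" for u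
  have m: "m u > 0" "u \<le> m u" if "u \<ge> 0" for u
    using that \<beta> by (auto simp: m_def flat_exp_def add_nonneg_pos)
  have m_eq: "m u = u" if "u \<ge> \<beta>" for u using that by (simp add: m_def flat_exp_def)
  define F' where "F' u = - (1 - flat_exp 2 (\<beta> - u)) / (m u)\<^sup>2" for u
  have fe: "((\<lambda>u. flat_exp 0 (\<beta> - u)) has_real_derivative - flat_exp 2 (\<beta> - u)) (at u)" for u
  proof -
    have "((\<lambda>u. \<beta> - u) has_real_derivative - 1) (at u)" by (auto intro!: derivative_eq_intros)
    from DERIV_chain2[OF flat_exp_has_derivative[of 0 "\<beta> - u"] this]
    show ?thesis by (simp add: numeral_2_eq_2)
  qed
  have F: "((\<lambda>u. inverse (m u)) has_real_derivative F' u) (at u)" if "u \<ge> 0" for u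
  proof -
    have "(m has_real_derivative 1 - flat_exp 2 (\<beta> - u)) (at u)"
      unfolding m_def[abs_def] using fe[of u] by (auto intro!: derivative_eq_intros)
    then show ?thesis
      unfolding F'_def using m(1)[OF that]
      by (auto intro!: derivative_eq_intros simp: power2_eq_square divide_inverse algebra_simps)
  qed
  have fcont: "continuous_on UNIV (flat_exp n)" for n
    by (rule DERIV_continuous_on, rule has_field_derivative_at_within[OF flat_exp_has_derivative])
  have Fcont: "continuous_on UNIV (\<lambda>x. F' (S x))"
  proof -
    have Sc: "continuous_on UNIV S" by (rule C_differentiable_imp_continuous[OF SC])
    have mS: "m (S x) \<noteq> 0" for x using m(1)[OF S0[of x]] by simp
    have "continuous_on UNIV (\<lambda>x. m (S x))"
      unfolding m_def by (intro continuous_intros Sc continuous_on_compose2[OF fcont]) auto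
    then show ?thesis
      unfolding F'_def using mS
      by (intro continuous_intros Sc continuous_on_compose2[OF fcont]) auto
  qed
  have invC: "C_differentiable (Suc 0) (\<lambda>x. inverse (m (S x)))"
    by (rule C_differentiable_compose_real[OF SC F[OF S0] Fcont])
  define \<theta> where "\<theta> i x = bump i (r i) x * inverse (m (S x))" for i x
  have sum: "(\<Sum>i\<in>J. \<theta> i x) = S x * inverse (m (S x))" for x
    by (simp add: \<theta>_def S_def sum_distrib_right)
  show ?thesis
  proof (rule that)
    show "C_differentiable (Suc 0) (\<theta> i)" for i
      unfolding \<theta>_def[abs_def] by (rule C_differentiable_mult[OF C_differentiable_bump invC])
    show "\<theta> i x \<ge> 0" for i x
      unfolding \<theta>_def using m(1)[OF S0[of x]] bump_nonneg by (intro mult_nonneg_nonneg) auto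
    show "(\<Sum>i\<in>J. \<theta> i x) \<le> 1" for x
      unfolding sum using m[OF S0[of x]] by (simp add: field_simps)
    show "(\<Sum>i\<in>J. \<theta> i x) = 1" if "x \<in> \<Omega>" for x
    proof -
      have x: "x \<in> closure \<Omega>" using that closure_subset by blast
      then have "m (S x) = S x" using x0(2) by (intro m_eq) (simp add: \<beta>_def)
      then show ?thesis unfolding sum using Spos[OF x] by simp
    qed
    show "x \<in> ball i (r i)" if "i \<in> J" "\<theta> i x \<noteq> 0" for i x
      using that bump_eq_0_iff[OF r[OF that(1)], of i x] unfolding \<theta>_def by auto
  qed
qed

section \<open>Choice of the smoothing parameters\<close>

lemma powr_le_self:
  fixes x p :: real
  assumes "0 \<le> x" "x \<le> 1" "1 \<le> p"
  shows "x powr p \<le> x"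
  using powr_mono'[of 1 p x] assms by (cases "x = 0") auto

text \<open>The choices are not circular: the cover and the partition fix the number
  \<open>m\<close> of pieces and \<open>B\<close>; \<open>d\<close> depends on \<eta> and
  \<open>b\<close>, the oscillation bound \<omega> on all of these, the scale \<open>t\<close> on
  \<omega> through uniform continuity, and the mollifiers and the margin \<open>s\<close> come last.
  No choice depends on \<open>p\<close>.\<close>

lemma smoothing_exists:
  fixes \<Omega> :: "'a::euclidean_space set" and b \<eta> :: real
  assumes L: "bounded_Lipschitz_domain \<Omega>" and b: "b \<ge> 1" and \<eta>: "\<eta> > 0"
  obtains I :: "'a set" and \<theta> \<rho> t \<omega> B s where "smoothing \<Omega> I \<theta> \<rho> t \<omega> B s"
    "\<And>p \<phi>. 1 \<le> p \<Longrightarrow> p \<le> b \<Longrightarrow> \<phi> \<in> test_functions \<Omega> \<Longrightarrow>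
      pint p \<Omega> (\<lambda>x. smoothing.T \<Omega> I \<theta> \<rho> \<phi> x - \<phi> x) \<le> \<eta> * (pint p \<Omega> \<phi> + pint p \<Omega> (grad \<phi>)) \<and>
      pint p \<Omega> (grad (smoothing.T \<Omega> I \<theta> \<rho> \<phi>)) \<le> pint p \<Omega> (grad \<phi>) + \<eta> * (pint p \<Omega> \<phi> + pint p \<Omega> (grad \<phi>))"
proof -
  have \<Omega>: "open \<Omega>" "bounded \<Omega>" "\<Omega> \<noteq> {}" using L unfolding bounded_Lipschitz_domain_def by auto
  obtain r e c t0 where ind: "\<And>x. x \<in> closure \<Omega> \<Longrightarrow> r x > 0 \<and> c x > 0 \<and> t0 x > 0 \<and> norm (e x) \<le> 1 \<and> c x \<le> 1 \<and>
    (\<forall>y\<in>\<Omega> \<inter> ball x (r x). \<forall>\<tau>. 0 < \<tau> \<and> \<tau> < t0 x \<longrightarrow> ball (y + \<tau> *\<^sub>R e x) (c x * \<tau>) \<subseteq> \<Omega>)"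
  proof -
    \<comment> \<open>The four quantities are packed into a tuple so that they are chosen
      jointly.\<close>
    have "\<forall>x\<in>closure \<Omega>. \<exists>q :: real \<times> 'a \<times> real \<times> real. case q of (r, e, c, t0) \<Rightarrow>
      r > 0 \<and> c > 0 \<and> t0 > 0 \<and> norm e \<le> 1 \<and> c \<le> 1 \<and>
      (\<forall>y\<in>\<Omega> \<inter> ball x r. \<forall>\<tau>. 0 < \<tau> \<and> \<tau> < t0 \<longrightarrow> ball (y + \<tau> *\<^sub>R e) (c * \<tau>) \<subseteq> \<Omega>)"
      using inward_direction[OF L] by force
    then obtain q where q: "\<forall>x\<in>closure \<Omega>. case q x of (r, e, c, t0) \<Rightarrow>
      r > 0 \<and> c > 0 \<and> t0 > 0 \<and> norm e \<le> 1 \<and> c \<le> 1 \<and>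
      (\<forall>y\<in>\<Omega> \<inter> ball x r. \<forall>\<tau>. 0 < \<tau> \<and> \<tau> < t0 \<longrightarrow> ball (y + \<tau> *\<^sub>R e) (c * \<tau>) \<subseteq> \<Omega>)"
      by (rule bchoice[THEN exE])
    show ?thesis
      by (rule that[of "\<lambda>x. fst (q x)" "\<lambda>x. fst (snd (snd (q x)))" "\<lambda>x. snd (snd (snd (q x)))" "\<lambda>x. fst (snd (q x))"])
        (use q in \<open>auto simp: case_prod_beta\<close>)
  qed
  have "compact (closure \<Omega>)" using \<Omega>(2) by simp
  moreover have "closure \<Omega> \<subseteq> (\<Union>x\<in>closure \<Omega>. ball x (r x))" using ind by force
  ultimately obtain J where J: "J \<subseteq> closure \<Omega>" "finite J" "closure \<Omega> \<subseteq> (\<Union>x\<in>J. ball x (r x))"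
    using compactE_image[of "closure \<Omega>" "closure \<Omega>" "\<lambda>x. ball x (r x)"] by blast
  have J0: "J \<noteq> {}" using J(3) \<Omega>(3) closure_subset by fastforce
  have rJ: "r x > 0" if "x \<in> J" for x using ind J(1) that by blast
  obtain \<theta> where \<theta>: "\<And>i. i \<in> J \<Longrightarrow> C_differentiable (Suc 0) (\<theta> i)" "\<And>i x. i \<in> J \<Longrightarrow> \<theta> i x \<ge> 0"
    "\<And>x. (\<Sum>i\<in>J. \<theta> i x) \<le> (1::real)" "\<And>x. x \<in> \<Omega> \<Longrightarrow> (\<Sum>i\<in>J. \<theta> i x) = 1"
    "\<And>i x. i \<in> J \<Longrightarrow> \<theta> i x \<noteq> 0 \<Longrightarrow> x \<in> ball i (r i)"
    using partition_of_unity[OF J(2) rJ J(3) \<Omega>(2,3)] by metis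
  have \<theta>0: "\<theta> i x = 0" "grad (\<theta> i) x = 0" if "i \<in> J" "x \<notin> cball i (r i)" for i x
  proof -
    have z: "\<theta> i y = 0" if "y \<notin> cball i (r i)" for y using \<theta>(5)[OF \<open>i \<in> J\<close>, of y] that by auto
    then show "\<theta> i x = 0" using that by blast
    show "grad (\<theta> i) x = 0" by (rule grad_outside_support(1)[OF compact_cball _ that(2)]) (rule z)
  qed
  have cont: "continuous_on UNIV (\<theta> i)" "continuous_on UNIV (grad (\<theta> i))" if "i \<in> J" for i
    using C_differentiable_imp_continuous[OF \<theta>(1)[OF that]] continuous_on_grad[OF \<theta>(1)[OF that]] by auto
  have "\<exists>B>0. \<forall>x. norm (grad (\<theta> i) x) \<le> B" if i: "i \<in> J" for i
    using bounded_compact_support[OF cont(2)[OF i] compact_cball \<theta>0(2)[OF i]] by metis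
  then obtain B' where B': "\<And>i. i \<in> J \<Longrightarrow> B' i > 0 \<and> (\<forall>x. norm (grad (\<theta> i) x) \<le> B' i)" by metis
  define B where "B = (\<Sum>i\<in>J. B' i)"
  have B'0: "B' i \<ge> 0" if "i \<in> J" for i using B'[OF that] by simp
  have B: "B \<ge> 0" "\<And>i x. i \<in> J \<Longrightarrow> norm (grad (\<theta> i) x) \<le> B"
  proof -
    show "B \<ge> 0" unfolding B_def using B'0 by (rule sum_nonneg)
    fix i x assume i: "i \<in> J"
    have "B' i \<le> B" unfolding B_def by (rule member_le_sum[OF i _ J(2)]) (use B'0 in blast)
    then show "norm (grad (\<theta> i) x) \<le> B" using B'[OF i] order_trans by blast
  qed
  define m where "m = real (card J)"
  have m: "m > 0" using J0 J(2) by (simp add: m_def card_gt_0_iff)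
  \<comment> \<open>One factor comes from splitting off the remainder, the other bounds
    \<open>(1 + m * \<omega>) powr (p - 1)\<close> once \<open>m * \<omega>\<close> is at most
    \<open>d\<close>.\<close>
  have "((\<lambda>d. (1 + d) powr b * (1 + d) powr b) \<longlongrightarrow> (1 + 0) powr b * (1 + 0) powr b) (at_right 0)"
    by (intro tendsto_intros) auto
  then have "eventually (\<lambda>d. (1 + d) powr b * (1 + d) powr b < 1 + \<eta> / 2) (at_right 0)"
    using \<eta> by (intro order_tendstoD(2)) auto
  moreover have "eventually (\<lambda>d::real. d > 0) (at_right 0)" by (simp add: eventually_at_filter)
  ultimately have "eventually (\<lambda>d. (1 + d) powr b * (1 + d) powr b < 1 + \<eta> / 2 \<and> d > 0) (at_right 0)"
    by (rule eventually_conj)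
  then obtain d where d: "d > 0" "(1 + d) powr b * (1 + d) powr b < 1 + \<eta> / 2"
    using eventually_happens'[OF trivial_limit_at_right_real] by blast
  \<comment> \<open>Majorizes every coefficient of an error term in \<open>T_estimates\<close>, for
    all exponents up to \<open>b\<close>; \<open>B + 1\<close> replaces \<open>B\<close> because its
    powers increase with the exponent.\<close>
  define Q where "Q = ((1 + d) / d) powr b * (2 powr b * (B + 1) powr b)"
  have Cd: "((1 + d) / d) powr b \<ge> 1" using d(1) b by (intro ge_one_powr_ge_zero) (auto simp: field_simps)
  have B1: "(B + 1) powr b \<ge> 1" using B(1) b by (intro ge_one_powr_ge_zero) auto
  have Q: "Q > 0" "2 powr b \<le> Q" "((1 + d) / d) powr b * 2 powr b \<le> Q"
  proof -
    have "2 powr b * 1 \<le> 2 powr b * (B + 1) powr b" using B1 by (intro mult_left_mono) auto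
    then have 1: "2 powr b \<le> 2 powr b * (B + 1) powr b" by simp
    have "1 * (2 powr b * (B + 1) powr b) \<le> Q" unfolding Q_def using Cd by (intro mult_right_mono) auto
    with 1 show 2: "2 powr b \<le> Q" by linarith
    show "((1 + d) / d) powr b * 2 powr b \<le> Q" unfolding Q_def using 1 by (intro mult_left_mono) auto
    have "(2::real) powr b > 0" by simp
    with 2 show "Q > 0" by linarith
  qed
  \<comment> \<open>The three bounds ensure \<open>m * \<omega> \<le> d\<close>, then
    \<open>m * \<omega> \<le> 1\<close>, so that its p-th power is no larger than itself, and
    finally an error of at most \<eta> / 2.\<close>
  define \<omega> where "\<omega> = min (min d 1) (\<eta> / (2 * Q)) / m"
  have \<omega>: "\<omega> > 0" "m * \<omega> \<le> d" "m * \<omega> \<le> 1" "Q * (m * \<omega>) \<le> \<eta> / 2"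
  proof -
    have pos: "min (min d 1) (\<eta> / (2 * Q)) > 0" using d(1) \<eta> Q(1) by simp
    then show "\<omega> > 0" unfolding \<omega>_def using m by simp
    have eq: "m * \<omega> = min (min d 1) (\<eta> / (2 * Q))" unfolding \<omega>_def using m by simp
    show "m * \<omega> \<le> d" "m * \<omega> \<le> 1" unfolding eq by auto
    have "Q * (m * \<omega>) \<le> Q * (\<eta> / (2 * Q))" unfolding eq using Q(1) by (intro mult_left_mono) auto
    then show "Q * (m * \<omega>) \<le> \<eta> / 2" using Q(1) by simp
  qed
  have "\<exists>\<delta>>0. \<forall>x z. norm z < \<delta> \<longrightarrow> \<bar>\<theta> i (x - z) - \<theta> i x\<bar> < \<omega> \<and> norm (grad (\<theta> i) (x - z) - grad (\<theta> i) x) < \<omega>"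
    if i: "i \<in> J" for i
  proof -
    have u: "uniformly_continuous_on UNIV (\<theta> i)" "uniformly_continuous_on UNIV (grad (\<theta> i))"
      using uniformly_continuous_compact_support[OF cont(1)[OF i] compact_cball \<theta>0(1)[OF i]]
        uniformly_continuous_compact_support[OF cont(2)[OF i] compact_cball \<theta>0(2)[OF i]] by auto
    obtain d1 where d1: "d1 > 0" "\<And>x y. dist y x < d1 \<Longrightarrow> dist (\<theta> i y) (\<theta> i x) < \<omega>"
      using uniformly_continuous_onE[OF u(1) \<omega>(1)] by (metis UNIV_I)
    obtain d2 where d2: "d2 > 0" "\<And>x y. dist y x < d2 \<Longrightarrow> dist (grad (\<theta> i) y) (grad (\<theta> i) x) < \<omega>"
      using uniformly_continuous_onE[OF u(2) \<omega>(1)] by (metis UNIV_I)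
    show ?thesis
    proof (intro exI[of _ "min d1 d2"] conjI allI impI)
      show "min d1 d2 > 0" using d1 d2 by simp
      fix x z :: 'a assume "norm z < min d1 d2"
      then have "dist (x - z) x < d1" "dist (x - z) x < d2" by (auto simp: dist_norm)
      then show "\<bar>\<theta> i (x - z) - \<theta> i x\<bar> < \<omega>" "norm (grad (\<theta> i) (x - z) - grad (\<theta> i) x) < \<omega>"
        using d1(2)[of "x - z" x] d2(2)[of "x - z" x] by (auto simp: dist_norm)
    qed
  qed
  then obtain \<delta> where \<delta>: "\<And>i. i \<in> J \<Longrightarrow> \<delta> i > 0 \<and>
      (\<forall>x z. norm z < \<delta> i \<longrightarrow> \<bar>\<theta> i (x - z) - \<theta> i x\<bar> < \<omega> \<and> norm (grad (\<theta> i) (x - z) - grad (\<theta> i) x) < \<omega>)"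
    by metis
  define \<mu> where "\<mu> = Min ((\<lambda>i. min (\<delta> i) (t0 i)) ` J)"
  have \<mu>: "\<mu> > 0" "\<And>i. i \<in> J \<Longrightarrow> \<mu> \<le> \<delta> i" "\<And>i. i \<in> J \<Longrightarrow> \<mu> \<le> t0 i"
  proof -
    show "\<mu> > 0" unfolding \<mu>_def using \<delta> ind J(1,2) J0 by (subst Min_gr_iff) auto
    have "\<mu> \<le> min (\<delta> i) (t0 i)" if "i \<in> J" for i unfolding \<mu>_def using J(2) that by (intro Min_le) auto
    then show "\<mu> \<le> \<delta> i" "\<mu> \<le> t0 i" if "i \<in> J" for i using that by fastforce+
  qed
  \<comment> \<open>Below \<mu> the shifts are admissible and the oscillations stay under \<omega>;
    the other bounds on \<open>m * t\<close> are those imposed on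
    \<open>m * \<omega>\<close>.\<close>
  define t where "t = min (\<mu> / 2) (min 1 (\<eta> / (2 * Q)) / m)"
  have t: "t > 0" "t < \<mu>" "m * t \<le> 1" "Q * (m * t) \<le> \<eta> / 2"
  proof -
    have pos: "min 1 (\<eta> / (2 * Q)) > 0" using \<eta> Q(1) by simp
    then show "t > 0" unfolding t_def using m \<mu>(1) by simp
    show "t < \<mu>" unfolding t_def using \<mu>(1) by linarith
    have "m * t \<le> m * (min 1 (\<eta> / (2 * Q)) / m)" unfolding t_def using m by (intro mult_left_mono) auto
    then have le: "m * t \<le> min 1 (\<eta> / (2 * Q))" using m by simp
    then show "m * t \<le> 1" by simp
    have "Q * (m * t) \<le> Q * (\<eta> / (2 * Q))" using Q(1) le by (intro mult_left_mono) auto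
    then show "Q * (m * t) \<le> \<eta> / 2" using Q(1) by simp
  qed
  \<comment> \<open>The length of the shift. The mollifier adds a radius of at most \<tau> / 2, so
    its support stays within distance \<open>t\<close> of the origin.\<close>
  define \<tau> where "\<tau> = t / 2"
  have \<tau>: "\<tau> > 0" "\<tau> < \<mu>" using t by (auto simp: \<tau>_def)
  have "\<exists>\<rho>. (\<forall>m. C_differentiable m \<rho>) \<and> (\<forall>x. \<rho> x \<ge> 0) \<and> (\<forall>x. x \<notin> ball (\<tau> *\<^sub>R e i) (c i * \<tau> / 2) \<longrightarrow> \<rho> x = 0) \<and>
      (\<integral>x. \<rho> x \<partial>lborel) = 1" if i: "i \<in> J" for i
  proof -
    have "c i * \<tau> / 2 > 0" using ind J(1) i \<tau>(1) by auto
    then show ?thesis using mollifier[of "c i * \<tau> / 2" "\<tau> *\<^sub>R e i"] by metis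
  qed
  then have "\<exists>\<rho>. \<forall>i\<in>J. (\<forall>m. C_differentiable m (\<rho> i)) \<and> (\<forall>x. \<rho> i x \<ge> 0) \<and>
      (\<forall>x. x \<notin> ball (\<tau> *\<^sub>R e i) (c i * \<tau> / 2) \<longrightarrow> \<rho> i x = 0) \<and> (\<integral>x. \<rho> i x \<partial>lborel) = 1"
    by (intro bchoice ballI)
  then obtain \<rho> where \<rho>: "\<forall>i\<in>J. (\<forall>m. C_differentiable m (\<rho> i)) \<and> (\<forall>x. \<rho> i x \<ge> 0) \<and>
      (\<forall>x. x \<notin> ball (\<tau> *\<^sub>R e i) (c i * \<tau> / 2) \<longrightarrow> \<rho> i x = 0) \<and> (\<integral>x. \<rho> i x \<partial>lborel) = 1"
    by (elim exE)
  \<comment> \<open>The mollifier uses half of the admissible radius \<open>c i * \<tau>\<close>;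
    the other half remains as distance to the complement.\<close>
  define s where "s = Min ((\<lambda>i. c i * \<tau> / 2) ` J)"
  have s: "s > 0" "\<And>i. i \<in> J \<Longrightarrow> s \<le> c i * \<tau> / 2"
  proof -
    show "s > 0" unfolding s_def using ind J(1,2) J0 \<tau>(1) by (subst Min_gr_iff) auto
    show "s \<le> c i * \<tau> / 2" if "i \<in> J" for i unfolding s_def using J(2) that by (intro Min_le) auto
  qed
  have near: "norm (z - \<tau> *\<^sub>R e i) < c i * \<tau> / 2" if "i \<in> J" "\<rho> i z \<noteq> 0" for i z
  proof -
    have "z \<in> ball (\<tau> *\<^sub>R e i) (c i * \<tau> / 2)" using \<rho> that by blast
    then show ?thesis by (simp add: dist_norm norm_minus_commute)
  qed
  have sm: "smoothing \<Omega> J \<theta> \<rho> t \<omega> B s"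
  proof
    show "open \<Omega>" "bounded \<Omega>" "finite J" "t > 0" "B \<ge> 0" "s > 0" by fact+
    show "\<omega> \<ge> 0" using \<omega>(1) by simp
    show "C_differentiable (Suc 0) (\<theta> i)" if "i \<in> J" for i by (rule \<theta>(1)[OF that])
    show "\<theta> i x \<ge> 0" if "i \<in> J" for i x by (rule \<theta>(2)[OF that])
    show "(\<Sum>i\<in>J. \<theta> i x) \<le> 1" for x by (rule \<theta>(3))
    show "(\<Sum>i\<in>J. \<theta> i x) = 1" if "x \<in> \<Omega>" for x by (rule \<theta>(4)[OF that])
    show "norm (grad (\<theta> i) x) \<le> B" if "i \<in> J" for i x by (rule B(2)[OF that])
    show "\<bar>\<theta> i (x - z) - \<theta> i x\<bar> \<le> \<omega>" "norm (grad (\<theta> i) (x - z) - grad (\<theta> i) x) \<le> \<omega>" if "i \<in> J" "norm z \<le> t" for i x z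
    proof -
      have "norm z < \<delta> i" using that(2) t(2) \<mu>(2)[OF that(1)] by linarith
      then show "\<bar>\<theta> i (x - z) - \<theta> i x\<bar> \<le> \<omega>" "norm (grad (\<theta> i) (x - z) - grad (\<theta> i) x) \<le> \<omega>"
        using \<delta>[OF that(1)] less_imp_le by blast+
    qed
    show "C_differentiable m (\<rho> i)" if "i \<in> J" for i m using \<rho> that by blast
    show "\<rho> i x \<ge> 0" if "i \<in> J" for i x using \<rho> that by blast
    show "(\<integral>x. \<rho> i x \<partial>lborel) = 1" if "i \<in> J" for i using \<rho> that by blast
    show "norm z \<le> t" if "i \<in> J" "\<rho> i z \<noteq> 0" for i z
    proof -
      have ci: "c i \<le> 1" "norm (e i) \<le> 1" using ind J(1) that(1) by auto
      have "c i * \<tau> \<le> 1 * \<tau>" "\<tau> * norm (e i) \<le> \<tau> * 1" using ci \<tau>(1) by (intro mult_right_mono mult_left_mono; simp)+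
      moreover have "norm z \<le> norm (z - \<tau> *\<^sub>R e i) + norm (\<tau> *\<^sub>R e i)"
        using norm_triangle_ineq[of "z - \<tau> *\<^sub>R e i" "\<tau> *\<^sub>R e i"] by simp
      moreover have "norm (\<tau> *\<^sub>R e i) = \<tau> * norm (e i)" using \<tau>(1) by simp
      ultimately show ?thesis using near[OF that] \<tau>(1) unfolding \<tau>_def by linarith
    qed
    show "ball (y + z) s \<subseteq> \<Omega>" if "i \<in> J" "y \<in> \<Omega>" "\<theta> i y \<noteq> 0" "\<rho> i z \<noteq> 0" for i y z
    proof -
      have "ball (y + z) s \<subseteq> ball (y + \<tau> *\<^sub>R e i) (c i * \<tau>)"
      proof
        fix w assume "w \<in> ball (y + z) s"
        then have "dist (y + z) w < c i * \<tau> / 2" using s(2)[OF that(1)] by simp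
        moreover have "dist (y + \<tau> *\<^sub>R e i) (y + z) < c i * \<tau> / 2"
          using near[OF that(1,4)] by (simp add: dist_norm norm_minus_commute)
        ultimately have "dist (y + \<tau> *\<^sub>R e i) w < c i * \<tau> / 2 + c i * \<tau> / 2"
          using dist_triangle[of "y + \<tau> *\<^sub>R e i" w "y + z"] by linarith
        then show "w \<in> ball (y + \<tau> *\<^sub>R e i) (c i * \<tau>)" unfolding mem_ball by linarith
      qed
      also have "\<dots> \<subseteq> \<Omega>"
        using ind J(1) that(1,2) \<theta>(5)[OF that(1,3)] \<tau> \<mu>(3)[OF that(1)] by (meson IntI order_less_le_trans subsetD)
      finally show ?thesis .
    qed
  qed
  show ?thesis
  proof (rule that[OF sm])
    fix p :: real and \<phi> assume p: "1 \<le> p" "p \<le> b" and \<phi>: "\<phi> \<in> test_functions \<Omega>"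
    let ?T = "smoothing.T \<Omega> J \<theta> \<rho>"
    let ?N = "pint p \<Omega> \<phi>" and ?E = "pint p \<Omega> (grad \<phi>)"
    have N: "?N \<ge> 0" and E: "?E \<ge> 0" by (rule pint_nonneg)+
    have mt: "(m * t) powr p \<le> m * t" using m t p by (intro powr_le_self) auto
    have mw: "(m * \<omega>) powr p \<le> m * \<omega>" using m \<omega> p by (intro powr_le_self) auto
    have mt0: "m * t \<ge> 0" and mw0: "m * \<omega> \<ge> 0" using m t(1) \<omega>(1) by simp_all
    note est = smoothing.T_estimates[OF sm J0 p d(1) \<phi>, folded m_def]
    have A: "2 powr b * ((m * t) powr p * ?E) \<le> \<eta> / 2 * ?E"
    proof -
      have "2 powr b * (m * t) powr p \<le> Q * (m * t)" using Q mt mt0 by (intro mult_mono) auto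
      then have "(2 powr b * (m * t) powr p) * ?E \<le> (\<eta> / 2) * ?E" using t(4) E by (intro mult_right_mono) auto
      then show ?thesis by (simp only: mult.assoc)
    qed
    have A': "2 powr b * ((m * \<omega>) powr p * ?N) \<le> \<eta> / 2 * ?N"
    proof -
      have "2 powr b * (m * \<omega>) powr p \<le> Q * (m * \<omega>)" using Q mw mw0 by (intro mult_mono) auto
      then have "(2 powr b * (m * \<omega>) powr p) * ?N \<le> (\<eta> / 2) * ?N" using \<omega>(4) N by (intro mult_right_mono) auto
      then show ?thesis by (simp only: mult.assoc)
    qed
    have h: "\<eta> / 2 * ?E + \<eta> / 2 * ?N \<le> \<eta> * (?N + ?E)"
    proof -
      have "\<eta> * (?N + ?E) \<ge> 0" using \<eta> N E by (intro mult_nonneg_nonneg) auto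
      then show ?thesis by (simp add: algebra_simps)
    qed
    have 1: "pint p \<Omega> (\<lambda>x. ?T \<phi> x - \<phi> x) \<le> \<eta> * (?N + ?E)" using est(1) A A' h by linarith
    have C: "(1 + d) powr b * ((1 + m * \<omega>) powr (p - 1) * ?E) \<le> (1 + \<eta> / 2) * ?E"
    proof -
      have "(1 + m * \<omega>) powr (p - 1) \<le> (1 + m * \<omega>) powr b" using mw0 p by (intro powr_mono) auto
      also have "\<dots> \<le> (1 + d) powr b" using mw0 \<omega>(2) b by (intro powr_mono2) auto
      finally have "(1 + d) powr b * (1 + m * \<omega>) powr (p - 1) \<le> (1 + d) powr b * (1 + d) powr b"
        by (intro mult_left_mono) auto
      then have "((1 + d) powr b * (1 + m * \<omega>) powr (p - 1)) * ?E \<le> (1 + \<eta> / 2) * ?E"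
        using d(2) E by (intro mult_right_mono) auto
      then show ?thesis by (simp only: mult.assoc)
    qed
    have D1: "((1 + d) / d) powr b * (2 powr b * (B powr p * ((m * t) powr p * ?E))) \<le> \<eta> / 2 * ?E"
    proof -
      have "B powr p \<le> (B + 1) powr p" using B(1) p by (intro powr_mono2) auto
      also have "\<dots> \<le> (B + 1) powr b" using B(1) p by (intro powr_mono) auto
      finally have "((1 + d) / d) powr b * (2 powr b * B powr p) \<le> Q"
        unfolding Q_def by (intro mult_left_mono) auto
      then have "((1 + d) / d) powr b * (2 powr b * B powr p) * (m * t) powr p \<le> Q * (m * t)"
        using mt Q(1) by (intro mult_mono) auto
      then have "((1 + d) / d) powr b * (2 powr b * B powr p) * (m * t) powr p * ?E \<le> \<eta> / 2 * ?E"
        using t(4) E by (intro mult_right_mono) auto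
      then show ?thesis by (simp only: mult.assoc)
    qed
    have D2: "((1 + d) / d) powr b * (2 powr b * ((m * \<omega>) powr p * ?N)) \<le> \<eta> / 2 * ?N"
    proof -
      have "((1 + d) / d) powr b * 2 powr b * (m * \<omega>) powr p \<le> Q * (m * \<omega>)"
        using mw Q by (intro mult_mono) auto
      then have "((1 + d) / d) powr b * 2 powr b * (m * \<omega>) powr p * ?N \<le> \<eta> / 2 * ?N"
        using \<omega>(4) N by (intro mult_right_mono) auto
      then show ?thesis by (simp only: mult.assoc)
    qed
    have "pint p \<Omega> (grad (?T \<phi>)) \<le> (1 + \<eta> / 2) * ?E + (\<eta> / 2 * ?E + \<eta> / 2 * ?N)"
      using est(2) C D1 D2 unfolding distrib_left by linarith
    also have "\<dots> \<le> ?E + \<eta> * (?N + ?E)"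
    proof -
      have "\<eta> * ?N \<ge> 0" using \<eta> N by simp
      then show ?thesis by (simp add: algebra_simps)
    qed
    finally show "pint p \<Omega> (\<lambda>x. ?T \<phi> x - \<phi> x) \<le> \<eta> * (?N + ?E) \<and>
        pint p \<Omega> (grad (?T \<phi>)) \<le> ?E + \<eta> * (?N + ?E)" using 1 by blast
  qed
qed

subsection \<open>Extension of the estimates to \<open>W0\<close>\<close>

text \<open>\<open>Lp_space_integrable\<close> with \<open>d\<close> so small that the constant term
  is below e / 2; with \<open>d\<close> fixed, the other term tends to 0.\<close>

lemma tendsto_L1:
  fixes w :: "'i \<Rightarrow> 'a::euclidean_space \<Rightarrow> real"
  assumes \<Omega>: "open \<Omega>" "bounded \<Omega>" and p: "p \<ge> 1" and w: "eventually (\<lambda>\<xi>. w \<xi> \<in> Lp_space p \<Omega>) F"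
    and lim: "((\<lambda>\<xi>. pint p \<Omega> (w \<xi>)) \<longlongrightarrow> 0) F"
  shows "((\<lambda>\<xi>. \<integral>x. \<bar>w \<xi> x\<bar> \<partial>lebesgue_on \<Omega>) \<longlongrightarrow> 0) F"
proof (rule order_tendstoI)
  fix a :: real assume "a < 0"
  moreover have "(\<integral>x. \<bar>w \<xi> x\<bar> \<partial>lebesgue_on \<Omega>) \<ge> 0" for \<xi> by simp
  ultimately have "a < (\<integral>x. \<bar>w \<xi> x\<bar> \<partial>lebesgue_on \<Omega>)" for \<xi> by (rule less_le_trans)
  then show "eventually (\<lambda>\<xi>. a < (\<integral>x. \<bar>w \<xi> x\<bar> \<partial>lebesgue_on \<Omega>)) F" by simp
next
  fix e :: real assume e: "0 < e"
  define V where "V = measure lebesgue \<Omega>"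
  define d where "d = e / (2 * (V + 1))"
  have V: "V \<ge> 0" by (simp add: V_def)
  have d: "d > 0" unfolding d_def using e V by (intro divide_pos_pos) auto
  have dV: "d * V < e / 2"
  proof -
    have "d * (V + 1) = e / 2" unfolding d_def using V by (simp add: field_simps)
    then show ?thesis using d by (simp add: distrib_left)
  qed
  have "((\<lambda>\<xi>. d powr (1 - p) * pint p \<Omega> (w \<xi>)) \<longlongrightarrow> d powr (1 - p) * 0) F"
    by (intro tendsto_mult tendsto_const lim)
  then have "eventually (\<lambda>\<xi>. d powr (1 - p) * pint p \<Omega> (w \<xi>) < e / 2) F"
    using e by (intro order_tendstoD(2)) auto
  with w show "eventually (\<lambda>\<xi>. (\<integral>x. \<bar>w \<xi> x\<bar> \<partial>lebesgue_on \<Omega>) < e) F"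
  proof eventually_elim
    case (elim \<xi>)
    then show ?case using Lp_space_integrable(2)[OF elim(1) \<Omega> p d] dV unfolding V_def real_norm_def by linarith
  qed
qed

context smoothing
begin

lemma integrable_W1p: "p \<ge> 1 \<Longrightarrow> u \<in> W1p p \<Omega> \<Longrightarrow> integrable (lebesgue_on \<Omega>) u"
  using Lp_space_integrable(1)[OF W1pD(1)[OF \<Omega>(1)] \<Omega> _ zero_less_one] by blast

text \<open>Convergence for the exponent \<open>p\<close> implies L^1 convergence on the bounded
  set, and the L^1 norm controls \<open>T\<close> for every \<open>q\<close>. With
  \<open>q = p\<close> this serves the density argument below, with general \<open>q\<close> the
  continuity of the transformed odd map.\<close>

lemma T_tendsto:
  assumes p: "p \<ge> 1" and q: "q \<ge> 1" and u: "u \<in> W1p p \<Omega>" and f: "eventually (\<lambda>\<xi>. f \<xi> \<in> W1p p \<Omega>) F"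
    and lim: "((\<lambda>\<xi>. sob p \<Omega> (\<lambda>x. f \<xi> x - u x)) \<longlongrightarrow> 0) F"
  shows "((\<lambda>\<xi>. sob q \<Omega> (\<lambda>x. T (f \<xi>) x - T u x)) \<longlongrightarrow> 0) F"
proof -
  obtain C where C: "C > 0"
    "\<And>u x. integrable (lebesgue_on \<Omega>) u \<Longrightarrow> \<bar>T u x\<bar> \<le> C * (\<integral>y. \<bar>u y\<bar> \<partial>lebesgue_on \<Omega>)"
    "\<And>u x. integrable (lebesgue_on \<Omega>) u \<Longrightarrow> norm (grad (T u) x) \<le> C * (\<integral>y. \<bar>u y\<bar> \<partial>lebesgue_on \<Omega>)"
    using T_bounds by blast
  let ?w = "\<lambda>\<xi> x. f \<xi> x - u x"
  let ?L = "\<lambda>\<xi>. \<integral>x. \<bar>?w \<xi> x\<bar> \<partial>lebesgue_on \<Omega>"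
  have w: "eventually (\<lambda>\<xi>. ?w \<xi> \<in> W1p p \<Omega>) F"
    using f by eventually_elim (rule W1p_diff[OF \<Omega>(1) p _ u])
  have "((\<lambda>\<xi>. pint p \<Omega> (?w \<xi>)) \<longlongrightarrow> 0) F"
    by (rule tendsto_sandwich[OF _ _ tendsto_const lim]) (auto simp: pint_nonneg pint_le_sob)
  moreover have "eventually (\<lambda>\<xi>. ?w \<xi> \<in> Lp_space p \<Omega>) F"
    using w by eventually_elim (rule W1pD(1)[OF \<Omega>(1)])
  ultimately have L: "(?L \<longlongrightarrow> 0) F" by (intro tendsto_L1[OF \<Omega> p])
  have CL0: "C * ?L \<xi> \<ge> 0" for \<xi> using C(1) by simp
  have "((\<lambda>\<xi>. (C * ?L \<xi>) powr q) \<longlongrightarrow> (C * 0) powr q) F"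
    using CL0 q by (intro tendsto_powr' tendsto_mult tendsto_const L disjI2 conjI) auto
  then have "((\<lambda>\<xi>. 2 * measure lebesgue \<Omega> * (C * ?L \<xi>) powr q) \<longlongrightarrow> 2 * measure lebesgue \<Omega> * (C * 0) powr q) F"
    by (intro tendsto_mult tendsto_const)
  then have B: "((\<lambda>\<xi>. 2 * measure lebesgue \<Omega> * (C * ?L \<xi>) powr q) \<longlongrightarrow> 0) F" by simp
  show ?thesis
  proof (rule tendsto_sandwich[OF _ _ tendsto_const B])
    show "eventually (\<lambda>\<xi>. 0 \<le> sob q \<Omega> (\<lambda>x. T (f \<xi>) x - T u x)) F" by (simp add: sob_nonneg)
    show "eventually (\<lambda>\<xi>. sob q \<Omega> (\<lambda>x. T (f \<xi>) x - T u x) \<le> 2 * measure lebesgue \<Omega> * (C * ?L \<xi>) powr q) F"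
      using f w
    proof eventually_elim
      case (elim \<xi>)
      note iw = integrable_W1p[OF p elim(2)]
      have "(\<lambda>x. T (f \<xi>) x - T u x) = T (?w \<xi>)"
        by (simp add: fun_eq_iff T_diff[OF integrable_W1p[OF p elim(1)] integrable_W1p[OF p u]])
      then show ?case
        using test_W1p(3)[OF \<Omega> q T_test[OF iw] C(2)[OF iw] C(3)[OF iw]] by simp
    qed
  qed
qed

text \<open>Both sides of each estimate are continuous along a sequence of test functions
  approaching \<open>u\<close>.\<close>

lemma T_W0_estimates:
  assumes p: "p \<ge> 1" and u: "u \<in> W0 p \<Omega>"
    and est: "\<And>\<phi>. \<phi> \<in> test_functions \<Omega> \<Longrightarrow> pint p \<Omega> (\<lambda>x. T \<phi> x - \<phi> x) \<le> \<eta> * (pint p \<Omega> \<phi> + pint p \<Omega> (grad \<phi>))"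
      "\<And>\<phi>. \<phi> \<in> test_functions \<Omega> \<Longrightarrow> pint p \<Omega> (grad (T \<phi>)) \<le> pint p \<Omega> (grad \<phi>) + \<eta> * (pint p \<Omega> \<phi> + pint p \<Omega> (grad \<phi>))"
  shows "pint p \<Omega> (\<lambda>x. T u x - u x) \<le> \<eta> * sob p \<Omega> u"
    and "energy p \<Omega> (T u) \<le> energy p \<Omega> u + \<eta> * sob p \<Omega> u"
proof -
  note u1 = W0_W1p[OF u]
  have "\<exists>\<phi>\<in>test_functions \<Omega>. sob p \<Omega> (\<lambda>x. u x - \<phi> x) < 1 / real (Suc n)" for n
    using u unfolding W0_iff[OF p] by simp
  then obtain \<phi> where \<phi>: "\<And>n. \<phi> n \<in> test_functions \<Omega>" "\<And>n. sob p \<Omega> (\<lambda>x. u x - \<phi> n x) < 1 / real (Suc n)"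
    by metis
  note \<phi>1 = test_W1p(1)[OF \<Omega> p \<phi>(1)]
  have sym: "sob p \<Omega> (\<lambda>x. \<phi> n x - u x) = sob p \<Omega> (\<lambda>x. u x - \<phi> n x)" for n
    using W1p_cmult(2)[OF \<Omega>(1) p W1p_diff[OF \<Omega>(1) p u1 \<phi>1], of "- 1" n] by simp
  have lim: "((\<lambda>n. sob p \<Omega> (\<lambda>x. \<phi> n x - u x)) \<longlongrightarrow> 0) sequentially"
  proof (rule tendsto_sandwich[OF _ _ tendsto_const LIMSEQ_inverse_real_of_nat])
    show "eventually (\<lambda>n. 0 \<le> sob p \<Omega> (\<lambda>x. \<phi> n x - u x)) sequentially" by (simp add: sob_nonneg)
    show "eventually (\<lambda>n. sob p \<Omega> (\<lambda>x. \<phi> n x - u x) \<le> inverse (real (Suc n))) sequentially"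
    proof (rule always_eventually, rule allI)
      show "sob p \<Omega> (\<lambda>x. \<phi> n x - u x) \<le> inverse (real (Suc n))" for n
        unfolding sym inverse_eq_divide by (rule less_imp_le[OF \<phi>(2)])
    qed
  qed
  have ev: "eventually (\<lambda>n. \<phi> n \<in> W1p p \<Omega>) sequentially" using \<phi>1 by simp
  have Tu: "T u \<in> W1p p \<Omega>" by (rule test_W1p(1)[OF \<Omega> p T_test[OF integrable_W1p[OF p u1]]])
  have T\<phi>: "T (\<phi> n) \<in> test_functions \<Omega>" for n by (rule T_test[OF integrable_W1p[OF p \<phi>1]])
  note T\<phi>1 = test_W1p(1)[OF \<Omega> p T\<phi>]
  have Tlim: "((\<lambda>n. sob p \<Omega> (\<lambda>x. T (\<phi> n) x - T u x)) \<longlongrightarrow> 0) sequentially"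
    by (rule T_tendsto[OF p p u1 ev lim])
  note l1 = tendsto_W1p[OF \<Omega>(1) p u1 ev lim]
  have l2: "((\<lambda>n. energy p \<Omega> (T (\<phi> n))) \<longlongrightarrow> energy p \<Omega> (T u)) sequentially"
    by (rule tendsto_W1p(2)[OF \<Omega>(1) p Tu _ Tlim]) (simp add: T\<phi>1)
  have "((\<lambda>n. 2 powr p * sob p \<Omega> (\<lambda>x. T (\<phi> n) x - T u x) + 2 powr p * sob p \<Omega> (\<lambda>x. \<phi> n x - u x))
      \<longlongrightarrow> 2 powr p * 0 + 2 powr p * 0) sequentially"
    by (intro tendsto_add tendsto_mult tendsto_const Tlim lim)
  then have B: "((\<lambda>n. 2 powr p * sob p \<Omega> (\<lambda>x. T (\<phi> n) x - T u x) + 2 powr p * sob p \<Omega> (\<lambda>x. \<phi> n x - u x)) \<longlongrightarrow> 0) sequentially"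
    by simp
  \<comment> \<open>Regrouped as the error of \<open>T\<close> plus the error of the approximation;
    the constant \<open>2 powr p\<close> comes from \<open>d = 1\<close> in
    \<open>W1p_add\<close>.\<close>
  have "((\<lambda>n. sob p \<Omega> (\<lambda>x. (T (\<phi> n) x - \<phi> n x) - (T u x - u x))) \<longlongrightarrow> 0) sequentially"
  proof (rule tendsto_sandwich[OF _ _ tendsto_const B])
    show "eventually (\<lambda>n. 0 \<le> sob p \<Omega> (\<lambda>x. (T (\<phi> n) x - \<phi> n x) - (T u x - u x))) sequentially" by (simp add: sob_nonneg)
    have "sob p \<Omega> (\<lambda>x. (T (\<phi> n) x - \<phi> n x) - (T u x - u x))
        \<le> 2 powr p * sob p \<Omega> (\<lambda>x. T (\<phi> n) x - T u x) + 2 powr p * sob p \<Omega> (\<lambda>x. \<phi> n x - u x)" for n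
    proof -
      note a = W1p_diff[OF \<Omega>(1) p T\<phi>1 Tu, of n] and b = W1p_diff[OF \<Omega>(1) p u1 \<phi>1, of n]
      have "(\<lambda>x. (T (\<phi> n) x - \<phi> n x) - (T u x - u x)) = (\<lambda>x. (T (\<phi> n) x - T u x) + (u x - \<phi> n x))"
        by (simp add: fun_eq_iff)
      then show ?thesis using W1p_add(4)[OF \<Omega>(1) p a b order_refl, of 1] unfolding sym by simp
    qed
    then show "eventually (\<lambda>n. sob p \<Omega> (\<lambda>x. (T (\<phi> n) x - \<phi> n x) - (T u x - u x))
        \<le> 2 powr p * sob p \<Omega> (\<lambda>x. T (\<phi> n) x - T u x) + 2 powr p * sob p \<Omega> (\<lambda>x. \<phi> n x - u x)) sequentially" by simp
  qed
  then have l3: "((\<lambda>n. pint p \<Omega> (\<lambda>x. T (\<phi> n) x - \<phi> n x)) \<longlongrightarrow> pint p \<Omega> (\<lambda>x. T u x - u x)) sequentially"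
    by (rule tendsto_W1p(1)[OF \<Omega>(1) p W1p_diff[OF \<Omega>(1) p Tu u1], rotated])
      (simp add: W1p_diff[OF \<Omega>(1) p T\<phi>1 \<phi>1])
  note e\<phi> = test_W1p(2)[OF \<Omega> p \<phi>(1)]
  have r: "((\<lambda>n. \<eta> * (pint p \<Omega> (\<phi> n) + energy p \<Omega> (\<phi> n))) \<longlongrightarrow> \<eta> * (pint p \<Omega> u + energy p \<Omega> u)) sequentially"
    by (intro tendsto_mult tendsto_add tendsto_const l1)
  show "pint p \<Omega> (\<lambda>x. T u x - u x) \<le> \<eta> * sob p \<Omega> u"
    unfolding sob_def
    by (rule tendsto_le[OF sequentially_bot r l3]) (use est(1)[OF \<phi>(1)] in \<open>simp add: e\<phi>\<close>)
  have r': "((\<lambda>n. energy p \<Omega> (\<phi> n) + \<eta> * (pint p \<Omega> (\<phi> n) + energy p \<Omega> (\<phi> n)))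
      \<longlongrightarrow> energy p \<Omega> u + \<eta> * (pint p \<Omega> u + energy p \<Omega> u)) sequentially"
    by (intro tendsto_mult tendsto_add tendsto_const l1)
  show "energy p \<Omega> (T u) \<le> energy p \<Omega> u + \<eta> * sob p \<Omega> u"
    unfolding sob_def
    by (rule tendsto_le[OF sequentially_bot r' l2])
      (use est(2)[OF \<phi>(1)] in \<open>simp add: e\<phi> test_W1p(2)[OF \<Omega> p T\<phi>]\<close>)
qed

end

subsection \<open>Continuity of the eigenvalues\<close>

text \<open>The sphere is mapped linearly into the span of concentric bumps with strictly decreasing
  radii. These are linearly independent, so the image avoids 0 and can be normalized.\<close>

lemma odd_sphere_map_exists:
  fixes \<Omega> :: "'a::euclidean_space set"
  assumes \<Omega>: "open \<Omega>" "bounded \<Omega>" "\<Omega> \<noteq> {}" and p: "p \<ge> 1"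
  obtains h where "odd_sphere_map k p \<Omega> h"
proof -
  let ?X = "nsphere (k - 1)"
  \<comment> \<open>Points of \<open>nsphere n\<close> have the coordinates 0 to \<open>n\<close>;
    the sums below run over exactly these.\<close>
  define n where "n = k - 1"
  obtain c r where c: "c \<in> \<Omega>" "r > 0" "cball c r \<subseteq> \<Omega>" using \<Omega>(1,3) open_contains_cball by blast
  define \<phi> where "\<phi> i = bump c (r / real (Suc i))" for i :: nat
  have rad: "r / real (Suc i) > 0" "r / real (Suc i) \<le> r" for i using c(2) by (auto simp: field_simps)
  have \<phi>: "\<phi> i \<in> test_functions \<Omega>" for i
  proof -
    have "cball c (r / real (Suc i)) \<subseteq> \<Omega>" using rad(2)[of i] c(3) subset_cball order_trans by metis
    then show ?thesis unfolding \<phi>_def by (rule bump_test_function[OF rad(1)])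
  qed
  define f where "f \<xi> x = (\<Sum>i\<le>n. \<xi> i * \<phi> i x)" for \<xi> x
  have ft: "f \<xi> \<in> test_functions \<Omega>" for \<xi>
    unfolding f_def[abs_def] by (intro test_functions_sum test_functions_cmult \<phi>)
  have "\<exists>B>0. \<forall>x. \<bar>\<phi> i x\<bar> \<le> B \<and> norm (grad (\<phi> i) x) \<le> B" for i
    using test_bounds[OF \<phi>[of i]] by metis
  then obtain B where B: "\<And>i. B i > 0 \<and> (\<forall>x. \<bar>\<phi> i x\<bar> \<le> B i \<and> norm (grad (\<phi> i) x) \<le> B i)" by metis
  have cont: "continuous_map ?X (W0_topology p \<Omega>) f"
  proof (rule continuous_map_W0I[OF p])
    show "f \<xi> \<in> W0 p \<Omega>" for \<xi> by (rule test_W0[OF \<Omega>(1,2) p ft])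
    fix \<xi> assume \<xi>: "\<xi> \<in> topspace ?X"
    let ?M = "\<lambda>\<zeta>. \<Sum>i\<le>n. \<bar>\<zeta> i - \<xi> i\<bar> * B i"
    have pr: "((\<lambda>\<zeta>. \<zeta> i) \<longlongrightarrow> \<xi> i) (atin ?X \<xi>)" for i
      using continuous_map_nsphere_projection[of "k - 1" i] \<xi> unfolding continuous_map_atin by simp
    have M0: "?M \<zeta> \<ge> 0" for \<zeta> using B less_imp_le by (intro sum_nonneg mult_nonneg_nonneg) auto
    have "(?M \<longlongrightarrow> (\<Sum>i\<le>n. \<bar>\<xi> i - \<xi> i\<bar> * B i)) (atin ?X \<xi>)"
      by (intro tendsto_sum tendsto_mult tendsto_rabs tendsto_diff tendsto_const pr)
    then have "(?M \<longlongrightarrow> 0) (atin ?X \<xi>)" by simp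
    then have "((\<lambda>\<zeta>. ?M \<zeta> powr p) \<longlongrightarrow> 0 powr p) (atin ?X \<xi>)"
      using M0 p by (intro tendsto_powr' tendsto_const disjI2 conjI) auto
    then have "((\<lambda>\<zeta>. 2 * measure lebesgue \<Omega> * ?M \<zeta> powr p) \<longlongrightarrow> 2 * measure lebesgue \<Omega> * 0 powr p) (atin ?X \<xi>)"
      by (intro tendsto_mult tendsto_const)
    then have lim: "((\<lambda>\<zeta>. 2 * measure lebesgue \<Omega> * ?M \<zeta> powr p) \<longlongrightarrow> 0) (atin ?X \<xi>)" by simp
    have le: "sob p \<Omega> (\<lambda>x. f \<zeta> x - f \<xi> x) \<le> 2 * measure lebesgue \<Omega> * ?M \<zeta> powr p" for \<zeta>
    proof -
      have eq: "(\<lambda>x. f \<zeta> x - f \<xi> x) = f (\<lambda>i. \<zeta> i - \<xi> i)"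
        by (simp add: f_def fun_eq_iff sum_subtractf[symmetric] left_diff_distrib)
      have g: "grad (f a) x = (\<Sum>i\<le>n. a i *\<^sub>R grad (\<phi> i) x)" for a x
      proof -
        have "grad (f a) x = (\<Sum>i\<le>n. grad (\<lambda>x. a i * \<phi> i x) x)"
          unfolding f_def[abs_def]
          by (intro grad_sum C_differentiable_mult C_differentiable_const test_functions_smooth[OF \<phi>])
        then show ?thesis by (simp only: grad_cmult[OF test_functions_smooth[OF \<phi>]])
      qed
      have "\<bar>f (\<lambda>i. \<zeta> i - \<xi> i) x\<bar> \<le> ?M \<zeta>" for x
        unfolding f_def using B by (intro order_trans[OF sum_abs] sum_mono) (auto simp: abs_mult intro!: mult_left_mono)
      moreover have "norm (grad (f (\<lambda>i. \<zeta> i - \<xi> i)) x) \<le> ?M \<zeta>" for x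
        unfolding g using B by (intro sum_norm_le) (auto intro!: mult_left_mono)
      ultimately show ?thesis unfolding eq by (rule test_W1p(3)[OF \<Omega>(1,2) p ft])
    qed
    show "((\<lambda>\<zeta>. sob p \<Omega> (\<lambda>x. f \<zeta> x - f \<xi> x)) \<longlongrightarrow> 0) (atin ?X \<xi>)"
      by (rule tendsto_sandwich[OF _ _ tendsto_const lim]) (auto simp: sob_nonneg le)
  qed
  have odd: "AE x in lebesgue_on \<Omega>. f (\<lambda>i. - \<xi> i) x = - f \<xi> x" for \<xi>
    by (simp add: f_def sum_negf)
  have pos: "pint p \<Omega> (f \<xi>) > 0" if \<xi>: "\<xi> \<in> topspace ?X" for \<xi>
  proof -
    have "(\<Sum>i\<le>n. (\<xi> i)\<^sup>2) = 1" using \<xi> unfolding nsphere n_def by auto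
    then have "\<exists>i. i \<le> n \<and> \<xi> i \<noteq> 0"
    proof (rule contrapos_pp)
      assume "\<not> (\<exists>i. i \<le> n \<and> \<xi> i \<noteq> 0)"
      then show "(\<Sum>i\<le>n. (\<xi> i)\<^sup>2) \<noteq> 1" by simp
    qed
    then obtain i where i: "i \<le> n" "\<xi> i \<noteq> 0" "\<And>j. j < i \<Longrightarrow> \<xi> j = 0"
      using exists_least_iff[of "\<lambda>i. i \<le> n \<and> \<xi> i \<noteq> 0"] by (metis order_less_le_trans less_imp_le)
    obtain b :: 'a where b: "b \<in> Basis" using nonempty_Basis by blast
    \<comment> \<open>\<open>i\<close> is the first nonzero coordinate, and \<open>y\<close> lies on
      the boundary of the next smaller ball: all later bumps vanish there, while bump
      \<open>i\<close> does not.\<close>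
    define y where "y = c + (r / real (Suc (Suc i))) *\<^sub>R b"
    have dy: "dist c y = r / real (Suc (Suc i))" using b c(2) by (simp add: y_def dist_norm)
    have "f \<xi> y = \<xi> i * \<phi> i y + (\<Sum>j\<in>{..n} - {i}. \<xi> j * \<phi> j y)"
      unfolding f_def using i(1) by (intro sum.remove) auto
    also have "(\<Sum>j\<in>{..n} - {i}. \<xi> j * \<phi> j y) = 0"
    proof (rule sum.neutral, rule ballI)
      fix j assume j: "j \<in> {..n} - {i}"
      show "\<xi> j * \<phi> j y = 0"
      proof (cases "j < i")
        case False
        then have "i < j" using j by auto
        then have "r / real (Suc j) \<le> r / real (Suc (Suc i))" using c(2) by (intro divide_left_mono) auto
        then have "y \<notin> ball c (r / real (Suc j))" using dy by simp
        then have "\<phi> j y = 0" unfolding \<phi>_def using bump_eq_0_iff[OF rad(1)] by blast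
        then show ?thesis by simp
      qed (use i(3) in simp)
    qed
    finally have "f \<xi> y = \<xi> i * \<phi> i y" by simp
    moreover have "y \<in> ball c (r / real (Suc i))"
      using dy c(2) by (simp add: divide_strict_left_mono)
    then have "\<phi> i y \<noteq> 0" unfolding \<phi>_def using bump_eq_0_iff[OF rad(1)] by blast
    ultimately have "f \<xi> y \<noteq> 0" using i(2) by simp
    then show ?thesis by (rule test_pint_pos[OF \<Omega>(1,2) p ft])
  qed
  show ?thesis
    using odd_sphere_map_normalize[OF \<Omega>(1,2) p cont odd pos] that by blast
qed

section \<open>Change of the exponent\<close>

lemma powr_uniform_continuity:
  fixes M b \<kappa> :: real
  assumes "\<kappa> > 0"
  obtains \<delta> where "\<delta> > 0"
    "\<And>p q s. 1 \<le> p \<Longrightarrow> p \<le> b \<Longrightarrow> 1 \<le> q \<Longrightarrow> q \<le> b \<Longrightarrow> \<bar>p - q\<bar> < \<delta> \<Longrightarrow> 0 \<le> s \<Longrightarrow> s \<le> M \<Longrightarrow> \<bar>s powr p - s powr q\<bar> < \<kappa>"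
proof -
  let ?S = "{0..M} \<times> {1..b}"
  \<comment> \<open>This includes the base 0, because the exponents are positive.\<close>
  have "continuous_on ?S (\<lambda>x. fst x powr snd x)"
    by (intro continuous_on_powr' continuous_intros) auto
  moreover have "compact ?S" by (intro compact_Times) auto
  ultimately have u: "uniformly_continuous_on ?S (\<lambda>x. fst x powr snd x)"
    by (rule compact_uniformly_continuous)
  have "\<exists>\<delta>>0. \<forall>x\<in>?S. \<forall>y\<in>?S. dist y x < \<delta> \<longrightarrow> dist (fst y powr snd y) (fst x powr snd x) < \<kappa>"
    using mp[OF spec[OF u[unfolded uniformly_continuous_on_def]] assms] .
  then obtain \<delta> where d: "\<delta> > 0"
    "\<forall>x\<in>?S. \<forall>y\<in>?S. dist y x < \<delta> \<longrightarrow> dist (fst y powr snd y) (fst x powr snd x) < \<kappa>"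
    by (elim exE conjE)
  show ?thesis
  proof (rule that[OF d(1)])
    fix p q s :: real assume "1 \<le> p" "p \<le> b" "1 \<le> q" "q \<le> b" "\<bar>p - q\<bar> < \<delta>" "0 \<le> s" "s \<le> M"
    then show "\<bar>s powr p - s powr q\<bar> < \<kappa>"
      using bspec[OF bspec[OF d(2), of "(s, q)"], of "(s, p)"] by (simp add: dist_Pair_Pair dist_real_def)
  qed
qed

text \<open>Powers with close exponents are uniformly close only for bases in a bounded range; the
  pointwise bounds on the smoothed functions provide such a range.\<close>

lemma pint_exponent_change:
  fixes f :: "'a::euclidean_space \<Rightarrow> 'b::euclidean_space"
  assumes \<Omega>: "open \<Omega>" "bounded \<Omega>" and p: "p \<ge> 1" and q: "q \<ge> 1" and f: "f \<in> borel_measurable (lebesgue_on \<Omega>)"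
    and M: "\<And>x. norm (f x) \<le> M" and close: "\<And>s. 0 \<le> s \<Longrightarrow> s \<le> M \<Longrightarrow> \<bar>s powr p - s powr q\<bar> \<le> \<kappa>"
  shows "\<bar>pint p \<Omega> f - pint q \<Omega> f\<bar> \<le> \<kappa> * measure lebesgue \<Omega>"
proof -
  have \<Omega>': "\<Omega> \<in> lmeasurable" using \<Omega> by (simp add: lmeasurable_open)
  have c: "integrable (lebesgue_on \<Omega>) (\<lambda>x. \<kappa>)"
    by (rule finite_measure.integrable_const[OF finite_measure_lebesgue_on[OF \<Omega>']])
  note i = Lp_spaceD(2)[OF Lp_space_bounded(1)[OF \<Omega> p f M]] and j = Lp_spaceD(2)[OF Lp_space_bounded(1)[OF \<Omega> q f M]]
  have "\<bar>pint p \<Omega> f - pint q \<Omega> f\<bar> = norm (\<integral>x. norm (f x) powr p - norm (f x) powr q \<partial>lebesgue_on \<Omega>)"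
    unfolding pint_def using i j by simp
  also have "\<dots> \<le> (\<integral>x. norm (norm (f x) powr p - norm (f x) powr q) \<partial>lebesgue_on \<Omega>)"
    by (rule integral_norm_bound)
  also have "\<dots> \<le> (\<integral>x. \<kappa> \<partial>lebesgue_on \<Omega>)"
    by (rule integral_mono[OF integrable_norm[OF Bochner_Integration.integrable_diff[OF i j]] c])
      (use M close in simp)
  also have "\<dots> = \<kappa> * measure lebesgue \<Omega>"
    using \<Omega>' by (simp add: measure_restrict_space fmeasurableD)
  finally show ?thesis .
qed

text \<open>\<delta> has to be found before \<open>p\<close> and \<open>q\<close>, so the operator
  and the bound \<open>M\<close> depend on \<open>b\<close>, \<open>c\<close>, \<epsilon> and the
  domain only. A nearly optimal map for \<open>p\<close> is smoothed, its integrals are compared for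
  the exponents \<open>p\<close> and \<open>q\<close>, and it is normalized for
  \<open>q\<close>.\<close>

lemma lambda_DR_step:
  fixes \<Omega> :: "'a::euclidean_space set" and b c \<epsilon> :: real
  assumes L: "bounded_Lipschitz_domain \<Omega>" and b: "b \<ge> 1" and c: "c \<ge> 0" and \<epsilon>: "\<epsilon> > 0" "\<epsilon> \<le> 1"
  obtains \<delta> where "\<delta> > 0" "\<And>p q. 1 \<le> p \<Longrightarrow> p \<le> b \<Longrightarrow> 1 \<le> q \<Longrightarrow> q \<le> b \<Longrightarrow> \<bar>p - q\<bar> < \<delta> \<Longrightarrow>
      lambda_DR k p \<Omega> \<le> c \<Longrightarrow> lambda_DR k q \<Omega> \<le> lambda_DR k p \<Omega> + \<epsilon>"
proof -
  have dom: "open \<Omega>" "bounded \<Omega>" "\<Omega> \<noteq> {}" using L unfolding bounded_Lipschitz_domain_def by auto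
  define V where "V = measure lebesgue \<Omega>"
  have V: "V \<ge> 0" by (simp add: V_def)
  \<comment> \<open>The final inequality l + 2 \<kappa> \<le> (l + \<epsilon> / 2) (1 - 2 \<kappa>)
    means 2 \<kappa> (l + \<epsilon> / 2 + 1) \<le> \<epsilon> / 2, where l + \<epsilon> / 2 is at
    most c + 2.\<close>
  define \<kappa> where "\<kappa> = \<epsilon> / (4 * (c + 3))"
  have \<kappa>: "\<kappa> > 0" "\<kappa> * (c + 3) = \<epsilon> / 4" "\<kappa> \<le> 1 / 4"
  proof -
    show "\<kappa> > 0" unfolding \<kappa>_def using \<epsilon> c by simp
    show e: "\<kappa> * (c + 3) = \<epsilon> / 4" unfolding \<kappa>_def using c by (simp add: field_simps)
    have "\<kappa> * 1 \<le> \<kappa> * (c + 3)" using \<open>\<kappa> > 0\<close> c by (intro mult_left_mono) auto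
    then show "\<kappa> \<le> 1 / 4" using e \<epsilon>(2) by linarith
  qed
  obtain \<delta>1 where \<delta>1: "\<delta>1 > 0" "\<And>B D. 0 \<le> B \<Longrightarrow> 0 \<le> D \<Longrightarrow> D < \<delta>1 \<Longrightarrow>
      (\<And>d. d > 0 \<Longrightarrow> B \<le> (1 + d) powr b * 1 + ((1 + d) / d) powr b * D) \<Longrightarrow>
      (\<And>d. d > 0 \<Longrightarrow> 1 \<le> (1 + d) powr b * B + ((1 + d) / d) powr b * D) \<Longrightarrow> \<bar>B - 1\<bar> < \<kappa>"
    using quasi_continuity[OF zero_le_one \<kappa>(1), of b] by metis
  \<comment> \<open>The Sobolev integrals along the chosen map are at most \<open>c + 2\<close>; so
    smoothing perturbs by less than \<delta>1 in L^p and raises the energy by at most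
    \<kappa>.\<close>
  define \<eta> where "\<eta> = min (\<delta>1 / 2) \<kappa> / (c + 2)"
  have \<eta>: "\<eta> > 0" "\<eta> * (c + 2) < \<delta>1" "\<eta> * (c + 2) \<le> \<kappa>"
  proof -
    show "\<eta> > 0" unfolding \<eta>_def using \<delta>1(1) \<kappa>(1) c by simp
    have "\<eta> * (c + 2) = min (\<delta>1 / 2) \<kappa>" unfolding \<eta>_def using c by simp
    then show "\<eta> * (c + 2) < \<delta>1" "\<eta> * (c + 2) \<le> \<kappa>" using \<delta>1(1) by auto
  qed
  obtain I :: "'a set" and \<theta> \<rho> t \<omega> B s where sm: "smoothing \<Omega> I \<theta> \<rho> t \<omega> B s"
    and est: "\<And>p \<phi>. 1 \<le> p \<Longrightarrow> p \<le> b \<Longrightarrow> \<phi> \<in> test_functions \<Omega> \<Longrightarrow>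
      pint p \<Omega> (\<lambda>x. smoothing.T \<Omega> I \<theta> \<rho> \<phi> x - \<phi> x) \<le> \<eta> * (pint p \<Omega> \<phi> + pint p \<Omega> (grad \<phi>)) \<and>
      pint p \<Omega> (grad (smoothing.T \<Omega> I \<theta> \<rho> \<phi>)) \<le> pint p \<Omega> (grad \<phi>) + \<eta> * (pint p \<Omega> \<phi> + pint p \<Omega> (grad \<phi>))"
    using smoothing_exists[OF L b \<eta>(1)] by blast
  interpret smoothing \<Omega> I \<theta> \<rho> t \<omega> B s by (rule sm)
  obtain C where C: "C > 0"
    "\<And>u x. integrable (lebesgue_on \<Omega>) u \<Longrightarrow> \<bar>T u x\<bar> \<le> C * (\<integral>y. \<bar>u y\<bar> \<partial>lebesgue_on \<Omega>)"
    "\<And>u x. integrable (lebesgue_on \<Omega>) u \<Longrightarrow> norm (grad (T u) x) \<le> C * (\<integral>y. \<bar>u y\<bar> \<partial>lebesgue_on \<Omega>)"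
    using T_bounds by blast
  \<comment> \<open>An element of the unit sphere has L^1 norm at most \<open>V + 1\<close>, by
    \<open>Lp_space_integrable\<close> with \<open>d = 1\<close>.\<close>
  define M where "M = C * (V + 1)"
  define \<kappa>' where "\<kappa>' = \<kappa> / (V + 1)"
  have \<kappa>': "\<kappa>' > 0" "\<kappa>' * V \<le> \<kappa>"
  proof -
    show "\<kappa>' > 0" unfolding \<kappa>'_def using \<kappa>(1) V by (intro divide_pos_pos) auto
    then have "\<kappa>' * V \<le> \<kappa>' * (V + 1)" by (intro mult_left_mono) auto
    also have "\<dots> = \<kappa>" unfolding \<kappa>'_def using V by (simp add: add_nonneg_eq_0_iff)
    finally show "\<kappa>' * V \<le> \<kappa>" .
  qed
  obtain \<delta> where \<delta>: "\<delta> > 0"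
    "\<And>p q s. 1 \<le> p \<Longrightarrow> p \<le> b \<Longrightarrow> 1 \<le> q \<Longrightarrow> q \<le> b \<Longrightarrow> \<bar>p - q\<bar> < \<delta> \<Longrightarrow> 0 \<le> s \<Longrightarrow> s \<le> M \<Longrightarrow> \<bar>s powr p - s powr q\<bar> < \<kappa>'"
    using powr_uniform_continuity[OF \<kappa>'(1), of b M] by metis
  show ?thesis
  proof (rule that[OF \<delta>(1)])
    fix p q assume p: "1 \<le> p" "p \<le> b" and q: "1 \<le> q" "q \<le> b" and pq: "\<bar>p - q\<bar> < \<delta>" and lam: "lambda_DR k p \<Omega> \<le> c"
    let ?X = "nsphere (k - 1)"
    obtain g where "odd_sphere_map k p \<Omega> g" using odd_sphere_map_exists[OF dom p(1)] by metis
    then obtain h where h: "odd_sphere_map k p \<Omega> h"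
      "\<And>\<xi>. \<xi> \<in> topspace ?X \<Longrightarrow> energy p \<Omega> (h \<xi>) \<le> lambda_DR k p \<Omega> + \<epsilon> / 2"
      using lambda_DR_approx[OF dom(1) p(1), of k g "\<epsilon> / 2"] \<epsilon>(1) by auto
    define l where "l = lambda_DR k p \<Omega> + \<epsilon> / 2"
    have l: "l \<le> c + 1" using lam \<epsilon>(2) by (simp add: l_def)
    define f where "f \<xi> = T (h \<xi>)" for \<xi>
    have hW: "h \<xi> \<in> W0 p \<Omega>" "pint p \<Omega> (h \<xi>) = 1" "energy p \<Omega> (h \<xi>) \<le> l" if "\<xi> \<in> topspace ?X" for \<xi>
      using odd_sphere_mapD(1,2)[OF h(1) that] h(2)[OF that] by (auto simp: l_def)
    have hi: "integrable (lebesgue_on \<Omega>) (h \<xi>)" if "\<xi> \<in> topspace ?X" for \<xi>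
      by (rule integrable_W1p[OF p(1) W0_W1p[OF hW(1)[OF that]]])
    have ft: "f \<xi> \<in> test_functions \<Omega>" if "\<xi> \<in> topspace ?X" for \<xi>
      unfolding f_def by (rule T_test[OF hi[OF that]])
    have key: "pint q \<Omega> (f \<xi>) \<ge> 1 - 2 * \<kappa>" "energy q \<Omega> (f \<xi>) \<le> l + 2 * \<kappa>" if \<xi>: "\<xi> \<in> topspace ?X" for \<xi>
    proof -
      let ?u = "h \<xi>"
      note u = hW[OF \<xi>] and u1 = W0_W1p[OF hW(1)[OF \<xi>]] and f1 = test_W1p(1)[OF dom(1,2) p(1) ft[OF \<xi>]]
      have sobu: "sob p \<Omega> ?u \<le> c + 2" unfolding sob_def using u(2,3) l by linarith
      then have es: "\<eta> * sob p \<Omega> ?u \<le> \<eta> * (c + 2)" using \<eta>(1) by (intro mult_left_mono) auto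
      note W = T_W0_estimates[OF p(1) u(1), of \<eta>, OF conjunct1[OF est[OF p]] conjunct2[OF est[OF p]]]
      have D: "pint p \<Omega> (\<lambda>x. f \<xi> x - ?u x) < \<delta>1" using W(1) es \<eta>(2) unfolding f_def by linarith
      have E: "energy p \<Omega> (f \<xi>) \<le> l + \<kappa>" using W(2) es \<eta>(3) u(3) unfolding f_def by linarith
      have w: "(\<lambda>x. f \<xi> x - ?u x) \<in> W1p p \<Omega>" by (rule W1p_diff[OF dom(1) p(1) f1 u1])
      have mw: "(\<lambda>x. (- 1) * (f \<xi> x - ?u x)) \<in> W1p p \<Omega>"
        "pint p \<Omega> (\<lambda>x. (- 1) * (f \<xi> x - ?u x)) = pint p \<Omega> (\<lambda>x. f \<xi> x - ?u x)"
        using W1p_cmult(1)[OF dom(1) p(1) w, of "- 1"] pint_cmult[OF p(1), of \<Omega> "- 1" "\<lambda>x. f \<xi> x - ?u x"] by simp_all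
      have "\<bar>pint p \<Omega> (f \<xi>) - 1\<bar> < \<kappa>"
      proof (rule \<delta>1(2)[OF pint_nonneg pint_nonneg D])
        show "pint p \<Omega> (f \<xi>) \<le> (1 + d) powr b * 1 + ((1 + d) / d) powr b * pint p \<Omega> (\<lambda>x. f \<xi> x - ?u x)" if "d > 0" for d
          using W1p_add(2)[OF dom(1) p(1) u1 w p(2) that] u(2) by simp
        show "1 \<le> (1 + d) powr b * pint p \<Omega> (f \<xi>) + ((1 + d) / d) powr b * pint p \<Omega> (\<lambda>x. f \<xi> x - ?u x)" if "d > 0" for d
          using W1p_add(2)[OF dom(1) p(1) f1 mw(1) p(2) that] u(2) unfolding mw(2) by simp
      qed
      then have P: "pint p \<Omega> (f \<xi>) \<ge> 1 - \<kappa>" by linarith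
      have L1: "(\<integral>y. \<bar>?u y\<bar> \<partial>lebesgue_on \<Omega>) \<le> V + 1"
        using Lp_space_integrable(2)[OF W1pD(1)[OF dom(1) u1] \<Omega>(1,2) p(1) zero_less_one] u(2) by (simp add: V_def)
      have "C * (\<integral>y. \<bar>?u y\<bar> \<partial>lebesgue_on \<Omega>) \<le> M" unfolding M_def using C(1) L1 by (intro mult_left_mono) auto
      then have b1: "norm (f \<xi> x) \<le> M" and b2: "norm (grad (f \<xi>) x) \<le> M" for x
        using C(2)[OF hi[OF \<xi>], of x] C(3)[OF hi[OF \<xi>], of x] unfolding f_def real_norm_def by linarith+
      have meas: "f \<xi> \<in> borel_measurable (lebesgue_on \<Omega>)" "grad (f \<xi>) \<in> borel_measurable (lebesgue_on \<Omega>)"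
        using test_measurable[OF ft[OF \<xi>]] by (auto intro: measurable_lebesgue_on_borel)
      have cl: "\<bar>s powr p - s powr q\<bar> \<le> \<kappa>'" if "0 \<le> s" "s \<le> M" for s
        using \<delta>(2)[OF p q pq that] by simp
      have "\<bar>pint p \<Omega> (f \<xi>) - pint q \<Omega> (f \<xi>)\<bar> \<le> \<kappa>' * V"
        unfolding V_def by (rule pint_exponent_change[OF dom(1,2) p(1) q(1) meas(1) b1 cl])
      then show "pint q \<Omega> (f \<xi>) \<ge> 1 - 2 * \<kappa>" using P \<kappa>'(2) by linarith
      have "\<bar>pint p \<Omega> (grad (f \<xi>)) - pint q \<Omega> (grad (f \<xi>))\<bar> \<le> \<kappa>' * V"
        unfolding V_def by (rule pint_exponent_change[OF dom(1,2) p(1) q(1) meas(2) b2 cl])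
      then show "energy q \<Omega> (f \<xi>) \<le> l + 2 * \<kappa>"
        using E \<kappa>'(2) unfolding test_W1p(2)[OF dom(1,2) p(1) ft[OF \<xi>]] test_W1p(2)[OF dom(1,2) q(1) ft[OF \<xi>]] by linarith
    qed
    have cm: "continuous_map ?X (W0_topology q \<Omega>) f"
    proof (rule continuous_map_W0I[OF q(1)])
      show "f \<xi> \<in> W0 q \<Omega>" if "\<xi> \<in> topspace ?X" for \<xi> by (rule test_W0[OF dom(1,2) q(1) ft[OF that]])
      fix \<xi> assume \<xi>: "\<xi> \<in> topspace ?X"
      have ev: "eventually (\<lambda>\<zeta>. h \<zeta> \<in> W1p p \<Omega>) (atin ?X \<xi>)"
        by (rule eventually_atin_openin[OF openin_topspace \<xi>]) (rule W0_W1p[OF hW(1)])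
      show "((\<lambda>\<zeta>. sob q \<Omega> (\<lambda>x. f \<zeta> x - f \<xi> x)) \<longlongrightarrow> 0) (atin ?X \<xi>)"
        unfolding f_def
        by (rule T_tendsto[OF p(1) q(1) W0_W1p[OF hW(1)[OF \<xi>]] ev
              continuous_map_W0D[OF dom(1) p(1) odd_sphere_map_continuous[OF h(1)] \<xi>]])
    qed
    have odd: "AE x in lebesgue_on \<Omega>. f (\<lambda>i. - \<xi> i) x = - f \<xi> x" if \<xi>: "\<xi> \<in> topspace ?X" for \<xi>
    proof (rule AE_I2)
      fix x
      have "- \<xi> \<in> topspace ?X" using \<xi> by (simp add: nsphere)
      then have \<xi>': "(\<lambda>i. - \<xi> i) \<in> topspace ?X" by (simp add: fun_Compl_def)
      show "f (\<lambda>i. - \<xi> i) x = - f \<xi> x"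
        unfolding f_def
        by (rule T_odd[OF odd_sphere_mapD(3)[OF h(1) \<xi>] borel_measurable_integrable[OF hi[OF \<xi>]]
              borel_measurable_integrable[OF hi[OF \<xi>']]])
    qed
    have pos: "pint q \<Omega> (f \<xi>) > 0" if "\<xi> \<in> topspace ?X" for \<xi>
      using key(1)[OF that] \<kappa>(3) by linarith
    obtain h' where h': "odd_sphere_map k q \<Omega> h'"
      "\<And>\<xi>. \<xi> \<in> topspace ?X \<Longrightarrow> energy q \<Omega> (h' \<xi>) = energy q \<Omega> (f \<xi>) / pint q \<Omega> (f \<xi>)"
      by (rule odd_sphere_map_normalize[OF dom(1,2) q(1) cm odd pos]) blast+
    have "lambda_DR k q \<Omega> \<le> l + \<epsilon> / 2"
    proof (rule lambda_DR_le[OF dom(1) q(1) h'(1)])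
      fix \<xi> assume \<xi>: "\<xi> \<in> topspace ?X"
      have l0: "l \<ge> 0" using hW(3)[OF \<xi>] energy_nonneg[of p \<Omega> "h \<xi>"] by linarith
      have "l + \<epsilon> / 2 \<le> c + 2" using l \<epsilon>(2) by linarith
      then have "\<kappa> * (l + \<epsilon> / 2) \<le> \<kappa> * (c + 2)" using \<kappa>(1) by (intro mult_left_mono) auto
      moreover have "\<kappa> * (c + 2) + \<kappa> = \<epsilon> / 4" using \<kappa>(2) by (simp add: algebra_simps)
      ultimately have "l + 2 * \<kappa> \<le> (l + \<epsilon> / 2) * (1 - 2 * \<kappa>)" by (simp add: algebra_simps)
      also have "\<dots> \<le> (l + \<epsilon> / 2) * pint q \<Omega> (f \<xi>)"
        using key(1)[OF \<xi>] l0 \<epsilon>(1) by (intro mult_left_mono) auto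
      finally have "energy q \<Omega> (f \<xi>) \<le> (l + \<epsilon> / 2) * pint q \<Omega> (f \<xi>)" using key(2)[OF \<xi>] by linarith
      then show "energy q \<Omega> (h' \<xi>) \<le> l + \<epsilon> / 2"
        unfolding h'(2)[OF \<xi>] using pos[OF \<xi>] by (simp add: divide_le_eq)
    qed
    then show "lambda_DR k q \<Omega> \<le> lambda_DR k p \<Omega> + \<epsilon>" by (simp add: l_def)
  qed
qed

lemma lambda_DR_nonneg:
  fixes \<Omega> :: "'a::euclidean_space set"
  assumes "open \<Omega>" "bounded \<Omega>" "\<Omega> \<noteq> {}" "p \<ge> 1"
  shows "lambda_DR k p \<Omega> \<ge> 0"
proof (rule field_le_epsilon)
  fix e :: real assume e: "e > 0"
  obtain g where "odd_sphere_map k p \<Omega> g" using odd_sphere_map_exists[OF assms] by metis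
  then obtain h where "\<And>\<xi>. \<xi> \<in> topspace (nsphere (k - 1)) \<Longrightarrow> energy p \<Omega> (h \<xi>) \<le> lambda_DR k p \<Omega> + e"
    using lambda_DR_approx[OF assms(1,4) _ e] by metis
  from this[OF in_topspace_nsphere] show "0 \<le> lambda_DR k p \<Omega> + e"
    using energy_nonneg order_trans by blast
qed

theorem proposition1p2:
  fixes \<Omega> :: "(real ^ 'n) set" and k :: nat
  assumes "CARD('n) \<ge> 2"
    and "bounded_Lipschitz_domain \<Omega>"
    and "k \<ge> 1"
  shows "continuous_on {1<..} (\<lambda>p. lambda_DR k p \<Omega>)"
  unfolding continuous_on_iff
proof (intro ballI allI impI)
  fix p \<epsilon> :: real assume p: "p \<in> {1<..}" and e: "\<epsilon> > 0"
  have \<Omega>: "open \<Omega>" "bounded \<Omega>" "\<Omega> \<noteq> {}" using assms(2) unfolding bounded_Lipschitz_domain_def by auto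
  let ?l = "\<lambda>p. lambda_DR k p \<Omega>"
  have "?l p \<ge> 0" using p by (intro lambda_DR_nonneg[OF \<Omega>]) auto
  then have c: "?l p + 1 \<ge> 0" by simp
  \<comment> \<open>The half makes the final inequality strict; the cap 1 keeps the eigenvalue at
    \<open>q\<close> below the bound \<open>?l p + 1\<close> used for \<open>c\<close>.\<close>
  let ?e = "min (\<epsilon> / 2) 1"
  have e': "?e > 0" "?e \<le> 1" using e by auto
  have b: "p + 1 \<ge> 1" using p by auto
  obtain \<delta> where d: "\<delta> > 0" "\<And>r q. 1 \<le> r \<Longrightarrow> r \<le> p + 1 \<Longrightarrow> 1 \<le> q \<Longrightarrow> q \<le> p + 1 \<Longrightarrow> \<bar>r - q\<bar> < \<delta> \<Longrightarrow>
      ?l r \<le> ?l p + 1 \<Longrightarrow> ?l q \<le> ?l r + ?e"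
    by (rule lambda_DR_step[OF assms(2) b c e', of k]) blast
  have "dist (?l q) (?l p) < \<epsilon>" if q: "q \<in> {1<..}" "dist q p < min \<delta> 1" for q
  proof -
    have q': "1 \<le> q" "q \<le> p + 1" "\<bar>p - q\<bar> < \<delta>" "\<bar>q - p\<bar> < \<delta>" using q by (auto simp: dist_real_def)
    have p': "1 \<le> p" "p \<le> p + 1" using p by auto
    have 1: "?l q \<le> ?l p + ?e" by (rule d(2)[OF p' q'(1-3)]) simp
    \<comment> \<open>This bound admits \<open>q\<close> as the starting exponent, so that the same
      \<delta> also gives the reverse inequality.\<close>
    then have "?l q \<le> ?l p + 1" by linarith
    then have "?l p \<le> ?l q + ?e" by (rule d(2)[OF q'(1,2) p' q'(4)])
    with 1 have "\<bar>?l q - ?l p\<bar> \<le> ?e" by linarith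
    then show ?thesis using e by (simp add: dist_real_def)
  qed
  then show "\<exists>d>0. \<forall>x'\<in>{1<..}. dist x' p < d \<longrightarrow> dist (?l x') (?l p) < \<epsilon>"
    using d(1) by (intro exI[of _ "min \<delta> 1"]) auto
qed

end
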